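(* Let $r\ge1$, $(\mu,\nu)\in\mathcal P_r(\mathcal X)\times\mathcal P_r(\mathcal Y)$ and let $C:\mathcal X\times\mathcal P_r(\mathcal Y)\to\mathbb{R}\cup\{+\infty\}$ be lower semicontinuous such that there are $K>0$ and $(x_0,y_0)\in\mathcal X\times\mathcal Y$ with \[ C(x,p)\ge -K\big(1+d_{\mathcal X}(x,x_0)^r+\mathcal W_r(p,\delta_{y_0})^r\big). \] Then \[ \inf_{P\in\Lambda(\mu,\nu)}\int C(x,p)\,P(dx,dp)=\sup_{\psi\in\Phi_r(\mathcal Y)}\Big(\nu(\psi)+\int_{\mathcal X}R_C\psi(x)\,\mu(dx)\Big) =\sup_{\substack{\phi\in\Phi_r(\mathcal X),\ \psi\in\Phi_r(\mathcal Y)\\ \phi(x)+p(\psi)\le C(x,p)\ \forall (x,p)}}\big(\nu(\psi)+\mu(\phi)\big), \] where $R_C\psi(x):=\inf\{-p(\psi)+C(x,p):p\in\mathcal P_r(\mathcal Y)\}$ and $\int R_C\psi\,d\mu:=-\infty$ whenever this integral is not well-defined.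
   Context: $\mathcal X,\mathcal Y$ are Polish spaces with compatible metrics $d_{\mathcal X},d_{\mathcal Y}$. $\mathcal P_r(\mathcal X)$ is the set of probability measures integrating $x\mapsto d_{\mathcal X}(x,x_0)^r$, equipped with the $r$-Wasserstein distance $\mathcal W_r$; $\Phi_r(\mathcal X)$ is the set of continuous functions on $\mathcal X$ bounded in absolute value by a multiple of $1+d_{\mathcal X}(x,x_0)^r$. For a measure $p$ and function $f$, $p(f)=\int f\,dp$. The intensity map $\hat I:\mathcal P(\mathcal X\times\mathcal P(\mathcal Y))\to\mathcal P(\mathcal X\times\mathcal Y)$ is defined by $\hat I(P)(f)=\int\int f(x,y)\,p(dy)\,P(dx,dp)$ for bounded continuous $f$, and $\Lambda(\mu,\nu):=\{P\in\mathcal P(\mathcal X\times\mathcal P(\mathcal Y)):\hat I(P)\text{ has marginals }\mu,\nu\}$. *)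

theory Defs
  imports "HOL-Analysis.Analysis" "HOL-Probability.Probability"
begin

text \<open>Probability measures on the Borel sets with finite r-th moment: the set P_r.
  (Finiteness of the moment does not depend on the reference point.)\<close>
definition Pr :: "real \<Rightarrow> ('a::metric_space) measure set" where
  "Pr r = {m. prob_space m \<and> sets m = sets borel \<and>
               (\<exists>x0. (\<integral>\<^sup>+ x. ennreal (dist x x0 powr r) \<partial>m) < \<infinity>)}"

definition Phi :: "real \<Rightarrow> (('a::metric_space) \<Rightarrow> real) set" where
  "Phi r = {f. continuous_on UNIV f \<and>
               (\<exists>x0 c. \<forall>x. \<bar>f x\<bar> \<le> c * (1 + dist x x0 powr r))}"

definition couplings :: "('a::metric_space) measure \<Rightarrow> 'a measure \<Rightarrow> ('a \<times> 'a) measure set" where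
  "couplings p q = {\<pi>. prob_space \<pi> \<and> sets \<pi> = sets (borel \<Otimes>\<^sub>M borel) \<and>
                        distr \<pi> borel fst = p \<and> distr \<pi> borel snd = q}"

text \<open>The r-Wasserstein distance (meaningful for measures in P_r).\<close>
definition wasserstein :: "real \<Rightarrow> ('a::metric_space) measure \<Rightarrow> 'a measure \<Rightarrow> real" where
  "wasserstein r p q =
     (enn2real (INF \<pi>\<in>couplings p q. \<integral>\<^sup>+ z. ennreal (dist (fst z) (snd z) powr r) \<partial>\<pi>)) powr (1 / r)"

definition Cb :: "(('a::topological_space) \<Rightarrow> real) set" where
  "Cb = {f. continuous_on UNIV f \<and> bounded (range f)}"

definition intensity :: "('a \<times> 'b measure) measure \<Rightarrow> ('a \<times> 'b \<Rightarrow> real) \<Rightarrow> real" where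
  "intensity P f = (\<integral>z. (\<integral>y. f (fst z, y) \<partial>(snd z)) \<partial>P)"

text \<open>Lambda(mu,nu): probability measures on X x P(Y) (P(Y) with its Borel sigma-algebra,
  here the evaluation sigma-algebra of the Giry monad) whose intensity has marginals mu, nu.\<close>
definition Lambda :: "('a::metric_space) measure \<Rightarrow> ('b::metric_space) measure \<Rightarrow>
                      ('a \<times> 'b measure) measure set" where
  "Lambda \<mu> \<nu> = {P. prob_space P \<and> sets P = sets (borel \<Otimes>\<^sub>M prob_algebra borel) \<and>
                     (\<forall>g\<in>Cb. intensity P (\<lambda>(x,y). g x) = (\<integral>x. g x \<partial>\<mu>)) \<and>
                     (\<forall>h\<in>Cb. intensity P (\<lambda>(x,y). h y) = (\<integral>y. h y \<partial>\<nu>))}"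

definition ext_integral :: "'a measure \<Rightarrow> ('a \<Rightarrow> ereal) \<Rightarrow> ereal" where
  "ext_integral M f =
     (if f \<in> borel_measurable M \<and>
         \<not> ((\<integral>\<^sup>+ x. e2ennreal (f x) \<partial>M) = \<infinity> \<and> (\<integral>\<^sup>+ x. e2ennreal (- f x) \<partial>M) = \<infinity>)
      then enn2ereal (\<integral>\<^sup>+ x. e2ennreal (f x) \<partial>M) - enn2ereal (\<integral>\<^sup>+ x. e2ennreal (- f x) \<partial>M)
      else - \<infinity>)"

text \<open>Lower semicontinuity on X x P_r(Y), P_r(Y) with the W_r metric (sequential form;
  the space is metrizable).\<close>
definition lsc_Wr :: "real \<Rightarrow> (('a::metric_space) \<Rightarrow> ('b::metric_space) measure \<Rightarrow> ereal) \<Rightarrow> bool" where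
  "lsc_Wr r C \<longleftrightarrow>
     (\<forall>x xs p ps. p \<in> Pr r \<and> (\<forall>n. ps n \<in> Pr r) \<and> xs \<longlonglongrightarrow> x \<and>
        (\<lambda>n. wasserstein r (ps n) p) \<longlonglongrightarrow> 0 \<longrightarrow> C x p \<le> liminf (\<lambda>n. C (xs n) (ps n)))"

definition RC :: "real \<Rightarrow> ('a \<Rightarrow> ('b::metric_space) measure \<Rightarrow> ereal) \<Rightarrow> ('b \<Rightarrow> real) \<Rightarrow> 'a \<Rightarrow> ereal" where
  "RC r C \<psi> x = (INF p\<in>Pr r. - ereal (\<integral>y. \<psi> y \<partial>p) + C x p)"

end

theory Submission
  imports Defs
begin

text \<open>
  Weak duality is integration of \<open>\<phi> x + p(\<psi>) \<le> C x p\<close>; what it needs is that \<open>RC r C \<psi>\<close> is universally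
  measurable, which holds because its sublevel sets are countable unions of projections of closed sets.

  For the converse let \<open>D\<close> be the dual value. The functional sending \<open>\<phi> x + p(\<psi>)\<close> to \<open>\<mu>(\<phi>) + \<nu>(\<psi>)\<close> extends,
  by Hahn--Banach, to a positive functional on all functions of bounded growth on \<open>X \<times> Pr r\<close> whose value is at most \<open>D\<close>
  on every function below \<open>C\<close>. Since \<open>\<mu>\<close> and \<open>\<nu>\<close> are tight with uniformly integrable moments, Dini's theorem
  and compactness show that it is continuous along continuous functions decreasing to zero, so that it is integration against
  some \<open>P\<close> in \<open>Lambda \<mu> \<nu>\<close>. Approximating \<open>C\<close> from below by continuous functions gives \<open>\<integral>C dP \<le> D\<close>.
\<close>

text \<open>Coupling \<open>p\<close> with a point mass by the constant map bounds
  \<open>wasserstein r p (return borel y0) powr r\<close> by the \<open>r\<close>-th moment of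
  \<open>p\<close>, so the lower bound on \<open>C\<close> takes the form
  \<open>- oplus \<phi>0 \<psi>0\<close> with \<open>\<phi>0\<close> and \<open>\<psi>0\<close> in
  \<open>Phi r\<close>. Adding \<open>oplus \<phi>0 \<psi>0\<close> makes the cost nonnegative and
  shifts every value by the same constant, because the marginals determine its integral. The
  obstacle is that \<open>X \<times> Pr r\<close> is in general not locally compact, so a positive
  functional may lose mass or moments at infinity. Daniell's criterion asks for continuity along
  decreasing sequences only, hence for compactness of sequences only. Completeness is available for
  some compatible metric, while moments refer to the metric of the type; mass and moments at
  infinity are therefore controlled by unrelated functions. Completions appear for two reasons:
  \<open>RC r C \<psi>\<close> is an infimum over an uncountable set, and \<open>C\<close> is
  constrained only for \<open>p\<close> in \<open>Pr r\<close>, a set that carries \<open>P\<close>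
  because \<open>\<nu>\<close> has a finite moment.\<close>

section \<open>Linear functionals below a sublinear functional\<close>

text \<open>Hahn--Banach in a form suited to functionals given as infima: for these, homogeneity
  comes as an inequality, and scaling by \<open>1 / c\<close> supplies the reverse one. It is
  applied to a limes superior along a sequence of measures and to the dual functional.\<close>

lemma dominated_extension:
  fixes V :: "('s \<Rightarrow> real) set" and U :: "('s \<Rightarrow> real) \<Rightarrow> real"
  assumes zero: "(\<lambda>_. 0) \<in> V"
    and add: "\<And>f g. f \<in> V \<Longrightarrow> g \<in> V \<Longrightarrow> (\<lambda>x. f x + g x) \<in> V"
    and scale: "\<And>c f. f \<in> V \<Longrightarrow> (\<lambda>x. c * f x) \<in> V"
    and sub: "\<And>f g. f \<in> V \<Longrightarrow> g \<in> V \<Longrightarrow> U (\<lambda>x. f x + g x) \<le> U f + U g"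
    and hom: "\<And>c f. f \<in> V \<Longrightarrow> c > 0 \<Longrightarrow> U (\<lambda>x. c * f x) \<le> c * U f"
  obtains l where "\<And>f. f \<in> V \<Longrightarrow> l f \<le> U f"
    and "\<And>f g. f \<in> V \<Longrightarrow> g \<in> V \<Longrightarrow> l (\<lambda>x. f x + g x) = l f + l g"
    and "\<And>c f. f \<in> V \<Longrightarrow> l (\<lambda>x. c * f x) = c * l f"
proof -
  define sl where "sl q \<longleftrightarrow> (\<forall>f\<in>V. \<forall>g\<in>V. q (\<lambda>x. f x + g x) \<le> q f + q g) \<and>
      (\<forall>f\<in>V. \<forall>c>0. q (\<lambda>x. c * f x) \<le> c * q f)" for q :: "('s \<Rightarrow> real) \<Rightarrow> real"
  \<comment> \<open>Values off \<open>V\<close> are pinned to 0, so that the order \<open>P\<close>,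
    which compares on all functions, depends on the values on \<open>V\<close> only.\<close>
  define A where "A = {q. sl q \<and> (\<forall>f\<in>V. q f \<le> U f) \<and> (\<forall>f. f \<notin> V \<longrightarrow> q f = 0)}"
  define P where "P q q' \<longleftrightarrow> (\<forall>f. q' f \<le> q f)" for q q' :: "('s \<Rightarrow> real) \<Rightarrow> real"
  have neg: "(\<lambda>x. - f x) \<in> V" if "f \<in> V" for f using scale[OF that, of "-1"] by simp
  have low: "- q (\<lambda>x. - f x) \<le> q f" if "sl q" "f \<in> V" for q f
  proof -
    have subq: "\<forall>f\<in>V. \<forall>g\<in>V. q (\<lambda>x. f x + g x) \<le> q f + q g" using that(1) by (simp add: sl_def)
    have "0 \<le> q (\<lambda>x. 0)" using bspec[OF bspec[OF subq zero] zero] by simp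
    moreover have "q (\<lambda>x. f x + - f x) \<le> q f + q (\<lambda>x. - f x)"
      using bspec[OF bspec[OF subq that(2)] neg[OF that(2)]] .
    ultimately show ?thesis by simp
  qed
  \<comment> \<open>Among the sublinear functionals below \<open>U\<close>, a minimal one is automatically linear.\<close>
  have po: "partial_order_on A (relation_of P A)"
    by (rule partial_order_on_relation_ofI) (auto simp: P_def fun_eq_iff intro: order_trans antisym)
  have "\<exists>m\<in>A. \<forall>a\<in>A. P m a \<longrightarrow> a = m"
  proof (rule predicate_Zorn[OF po])
    fix C assume C: "C \<in> Chains (relation_of P A)"
    show "\<exists>u\<in>A. \<forall>a\<in>C. P a u"
    proof (cases "C = {}")
      case True
      have "(\<lambda>f. if f \<in> V then U f else 0) \<in> A"
        by (auto simp: A_def sl_def add scale sub hom)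
      with True show ?thesis by auto
    next
      case False
      have CA: "C \<subseteq> A" using C unfolding Chains_def relation_of_def by auto
      have CC: "P a b \<or> P b a" if "a \<in> C" "b \<in> C" for a b
        using C that unfolding Chains_def relation_of_def by auto
      define u where "u f = (INF q\<in>C. q f)" for f
      have bdd: "bdd_below ((\<lambda>q. q f) ` C)" for f
      proof (cases "f \<in> V")
        case True
        have "- U (\<lambda>x. - f x) \<le> q f" if "q \<in> C" for q
        proof -
          have "q \<in> A" using that CA by blast
          then have "- q (\<lambda>x. - f x) \<le> q f" "q (\<lambda>x. - f x) \<le> U (\<lambda>x. - f x)"
            using low[of q f] True neg unfolding A_def by auto
          then show ?thesis by simp
        qed
        then show ?thesis by (auto intro!: bdd_belowI2)
      next
        case False then show ?thesis using CA by (auto simp: A_def intro!: bdd_belowI2[of _ 0])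
      qed
      have le: "u f \<le> q f" if "q \<in> C" for q f unfolding u_def by (rule cINF_lower[OF bdd that])
      have ap: "\<exists>q\<in>C. q f < u f + e" if "e > 0" for e f
        using cINF_less_iff[OF False bdd, of f "u f + e"] that unfolding u_def by auto
      have "u \<in> A" unfolding A_def sl_def
      proof (intro CollectI conjI ballI allI impI)
        fix f g assume fg: "f \<in> V" "g \<in> V"
        show "u (\<lambda>x. f x + g x) \<le> u f + u g"
        proof (rule field_le_epsilon)
          fix e :: real assume "e > 0"
          then obtain q1 q2 where q: "q1 \<in> C" "q2 \<in> C" "q1 f < u f + e/2" "q2 g < u g + e/2"
            using ap[of "e/2"] by (meson half_gt_zero)
          \<comment> \<open>In a chain the smaller of \<open>q1\<close> and \<open>q2\<close> serves
            for both functions.\<close>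
          obtain q where "q \<in> C" "q f \<le> q1 f" "q g \<le> q2 g"
            using CC[OF q(1,2)] q(1,2) unfolding P_def by (metis order_refl)
          moreover from \<open>q \<in> C\<close> have "q (\<lambda>x. f x + g x) \<le> q f + q g"
            using CA fg unfolding A_def sl_def by auto
          moreover have "u (\<lambda>x. f x + g x) \<le> q (\<lambda>x. f x + g x)" by (rule le) fact
          ultimately show "u (\<lambda>x. f x + g x) \<le> u f + u g + e" using q by simp
        qed
      next
        fix f and c :: real assume f: "f \<in> V" and c: "c > 0"
        show "u (\<lambda>x. c * f x) \<le> c * u f"
        proof (rule field_le_epsilon)
          fix e :: real assume "e > 0"
          then obtain q where q: "q \<in> C" "q f < u f + e/c" using ap[of "e/c"] c by auto
          have "u (\<lambda>x. c * f x) \<le> q (\<lambda>x. c * f x)" by (rule le) fact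
          also have "\<dots> \<le> c * q f" using CA f c q(1) unfolding A_def sl_def by auto
          also have "\<dots> \<le> c * (u f + e/c)" using q c by (intro mult_left_mono) auto
          also have "\<dots> = c * u f + e" using c by (simp add: field_simps)
          finally show "u (\<lambda>x. c * f x) \<le> c * u f + e" .
        qed
      next
        fix f assume f: "f \<in> V"
        obtain q where q: "q \<in> C" using False by blast
        then have "q f \<le> U f" using f CA unfolding A_def by blast
        with le[OF q, of f] show "u f \<le> U f" by simp
      next
        fix f assume "f \<notin> V"
        then have "q f = 0" if "q \<in> C" for q using that CA unfolding A_def by blast
        then have "(\<lambda>q. q f) ` C = {0}" using False by (auto simp: image_iff)
        then show "u f = 0" unfolding u_def by simp
      qed
      moreover have "\<forall>a\<in>C. P a u" using le unfolding P_def by auto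
      ultimately show ?thesis by auto
    qed
  qed
  then obtain l where lA: "l \<in> A" and min: "\<And>a. a \<in> A \<Longrightarrow> P l a \<Longrightarrow> a = l" by auto
  then have ll: "sl l" and lU: "\<And>f. f \<in> V \<Longrightarrow> l f \<le> U f" by (auto simp: A_def)
  have lsub: "\<And>f g. f \<in> V \<Longrightarrow> g \<in> V \<Longrightarrow> l (\<lambda>x. f x + g x) \<le> l f + l g"
    and lhom: "\<And>c f. f \<in> V \<Longrightarrow> c > 0 \<Longrightarrow> l (\<lambda>x. c * f x) \<le> c * l f"
    using ll by (auto simp: sl_def)
  have l0: "l (\<lambda>x. 0) = 0"
    using lhom[OF zero, of "1/2"] lsub[OF zero zero] by simp
  have super: "l f + l y \<le> l (\<lambda>x. f x + y x)" if f: "f \<in> V" and y: "y \<in> V" for f y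
  proof -
    \<comment> \<open>Relaxing \<open>l\<close> in the direction \<open>y\<close> gives a sublinear
      functional below \<open>l\<close>; minimality forces \<open>q = l\<close>, and the value
      \<open>t = 1\<close> in the infimum is the superadditivity that is wanted.\<close>
    define q where "q g = (if g \<in> V then INF t\<in>{0..}. l (\<lambda>x. g x + t * y x) - t * l y else 0)" for g
    have ty: "(\<lambda>x. g x + t * y x) \<in> V" if "g \<in> V" for g t using add[OF that scale[OF y]] .
    have bdd: "bdd_below ((\<lambda>t. l (\<lambda>x. g x + t * y x) - t * l y) ` {0..})" if g: "g \<in> V" for g
    proof (rule bdd_belowI2)
      fix t :: real assume "t \<in> {0..}"
      then have t: "t * l y \<le> l (\<lambda>x. t * y x)"
        using lhom[OF scale[OF y, of t], of "1/t"] l0 by (cases "t = 0") (auto simp: field_simps)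
      have "l (\<lambda>x. (g x + t * y x) + - g x) \<le> l (\<lambda>x. g x + t * y x) + l (\<lambda>x. - g x)"
        using ty g neg by (intro lsub) auto
      then show "- l (\<lambda>x. - g x) \<le> l (\<lambda>x. g x + t * y x) - t * l y" using t by simp
    qed
    have qle: "q g \<le> l (\<lambda>x. g x + t * y x) - t * l y" if "g \<in> V" "t \<ge> 0" for g t
      using cINF_lower[OF bdd[OF that(1)], of t] that by (simp add: q_def)
    have qap: "\<exists>t\<ge>0. l (\<lambda>x. g x + t * y x) - t * l y < q g + e" if "g \<in> V" "e > 0" for g e
      using cINF_less_iff[OF _ bdd[OF that(1)], of "q g + e"] that by (auto simp: q_def)
    have "q \<in> A" unfolding A_def sl_def
    proof (intro CollectI conjI ballI allI impI)
      fix g h assume gh: "g \<in> V" "h \<in> V"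
      show "q (\<lambda>x. g x + h x) \<le> q g + q h"
      proof (rule field_le_epsilon)
        fix e :: real assume "e > 0"
        then obtain s t where st: "s \<ge> 0" "t \<ge> 0" "l (\<lambda>x. g x + s * y x) - s * l y < q g + e/2"
          "l (\<lambda>x. h x + t * y x) - t * l y < q h + e/2"
          using qap[OF gh(1), of "e/2"] qap[OF gh(2), of "e/2"] by auto
        have "q (\<lambda>x. g x + h x) \<le> l (\<lambda>x. (g x + h x) + (s+t) * y x) - (s+t) * l y"
          using st add gh by (intro qle) auto
        moreover have "l (\<lambda>x. (g x + s * y x) + (h x + t * y x)) \<le> l (\<lambda>x. g x + s * y x) + l (\<lambda>x. h x + t * y x)"
          using ty gh by (intro lsub) auto
        moreover have "(\<lambda>x. (g x + s * y x) + (h x + t * y x)) = (\<lambda>x. (g x + h x) + (s+t) * y x)"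
          by (auto simp: algebra_simps)
        ultimately show "q (\<lambda>x. g x + h x) \<le> q g + q h + e" using st by (simp add: algebra_simps)
      qed
    next
      fix g and c :: real assume g: "g \<in> V" and c: "c > 0"
      show "q (\<lambda>x. c * g x) \<le> c * q g"
      proof (rule field_le_epsilon)
        fix e :: real assume "e > 0"
        then obtain t where t: "t \<ge> 0" "l (\<lambda>x. g x + t * y x) - t * l y < q g + e/c"
          using qap[OF g, of "e/c"] c by auto
        have "q (\<lambda>x. c * g x) \<le> l (\<lambda>x. c * g x + (c*t) * y x) - (c*t) * l y"
          using t c scale g by (intro qle) auto
        also have "(\<lambda>x. c * g x + (c*t) * y x) = (\<lambda>x. c * (g x + t * y x))" by (auto simp: algebra_simps)
        also have "l \<dots> \<le> c * l (\<lambda>x. g x + t * y x)" using ty g c by (intro lhom) auto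
        finally have "q (\<lambda>x. c * g x) \<le> c * (l (\<lambda>x. g x + t * y x) - t * l y)" by (simp add: algebra_simps)
        also have "\<dots> \<le> c * (q g + e/c)" using t c by (intro mult_left_mono) auto
        also have "\<dots> = c * q g + e" using c by (simp add: field_simps)
        finally show "q (\<lambda>x. c * g x) \<le> c * q g + e" .
      qed
    next
      fix g assume g: "g \<in> V"
      show "q g \<le> U g" using qle[OF g, of 0] lU[OF g] by simp
    qed (simp add: q_def)
    moreover have "q g \<le> l g" for g
    proof (cases "g \<in> V")
      case True
      then show ?thesis using qle[of g 0] by simp
    next
      case False
      then show ?thesis using lA unfolding A_def q_def by simp
    qed
    then have "P l q" unfolding P_def by blast
    ultimately have "q = l" using min by blast
    then show ?thesis using qle[OF f, of 1] by simp
  qed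
  have ladd: "l (\<lambda>x. f x + g x) = l f + l g" if "f \<in> V" "g \<in> V" for f g
    using super[OF that] lsub[OF that] by simp
  have lpos: "l (\<lambda>x. c * f x) = c * l f" if "f \<in> V" "c > 0" for c f
  proof (rule antisym[OF lhom[OF that]])
    have "l (\<lambda>x. 1/c * (c * f x)) \<le> 1/c * l (\<lambda>x. c * f x)"
      by (rule lhom) (use that scale in auto)
    moreover have "(\<lambda>x. 1/c * (c * f x)) = f" using that by auto
    ultimately have "c * l f \<le> c * (1/c * l (\<lambda>x. c * f x))" using that by (intro mult_left_mono) auto
    then show "c * l f \<le> l (\<lambda>x. c * f x)" using that by auto
  qed
  have lneg: "l (\<lambda>x. - f x) = - l f" if "f \<in> V" for f
    using ladd[OF that neg[OF that]] l0 by simp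
  have "l (\<lambda>x. c * f x) = c * l f" if "f \<in> V" for c f
  proof (cases c "0::real" rule: linorder_cases)
    case less
    then have "l (\<lambda>x. - ((-c) * f x)) = - ((-c) * l f)"
      using lneg[OF scale[OF that, of "-c"]] lpos[OF that, of "-c"] by simp
    then show ?thesis by simp
  qed (use l0 lpos that in auto)
  then show thesis using that[of l] lU ladd by blast
qed

section \<open>The Daniell--Stone theorem\<close>

text \<open>Pointwise conditions are imposed on \<open>\<Omega>\<close> although the functions are
  total: in the second application \<open>\<Omega>\<close> is the set
  \<open>UNIV \<times> Pr r\<close> inside a larger type.\<close>

locale daniell =
  fixes \<Omega> :: "'s set" and H :: "('s \<Rightarrow> real) set" and I :: "('s \<Rightarrow> real) \<Rightarrow> real"
  assumes add: "\<And>f g. f \<in> H \<Longrightarrow> g \<in> H \<Longrightarrow> (\<lambda>x. f x + g x) \<in> H"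
    and scale: "\<And>c f. f \<in> H \<Longrightarrow> (\<lambda>x. c * f x) \<in> H"
    and max: "\<And>f g. f \<in> H \<Longrightarrow> g \<in> H \<Longrightarrow> (\<lambda>x. max (f x) (g x)) \<in> H"
    and one: "(\<lambda>_. 1) \<in> H"
    and bounded: "\<And>f. f \<in> H \<Longrightarrow> \<exists>c. \<forall>x\<in>\<Omega>. \<bar>f x\<bar> \<le> c"
    and I_add: "\<And>f g. f \<in> H \<Longrightarrow> g \<in> H \<Longrightarrow> I (\<lambda>x. f x + g x) = I f + I g"
    and I_scale: "\<And>c f. f \<in> H \<Longrightarrow> I (\<lambda>x. c * f x) = c * I f"
    and I_nonneg: "\<And>f. f \<in> H \<Longrightarrow> (\<And>x. x \<in> \<Omega> \<Longrightarrow> 0 \<le> f x) \<Longrightarrow> 0 \<le> I f"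
    and I_one: "I (\<lambda>_. 1) = 1"
    and dini: "\<And>f. (\<And>n. f n \<in> H) \<Longrightarrow> (\<And>n x. x \<in> \<Omega> \<Longrightarrow> f (Suc n) x \<le> f n x) \<Longrightarrow>
        (\<And>n x. x \<in> \<Omega> \<Longrightarrow> 0 \<le> f n x) \<Longrightarrow> (\<And>x. x \<in> \<Omega> \<Longrightarrow> (\<lambda>n. f n x) \<longlonglongrightarrow> 0) \<Longrightarrow>
        (\<lambda>n. I (f n)) \<longlonglongrightarrow> 0"
begin

lemma const: "(\<lambda>_. c) \<in> H" and I_const: "I (\<lambda>_. c) = c"
  using scale[OF one, of c] I_scale[OF one, of c] by (simp_all add: I_one)

lemma diff: "f \<in> H \<Longrightarrow> g \<in> H \<Longrightarrow> (\<lambda>x. f x - g x) \<in> H"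
  and I_diff: "f \<in> H \<Longrightarrow> g \<in> H \<Longrightarrow> I (\<lambda>x. f x - g x) = I f - I g"
  using add[OF _ scale[of g "-1"], of f] I_add[OF _ scale[of g "-1"], of f] I_scale[of g "-1"]
  by (simp_all)

lemma min: "f \<in> H \<Longrightarrow> g \<in> H \<Longrightarrow> (\<lambda>x. min (f x) (g x)) \<in> H"
  using diff[OF add diff[OF max], of f g "\<lambda>_. 0" f g] diff[OF add max, of f g f g]
  by (auto simp: min_def max_def if_distrib[of "\<lambda>z. _ - z"] cong: if_cong)

lemma I_mono: "f \<in> H \<Longrightarrow> g \<in> H \<Longrightarrow> (\<And>x. x \<in> \<Omega> \<Longrightarrow> f x \<le> g x) \<Longrightarrow> I f \<le> I g"
  using I_nonneg[OF diff[of g f]] I_diff[of g f] by simp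

lemma sum: "finite A \<Longrightarrow> (\<And>i. i \<in> A \<Longrightarrow> f i \<in> H) \<Longrightarrow> (\<lambda>x. \<Sum>i\<in>A. f i x) \<in> H \<and> I (\<lambda>x. \<Sum>i\<in>A. f i x) = (\<Sum>i\<in>A. I (f i))"
  by (induction A rule: finite_induct) (auto simp: const I_const add I_add)

text \<open>The content \<open>I g - I f\<close> of the strip between the graphs of \<open>f \<le> g\<close> is countably additive: this is Dini continuity
  of \<open>I\<close> combined with countable additivity of length on each fibre. The measure of \<open>A\<close> is then the
  area of \<open>A \<times> [0,1)\<close>.\<close>

definition strip :: "('s \<Rightarrow> real) \<times> ('s \<Rightarrow> real) \<Rightarrow> ('s \<times> real) set" where
  "strip fg = {(x, t). x \<in> \<Omega> \<and> fst fg x \<le> t \<and> t < snd fg x}"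

definition idx :: "(('s \<Rightarrow> real) \<times> ('s \<Rightarrow> real)) set" where
  "idx = {(f, g). f \<in> H \<and> g \<in> H \<and> (\<forall>x\<in>\<Omega>. f x \<le> g x)}"

definition area :: "('s \<times> real) measure" where
  "area = extend_measure (\<Omega> \<times> UNIV) idx strip (\<lambda>(f, g). ennreal (I g - I f))"

lemma semiring: "semiring_of_sets (\<Omega> \<times> UNIV) (strip ` idx)"
proof
  show "strip ` idx \<subseteq> Pow (\<Omega> \<times> UNIV)" by (auto simp: strip_def)
  have "strip ((\<lambda>_. 0), (\<lambda>_. 0)) = {}" "((\<lambda>_. 0), (\<lambda>_. 0)) \<in> idx"
    by (auto simp: strip_def idx_def const)
  then show "{} \<in> strip ` idx" by (metis imageI)
  fix a b assume "a \<in> strip ` idx" "b \<in> strip ` idx"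
  then obtain f1 g1 f2 g2 where a: "a = strip (f1, g1)" "f1 \<in> H" "g1 \<in> H" "\<And>x. x \<in> \<Omega> \<Longrightarrow> f1 x \<le> g1 x"
    and b: "b = strip (f2, g2)" "f2 \<in> H" "g2 \<in> H" "\<And>x. x \<in> \<Omega> \<Longrightarrow> f2 x \<le> g2 x"
    by (auto simp: idx_def)
  let ?f = "\<lambda>x. max (f1 x) (f2 x)"
  have "a \<inter> b = strip (?f, \<lambda>x. max (?f x) (min (g1 x) (g2 x)))"
    by (auto simp: a b strip_def)
  moreover have "(?f, \<lambda>x. max (?f x) (min (g1 x) (g2 x))) \<in> idx"
    by (auto simp: idx_def a b intro!: max min)
  ultimately show "a \<inter> b \<in> strip ` idx" by auto
  \<comment> \<open>The parts of the first strip below and above the second one. The outer clamps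
    keep each lower edge below the upper edge where the strips do not meet.\<close>
  let ?A = "(f1, \<lambda>x. max (f1 x) (min (g1 x) (f2 x)))" and ?B = "(\<lambda>x. min (g1 x) (max (f1 x) (g2 x)), g1)"
  have "?A \<in> idx" "?B \<in> idx" by (auto simp: idx_def a b intro!: max min)
  moreover have "a - b = \<Union>{strip ?A, strip ?B}"
  proof (rule set_eqI)
    fix z :: "'s \<times> real"
    obtain x t where z: "z = (x, t)" by (cases z)
    show "z \<in> a - b \<longleftrightarrow> z \<in> \<Union>{strip ?A, strip ?B}"
    proof (cases "x \<in> \<Omega>")
      case True
      then show ?thesis using a(4)[OF True] b(4)[OF True] by (simp add: z a(1) b(1) strip_def) linarith
    qed (simp add: z a(1) b(1) strip_def)
  qed
  moreover have "strip ?A \<inter> strip ?B = {}"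
  proof -
    have "(x, t) \<notin> strip ?A \<inter> strip ?B" for x t
      using b(4)[of x] by (simp add: strip_def) linarith
    then show ?thesis by auto
  qed
  then have "disjoint {strip ?A, strip ?B}"
    by (auto simp: disjoint_def)
  ultimately show "\<exists>C\<subseteq>strip ` idx. finite C \<and> disjoint C \<and> a - b = \<Union>C"
    by (intro exI[of _ "{strip ?A, strip ?B}"]) auto
qed

lemma emeasure_strip:
  assumes "(f, g) \<in> idx" shows "emeasure area (strip (f, g)) = ennreal (I g - I f)"
proof -
  let ?\<mu> = "\<lambda>(f, g). ennreal (I g - I f)"
  have "emeasure area (strip (f, g)) = ?\<mu> (f, g)"
  proof (rule extend_measure_caratheodory[OF area_def assms semiring])
    fix i assume i: "i \<in> idx" "strip i = {}"
    obtain f g where fg: "i = (f, g)" by (cases i)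
    then have "g x \<le> f x" if "x \<in> \<Omega>" for x
      using i that by (auto simp: strip_def) (meson dual_order.refl linorder_not_le)
    then show "?\<mu> i = 0" using i fg I_mono[of g f] by (auto simp: idx_def ennreal_eq_0_iff)
  next
    fix i j assume ij: "i \<in> idx" "j \<in> idx" "strip i = strip j"
    obtain f g f' g' where fg: "i = (f, g)" "j = (f', g')" by (cases i, cases j)
    have "I (\<lambda>x. g x - f x) = I (\<lambda>x. g' x - f' x)"
    proof -
      have "g x - f x = g' x - f' x" if "x \<in> \<Omega>" for x
      proof -
        have "{f x..<g x} = {f' x..<g' x}" using ij(3) that by (auto simp: fg strip_def set_eq_iff)
        \<comment> \<open>Half-open intervals with the same points share both endpoints or are both
          empty; in the second case \<open>f \<le> g\<close> makes both lengths zero.\<close>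
        then have "f x = f' x \<and> g x = g' x \<or> g x \<le> f x \<and> g' x \<le> f' x"
          by (metis atLeastLessThan_empty_iff2 atLeastLessThan_eq_iff linorder_not_less atLeastLessThan_empty_iff)
        moreover have "f x \<le> g x" "f' x \<le> g' x" using ij(1,2) that by (auto simp: fg idx_def)
          ultimately show ?thesis by auto
      qed
      then show ?thesis using ij by (intro antisym I_mono) (auto simp: fg idx_def intro!: diff)
    qed
    then show "?\<mu> i = ?\<mu> j" using ij by (auto simp: fg idx_def I_diff)
  next
    fix A :: "nat \<Rightarrow> _" and j
    assume A: "A \<in> UNIV \<rightarrow> idx" and j: "j \<in> idx" and disj: "disjoint_family (strip \<circ> A)"
      and un: "(\<Union>i. strip (A i)) = strip j"
    obtain F G where FG: "j = (F, G)" by (cases j)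
    define f g where "f n = fst (A n)" and "g n = snd (A n)" for n
    have Afg: "A n = (f n, g n)" for n by (simp add: f_def g_def)
    have H: "F \<in> H" "G \<in> H" "\<And>n. f n \<in> H" "\<And>n. g n \<in> H" "\<And>x. x \<in> \<Omega> \<Longrightarrow> F x \<le> G x"
      "\<And>n x. x \<in> \<Omega> \<Longrightarrow> f n x \<le> g n x"
    proof -
      have "A n \<in> idx" for n using A by auto
      then show "\<And>n. f n \<in> H" "\<And>n. g n \<in> H" "\<And>n x. x \<in> \<Omega> \<Longrightarrow> f n x \<le> g n x"
        unfolding Afg by (auto simp: idx_def)
    qed (use j FG in \<open>auto simp: idx_def\<close>)
    have sums: "(\<lambda>n. g n x - f n x) sums (G x - F x)" if x: "x \<in> \<Omega>" for x
    proof -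
      have "disjoint_family (\<lambda>n. {f n x..<g n x})"
        unfolding disjoint_family_on_def
      proof (intro ballI impI)
        fix m n :: nat assume "m \<noteq> n"
        then have "strip (A m) \<inter> strip (A n) = {}" using disj by (auto simp: disjoint_family_on_def)
        then have "(x, t) \<notin> strip (A m) \<inter> strip (A n)" for t by blast
        then have "t \<notin> {f m x..<g m x} \<inter> {f n x..<g n x}" for t using x by (auto simp: Afg strip_def)
        then show "{f m x..<g m x} \<inter> {f n x..<g n x} = {}" by blast
      qed
      moreover have "(\<Union>n. {f n x..<g n x}) = {F x..<G x}"
        using un x by (auto simp: Afg FG strip_def set_eq_iff)
      ultimately have "(\<Sum>n. emeasure lborel {f n x..<g n x}) = emeasure lborel {F x..<G x}"
        using suminf_emeasure[of "\<lambda>n. {f n x..<g n x}" lborel] by (auto simp: image_subset_iff)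
      then have "(\<Sum>n. ennreal (g n x - f n x)) = ennreal (G x - F x)" using x H by simp
      then have "(\<lambda>n. ennreal (g n x - f n x)) sums ennreal (G x - F x)"
        by (metis summableI summable_sums)
      then show ?thesis using x H by (subst (asm) sums_ennreal) auto
    qed
    \<comment> \<open>The length still uncovered on each fibre after \<open>N\<close> strips, which
      decreases to zero pointwise.\<close>
    define h where "h N x = (G x - F x) - (\<Sum>n<N. g n x - f n x)" for N x
    have h: "h N \<in> H" "I (h N) = (I G - I F) - (\<Sum>n<N. I (g n) - I (f n))" for N
      unfolding h_def using sum[of "{..<N}" "\<lambda>n x. g n x - f n x"] H
      by (auto simp: diff I_diff)
    have "(\<lambda>N. I (h N)) \<longlonglongrightarrow> 0"
    proof (rule dini)
      fix n x assume x: "x \<in> \<Omega>"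
      show "h (Suc n) x \<le> h n x" using H x by (simp add: h_def)
      have "(\<Sum>i<n. g i x - f i x) \<le> (\<Sum>i. g i x - f i x)"
        using sums[OF x] H x by (intro sum_le_suminf) (auto simp: sums_iff)
      then show "0 \<le> h n x" using sums[OF x] by (simp add: h_def sums_iff)
    next
      fix x assume x: "x \<in> \<Omega>"
      have "(\<lambda>N. (G x - F x) - (\<Sum>n<N. g n x - f n x)) \<longlonglongrightarrow> (G x - F x) - (G x - F x)"
        using sums[OF x] unfolding sums_def by (intro tendsto_intros)
      then show "(\<lambda>n. h n x) \<longlonglongrightarrow> 0" by (simp add: h_def)
    qed (rule h)
    then have "(\<lambda>N. (I G - I F) - I (h N)) \<longlonglongrightarrow> (I G - I F) - 0" by (intro tendsto_intros)
    then have s: "(\<lambda>n. I (g n) - I (f n)) sums (I G - I F)" by (simp add: h sums_def)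
    have nn: "0 \<le> I (g n) - I (f n)" for n using H I_mono[of "f n" "g n"] by simp
    have "(\<lambda>n. ennreal (I (g n) - I (f n))) sums ennreal (I G - I F)"
      using s nn sums_le[OF nn sums_zero s] by (subst sums_ennreal) auto
    then show "(\<Sum>n. ?\<mu> (A n)) = ?\<mu> j" by (simp add: Afg FG sums_iff)
  qed auto
  then show ?thesis by simp
qed

lemma sets_area: "sets area = sigma_sets (\<Omega> \<times> UNIV) (strip ` idx)" "space area = \<Omega> \<times> UNIV"
  proof -
  have "strip ` idx \<subseteq> Pow (\<Omega> \<times> UNIV)" by (auto simp: strip_def)
  then show "sets area = sigma_sets (\<Omega> \<times> UNIV) (strip ` idx)" "space area = \<Omega> \<times> UNIV"
    unfolding area_def by (simp_all add: sets_extend_measure space_extend_measure)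
qed

section \<open>The representing measure and its integral\<close>

definition gen :: "'s set set" where "gen = {{x\<in>\<Omega>. a < f x} | a f. f \<in> H}"

definition base :: "('s \<times> real) set" where "base = strip (\<lambda>_. 0, \<lambda>_. 1)"

definition repr :: "'s measure" where
  "repr = distr (restrict_space area base) (sigma \<Omega> gen) fst"

lemma strip_sets: "i \<in> idx \<Longrightarrow> strip i \<in> sets area"
  unfolding sets_area by auto

lemma base_sets: "base \<in> sets area"
  unfolding base_def by (rule strip_sets) (auto simp: idx_def const)

lemma gen_Pow: "gen \<subseteq> Pow \<Omega>" by (auto simp: gen_def)

lemma sets_repr: "sets repr = sigma_sets \<Omega> gen" and space_repr: "space repr = \<Omega>"
  using gen_Pow by (auto simp: repr_def)

text \<open>For \<open>A = {x\<in>\<Omega>. a < f x}\<close> the part of \<open>base\<close> over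
  \<open>A\<close> is a countable union of strips: the clamped functions
  \<open>min 1 (max 0 (n * (f x - a)))\<close> vanish off \<open>A\<close> and equal 1 at each point
  of \<open>A\<close> once \<open>n\<close> is large.\<close>

lemma fst_measurable: "fst \<in> measurable (restrict_space area base) (sigma \<Omega> gen)"
proof (rule measurable_measure_of[OF gen_Pow])
  show "fst \<in> space (restrict_space area base) \<rightarrow> \<Omega>"
    by (auto simp: space_restrict_space base_def strip_def)
  fix A assume "A \<in> gen"
  then obtain a f where f: "f \<in> H" and A: "A = {x\<in>\<Omega>. a < f x}" by (auto simp: gen_def)
  define h where "h n x = min 1 (max 0 (real n * (f x - a)))" for n x
  have h: "((\<lambda>_. 0), h n) \<in> idx" for n
    unfolding h_def by (auto simp: idx_def const intro!: min max scale[of "\<lambda>x. f x - a"] diff f)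
  have "fst -` A \<inter> space (restrict_space area base) = (\<Union>n. strip (\<lambda>_. 0, h n))"
  proof (intro set_eqI iffI)
    fix z assume z: "z \<in> fst -` A \<inter> space (restrict_space area base)"
    obtain x t where zx: "z = (x, t)" by (cases z)
    have xt: "x \<in> \<Omega>" "a < f x" "0 \<le> t" "t < 1"
      using z by (auto simp: zx A space_restrict_space base_def strip_def)
    obtain n where "1 / (f x - a) < real n" using reals_Archimedean2 by blast
    then have "1 \<le> real n * (f x - a)" using xt by (simp add: field_simps)
    then have "h n x = 1" by (simp add: h_def)
    then show "z \<in> (\<Union>n. strip (\<lambda>_. 0, h n))" using xt by (auto simp: zx strip_def intro!: exI[of _ n])
  next
    fix z assume "z \<in> (\<Union>n. strip (\<lambda>_. 0, h n))"
    then obtain n where z: "z \<in> strip (\<lambda>_. 0, h n)" by auto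
    obtain x t where zx: "z = (x, t)" by (cases z)
    have xt: "x \<in> \<Omega>" "0 \<le> t" "t < h n x" using z by (auto simp: zx strip_def)
    then have "0 < real n * (f x - a)" "t < 1" by (auto simp: h_def)
    then have "a < f x" using zero_less_mult_pos[of "real n" "f x - a"] by (cases "n = 0") auto
    with xt \<open>t < 1\<close> show "z \<in> fst -` A \<inter> space (restrict_space area base)"
      by (auto simp: zx A space_restrict_space base_def strip_def sets_area)
  qed
  also have "\<dots> \<in> sets (restrict_space area base)"
  proof (intro sets.countable_UN subsetI, safe)
    fix n
    have "strip (\<lambda>_. 0, h n) = base \<inter> strip (\<lambda>_. 0, h n)" by (auto simp: base_def strip_def h_def)
    then show "strip (\<lambda>_. 0, h n) \<in> sets (restrict_space area base)"
      using strip_sets[OF h] by (auto simp: sets_restrict_space)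
  qed
  finally show "fst -` A \<inter> space (restrict_space area base) \<in> sets (restrict_space area base)" .
qed

lemma emeasure_repr:
  assumes "A \<in> sets repr"
  shows "emeasure repr A = emeasure area (A \<times> UNIV \<inter> base)"
    and "A \<times> UNIV \<inter> base \<in> sets area"
proof -
  have A: "A \<in> sets (sigma \<Omega> gen)" using assms by (simp add: repr_def)
  have eq: "fst -` A \<inter> space (restrict_space area base) = A \<times> UNIV \<inter> base"
    using sets.sets_into_space[OF assms]
    by (auto simp: space_repr space_restrict_space base_def strip_def sets_area)
  have "A \<times> UNIV \<inter> base \<in> sets (restrict_space area base)"
    using measurable_sets[OF fst_measurable A] by (simp add: eq)
  then show s: "A \<times> UNIV \<inter> base \<in> sets area"
    using base_sets by (simp add: sets_restrict_space_iff)
  show "emeasure repr A = emeasure area (A \<times> UNIV \<inter> base)"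
    unfolding repr_def emeasure_distr[OF fst_measurable A] eq using base_sets sets.sets_into_space[OF base_sets]
    by (intro emeasure_restrict_space) (auto simp: Int_absorb1)
qed

lemma prob_repr: "prob_space repr"
proof
  have "\<Omega> \<in> sets repr" using sets.top[of repr] by (simp add: space_repr)
  from emeasure_repr(1)[OF this] have "emeasure repr \<Omega> = emeasure area (strip (\<lambda>_. 0, \<lambda>_. 1))"
    by (simp add: base_def strip_def Times_Int_Times)
  also have "\<dots> = 1" by (subst emeasure_strip) (auto simp: idx_def const I_const)
  finally show "emeasure repr (space repr) = 1" by (simp add: space_repr)
qed

sublocale repr: prob_space repr by (rule prob_repr)

lemma measurable_repr: "f \<in> H \<Longrightarrow> f \<in> borel_measurable repr"
  unfolding borel_measurable_iff_greater space_repr sets_repr gen_def by blast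

text \<open>The strip below \<open>h\<close> lies in the part of \<open>base\<close> over
  \<open>A\<close>, so its area is smaller. The companion \<open>measure_le_I\<close> uses the
  reverse inclusion.\<close>

lemma I_le_measure:
  assumes h: "h \<in> H" "\<And>x. x \<in> \<Omega> \<Longrightarrow> 0 \<le> h x" "\<And>x. x \<in> \<Omega> \<Longrightarrow> h x \<le> indicator A x" and A: "A \<in> sets repr"
  shows "I h \<le> measure repr A"
proof -
  have "ennreal (I h) = emeasure area (strip (\<lambda>_. 0, h))"
    using h by (subst emeasure_strip) (auto simp: idx_def const I_const)
  also have "\<dots> \<le> emeasure area (A \<times> UNIV \<inter> base)"
  proof (rule emeasure_mono[OF _ emeasure_repr(2)[OF A]], safe)
    fix x t assume "(x, t) \<in> strip (\<lambda>_. 0, h)"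
    then have xt: "x \<in> \<Omega>" "0 \<le> t" "t < h x" by (auto simp: strip_def)
    then have "x \<in> A \<and> t < 1" using h(3)[OF xt(1)] by (cases "x \<in> A") auto
    then show "x \<in> A" "t \<in> UNIV" "(x, t) \<in> base" using xt \<open>x \<in> A \<and> t < 1\<close> by (auto simp: base_def strip_def)
  qed
  also have "\<dots> = ennreal (measure repr A)" using emeasure_repr(1)[OF A] by (simp add: repr.emeasure_eq_measure)
  finally show ?thesis by simp
qed

lemma measure_le_I:
  assumes h: "h \<in> H" "\<And>x. x \<in> \<Omega> \<Longrightarrow> indicator A x \<le> h x" and A: "A \<in> sets repr"
  shows "measure repr A \<le> I h"
proof -
  have h0: "0 \<le> h x" if "x \<in> \<Omega>" for x
    using h(2)[OF that] indicator_pos_le[of A x] by (rule order_trans[rotated])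
  have id: "((\<lambda>_. 0), h) \<in> idx" using h h0 by (auto simp: idx_def const)
  have "ennreal (measure repr A) = emeasure area (A \<times> UNIV \<inter> base)"
    using emeasure_repr(1)[OF A] by (simp add: repr.emeasure_eq_measure)
  also have "\<dots> \<le> emeasure area (strip (\<lambda>_. 0, h))"
  proof (rule emeasure_mono[OF _ strip_sets[OF id]], safe)
    fix x t assume "x \<in> A" "(x, t) \<in> base"
    then show "(x, t) \<in> strip (\<lambda>_. 0, h)" using h(2)[of x] by (auto simp: strip_def base_def)
  qed
  also have "\<dots> = ennreal (I h)" using id by (subst emeasure_strip) (auto simp: idx_def I_const)
  finally show ?thesis using I_nonneg[OF h(1) h0] by simp
qed

text \<open>Slicing at height \<open>1 / n\<close>: the slices \<open>h k\<close> of
  \<open>n * f\<close> satisfy \<open>indicator (A (Suc k)) \<le> h k \<le> indicator (A k)\<close>,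
  so \<open>I (h k)\<close> and the integral of \<open>h k\<close> lie between the same two
  measures. The errors telescope to at most 1, and the factor \<open>1 / n\<close> makes them
  vanish.\<close>

lemma integral_repr:
  assumes f: "f \<in> H" shows "integral\<^sup>L repr f = I f"
proof -
  have int: "integrable repr g" if "g \<in> H" for g
    using bounded[OF that] measurable_repr[OF that]
    by (auto intro!: repr.integrable_const_bound AE_I2 simp: space_repr)
  have pos: "integral\<^sup>L repr f = I f" if f: "f \<in> H" and f0: "\<And>x. x \<in> \<Omega> \<Longrightarrow> 0 \<le> f x" for f
  proof -
    obtain c where c: "\<And>x. x \<in> \<Omega> \<Longrightarrow> \<bar>f x\<bar> \<le> c" using bounded[OF f] by auto
    have "\<bar>integral\<^sup>L repr f - I f\<bar> \<le> 1 / real n" if n: "n > 0" for n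
    proof -
      obtain N where N: "c * real n \<le> real N" using real_arch_simple by blast
      define h where "h k x = min 1 (max 0 (real n * f x - real k))" for k x
      define A where "A k = {x\<in>\<Omega>. real k / real n < f x}" for k
      have hH: "h k \<in> H" for k
        unfolding h_def by (intro min max diff scale const f)
      have A: "A k \<in> sets repr" for k unfolding A_def sets_repr gen_def using f by blast
      have up: "h k x \<le> indicator (A k) x" and dn: "indicator (A (Suc k)) x \<le> h k x" if "x \<in> \<Omega>" for k x
        using n that by (auto simp: h_def A_def indicator_def field_simps)
      have tel: "(\<Sum>k<M. h k x) = min (real M) (real n * f x)" if "x \<in> \<Omega>" for x M
        using f0[OF that] by (induction M) (auto simp: h_def min_def max_def)
      have fx: "f x = 1 / real n * (\<Sum>k<N. h k x)" if "x \<in> \<Omega>" for x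
      proof -
        have "f x * real n \<le> c * real n" using c[OF that] by (intro mult_right_mono) auto
        then have "min (real N) (real n * f x) = real n * f x" using N by (simp add: mult.commute)
        then show ?thesis using tel[OF that, of N] n by simp
      qed
      let ?g = "\<lambda>x. 1 / real n * (\<Sum>k<N. h k x)"
      have sH: "(\<lambda>x. \<Sum>k<N. h k x) \<in> H" "I (\<lambda>x. \<Sum>k<N. h k x) = (\<Sum>k<N. I (h k))"
        using sum[of "{..<N}" h] hH by auto
      have If: "I f = 1 / real n * (\<Sum>k<N. I (h k))"
      proof -
        have "I f = I ?g" by (intro antisym I_mono f scale sH) (use fx in auto)
        then show ?thesis by (simp only: I_scale[OF sH(1)] sH(2))
      qed
      have Jf: "integral\<^sup>L repr f = 1 / real n * (\<Sum>k<N. integral\<^sup>L repr (h k))"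
      proof -
        have "integral\<^sup>L repr f = integral\<^sup>L repr ?g"
          by (intro Bochner_Integration.integral_cong) (auto simp: space_repr fx simp del: times_divide_eq_left)
        then show ?thesis using int hH by (simp add: Bochner_Integration.integral_sum)
      qed
      have inti: "integrable repr (indicator (A k) :: 's \<Rightarrow> real)" for k
        using A by (simp add: repr.emeasure_eq_measure)
      have b1: "measure repr (A (Suc k)) \<le> I (h k)" "I (h k) \<le> measure repr (A k)" for k
      proof -
        show "measure repr (A (Suc k)) \<le> I (h k)" by (rule measure_le_I[OF hH dn A])
        show "I (h k) \<le> measure repr (A k)" by (rule I_le_measure[OF hH _ up A]) (simp add: h_def)
      qed
      have b2: "measure repr (A (Suc k)) \<le> integral\<^sup>L repr (h k)" for k
      proof -
        have "integral\<^sup>L repr (indicator (A (Suc k))) \<le> integral\<^sup>L repr (h k)"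
          using dn A hH int inti by (intro integral_mono) (auto simp: space_repr)
        then show ?thesis using A sets.sets_into_space[OF A] by (simp add: Int_absorb2)
      qed
      have b3: "integral\<^sup>L repr (h k) \<le> measure repr (A k)" for k
      proof -
        have "integral\<^sup>L repr (h k) \<le> integral\<^sup>L repr (indicator (A k))"
          using up A hH int inti by (intro integral_mono) (auto simp: space_repr)
        then show ?thesis using A sets.sets_into_space[OF A] by (simp add: Int_absorb2)
      qed
      have "\<bar>(\<Sum>k<N. integral\<^sup>L repr (h k)) - (\<Sum>k<N. I (h k))\<bar> = \<bar>\<Sum>k<N. integral\<^sup>L repr (h k) - I (h k)\<bar>"
        by (simp add: sum_subtractf)
      also have "\<dots> \<le> (\<Sum>k<N. \<bar>integral\<^sup>L repr (h k) - I (h k)\<bar>)" by (rule sum_abs)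
      also have "\<dots> \<le> (\<Sum>k<N. measure repr (A k) - measure repr (A (Suc k)))"
        using b1 b2 b3 by (intro sum_mono) (simp add: abs_le_iff, smt (verit))
      also have "\<dots> = measure repr (A 0) - measure repr (A N)" by (rule sum_lessThan_telescope')
      also have "\<dots> \<le> 1" by (smt (verit) repr.prob_le_1 measure_nonneg)
      finally have *: "\<bar>(\<Sum>k<N. integral\<^sup>L repr (h k)) - (\<Sum>k<N. I (h k))\<bar> \<le> 1" .
      have "\<bar>integral\<^sup>L repr f - I f\<bar> = 1 / real n * \<bar>(\<Sum>k<N. integral\<^sup>L repr (h k)) - (\<Sum>k<N. I (h k))\<bar>"
        unfolding If Jf by (simp add: abs_mult flip: right_diff_distrib diff_divide_distrib)
      also have "\<dots> \<le> 1 / real n * 1" by (intro mult_left_mono *) simp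
      finally show ?thesis by simp
    qed
    then have "\<bar>integral\<^sup>L repr f - I f\<bar> \<le> e" if "e > 0" for e
      using that real_arch_inverse[of e] by (smt (verit) inverse_eq_divide not_gr_zero)
    then show ?thesis by (metis abs_le_zero_iff dense_ge eq_iff_diff_eq_0)
  qed
  \<comment> \<open>Adding the bound \<open>c\<close> makes \<open>f\<close> nonnegative, and both
    sides grow by \<open>c\<close> since \<open>repr\<close> has mass one.\<close>
  obtain c where c: "\<And>x. x \<in> \<Omega> \<Longrightarrow> \<bar>f x\<bar> \<le> c" using bounded[OF f] by auto
  have "integral\<^sup>L repr (\<lambda>x. f x + c) = I (\<lambda>x. f x + c)"
    using c by (intro pos add f const) (auto simp: abs_le_iff, smt (verit))
  then show ?thesis using int[OF f] repr.prob_space by (simp add: I_add f const I_const)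
qed

end

theorem daniell_stone:
  assumes "daniell \<Omega> H I"
  obtains M where "prob_space M" "space M = \<Omega>" "\<And>f. f \<in> H \<Longrightarrow> f \<in> borel_measurable M"
    "\<And>f. f \<in> H \<Longrightarrow> integral\<^sup>L M f = I f"
proof -
  interpret daniell \<Omega> H I by fact
  show thesis by (rule that[OF prob_repr space_repr measurable_repr integral_repr])
qed

section \<open>Exhaustion of Polish spaces\<close>

text \<open>The sets \<open>{y. \<forall>j. u j y \<le> N j}\<close> are relatively compact, so a bound on each \<open>u j\<close> separately replaces
  total boundedness in a complete metric, which need not be the metric of the type.\<close>

definition coercive :: "(nat \<Rightarrow> 'b::topological_space \<Rightarrow> real) \<Rightarrow> bool" where
  "coercive u \<longleftrightarrow> (\<forall>j. continuous_on UNIV (u j)) \<and> (\<forall>j y. 0 \<le> u j y) \<and>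
     (\<forall>j y. u j y \<le> u (Suc j) y) \<and>
     (\<forall>y N. (\<forall>j. \<forall>n\<ge>j. u j (y n) \<le> N j) \<longrightarrow> (\<exists>s l. strict_mono (s :: nat \<Rightarrow> nat) \<and> (y \<circ> s) \<longlonglongrightarrow> l))"

text \<open>\<open>a j y\<close> is a weighted sum of bumps of radius \<open>1 / Suc j\<close>
  around a dense sequence, taken in a complete compatible metric \<open>d\<close>. It is continuous
  and positive, and a lower bound on it forces \<open>y\<close> to be near one of finitely many
  dense points. Hence bounds on the reciprocals for all \<open>j\<close> give total boundedness, and
  completeness of \<open>d\<close> gives a limit. Summing the reciprocals makes \<open>u\<close>
  increasing in \<open>j\<close>.\<close>

lemma coercive_exists:
  assumes "completely_metrizable_space (euclidean :: ('b::second_countable_topology) topology)"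
  obtains u :: "nat \<Rightarrow> ('b::second_countable_topology) \<Rightarrow> real" where "coercive u"
proof -
  obtain M :: "'b set" and d where ms: "Metric_space M d" and mc: "Metric_space.mcomplete M d"
    and top: "(euclidean :: 'b topology) = Metric_space.mtopology M d"
    using assms unfolding completely_metrizable_space_def by auto
  interpret Metric_space M d by fact
  have M: "M = UNIV" using arg_cong[OF top, of topspace] by simp
  have mb: "w \<in> mball y e \<longleftrightarrow> d y w < e" for w y e
    by (subst in_mball) (simp add: M)
  have dyy: "d y y = 0" for y using zero[of y y] by (simp add: M)
  have opn: "open (mball x e)" for x e
    using openin_mball[of x e] by (simp flip: top)
  obtain D :: "'b set" where D: "countable D" "\<And>X. open X \<Longrightarrow> X \<noteq> {} \<Longrightarrow> \<exists>z\<in>D. z \<in> X"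
    using countable_dense_setE by blast
  then have "D \<noteq> {}" using D(2)[of UNIV] by auto
  define e where "e = from_nat_into D"
  have dense: "\<exists>i. d y (e i) < \<delta>" if "\<delta> > 0" for y \<delta>
  proof -
    have "mball y \<delta> \<noteq> {}" using that M centre_in_mball_iff[of y \<delta>] by blast
    then obtain z where z: "z \<in> D" "z \<in> mball y \<delta>" using D(2)[OF opn] by blast
    then obtain i where "z = e i" unfolding e_def using from_nat_into_surj[OF D(1) z(1)] by auto
    then show ?thesis using z by auto
  qed
  have cd: "continuous_on UNIV (\<lambda>y. d y z)" for z
    unfolding continuous_on_def
  proof (intro ballI tendstoI)
    fix y and \<epsilon> :: real assume "\<epsilon> > 0"
    have "dist (d w z) (d y z) < \<epsilon>" if "w \<in> mball y \<epsilon>" for w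
      using that mdist_reverse_triangle[of w z y] unfolding mb by (simp add: M dist_real_def commute)
    then show "\<forall>\<^sub>F x in at y within UNIV. dist (d x z) (d y z) < \<epsilon>"
      using opn[of y \<epsilon>] \<open>\<epsilon> > 0\<close> mb[of y y \<epsilon>] unfolding eventually_at_topological
      by (intro exI[of _ "mball y \<epsilon>"] conjI ballI impI) (simp_all only: dyy)
  qed
  define t where "t j i y = (1/2)^i * max 0 (1 / real (Suc j) - d y (e i))" for j i y
  define a where "a j y = (\<Sum>i. t j i y)" for j y
  have t0: "0 \<le> t j i y" for j i y by (simp add: t_def)
  have t1: "t j i y \<le> (1/2)^i" for j i y
  proof -
    have "max 0 (1 / real (Suc j) - d y (e i)) \<le> 1" using nonneg[of y "e i"] by (simp add: field_simps)
    then show ?thesis unfolding t_def by (intro mult_left_le) auto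
  qed
  have sg: "summable (\<lambda>i. (1/2::real)^i)" by (rule summable_geometric) simp
  have st: "summable (\<lambda>i. t j i y)" for j y
    by (rule summable_comparison_test'[OF sg]) (use t0 t1 in auto)
  have ca: "continuous_on UNIV (a j)" for j
  proof -
    have "uniform_limit UNIV (\<lambda>n y. \<Sum>i<n. t j i y) (\<lambda>y. \<Sum>i. t j i y) sequentially"
      by (rule Weierstrass_m_test[OF _ sg]) (use t0 t1 in auto)
    then show ?thesis unfolding a_def
      by (rule uniform_limit_theorem[rotated])
        (auto intro!: always_eventually continuous_intros cd simp: t_def)
  qed
  have a0: "a j y > 0" for j y
  proof -
    obtain i where i: "d y (e i) < 1 / real (Suc j)" using dense[of "1 / real (Suc j)" y] by auto
    then have "0 < t j i y" by (simp add: t_def)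
    also have "t j i y = sum (\<lambda>i. t j i y) {i}" by simp
    also have "\<dots> \<le> a j y" unfolding a_def by (rule sum_le_suminf[OF st]) (use t0 in auto)
    finally show ?thesis .
  qed
  define u where "u j y = (\<Sum>k\<le>j. 1 / a k y)" for j y
  have "coercive u" unfolding coercive_def
  proof (intro conjI allI impI)
    show "continuous_on UNIV (u j)" for j
      unfolding u_def by (intro continuous_intros ca) (use a0 in \<open>auto simp: less_imp_neq[symmetric] dual_order.strict_implies_not_eq\<close>)
    show "0 \<le> u j y" for j y unfolding u_def by (intro sum_nonneg) (simp add: a0 less_imp_le)
    show "u j y \<le> u (Suc j) y" for j y unfolding u_def using a0[of "Suc j" y] by simp
    fix y :: "nat \<Rightarrow> 'b" and N assume b: "\<forall>j. \<forall>n\<ge>j. u j (y n) \<le> N j"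
    have "mtotally_bounded (range y)"
      unfolding mtotally_bounded_def
    proof (intro allI impI)
      fix \<epsilon> :: real assume "\<epsilon> > 0"
      then obtain j where j: "2 / \<epsilon> < real (Suc j)" using reals_Archimedean2[of "2/\<epsilon>"] by (metis less_Suc_eq of_nat_less_iff order_less_trans)
      then have j': "1 / real (Suc j) < \<epsilon> / 2" using \<open>\<epsilon> > 0\<close> by (simp add: field_simps)
      define B where "B = max 1 (N j)"
      have "(\<lambda>i. 2 * (1/2::real)^i) \<longlonglongrightarrow> 2 * 0" by (intro tendsto_intros) simp_all
      then have "\<forall>\<^sub>F i in sequentially. 2 * (1/2::real)^i < 1 / B"
        by (rule order_tendstoD(2)) (simp add: B_def)
      \<comment> \<open>The terms from \<open>I\<close> on sum to at most
        \<open>2 * (1/2)^I\<close>, too little for the lower bound \<open>1 / B\<close> on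
        \<open>a j\<close>; so one of the first \<open>I\<close> dense points must be close.\<close>
      then obtain I where I: "2 * (1/2::real)^I < 1 / B" by (auto simp: eventually_sequentially)
      have near: "\<exists>i<I. d (y n) (e i) < \<epsilon> / 2" if "n \<ge> j" for n
      proof (rule ccontr)
        assume neg: "\<not> (\<exists>i<I. d (y n) (e i) < \<epsilon> / 2)"
        have z: "t j i (y n) = 0" if "i < I" for i
        proof -
          have "\<epsilon> / 2 \<le> d (y n) (e i)" using neg that by (meson not_less)
          then show ?thesis using j' by (simp add: t_def)
        qed
        have "1 / a j (y n) \<le> u j (y n)" unfolding u_def
          using member_le_sum[of j "{..j}" "\<lambda>k. 1 / a k (y n)"] a0 by (simp add: less_imp_le)
        also have "\<dots> \<le> B" using b that by (simp add: B_def max.coboundedI2)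
        finally have "1 / B \<le> a j (y n)" using a0[of j "y n"] by (simp add: B_def field_simps)
        also have "a j (y n) = (\<Sum>i. t j (i + I) (y n))"
          unfolding a_def using suminf_split_initial_segment[OF st, of j "y n" I] z by simp
        also have "\<dots> \<le> (\<Sum>i. (1/2)^(i + I))"
          by (intro suminf_le t1 summable_ignore_initial_segment st sg)
        also have "\<dots> = (\<Sum>i. (1/2::real)^I * (1/2)^i)" by (simp add: power_add mult.commute)
        also have "\<dots> = (1/2::real)^I * 2" using suminf_mult[OF sg, of "(1/2)^I"] suminf_geometric[of "1/2::real"] by simp
        finally show False using I by simp
      qed
      \<comment> \<open>Total boundedness wants centres on the sequence itself; replacing
        \<open>e i\<close> by a term of the sequence near it doubles the radius from
        \<open>\<epsilon> / 2\<close> to \<open>\<epsilon>\<close>.\<close>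
      define g where "g i = y (SOME n. d (y n) (e i) < \<epsilon> / 2)" for i
      have g: "d (y n) (g i) < \<epsilon>" if "d (y n) (e i) < \<epsilon> / 2" for n i
      proof -
        have "d (g i) (e i) < \<epsilon> / 2" unfolding g_def by (rule someI[where P="\<lambda>n. d (y n) (e i) < \<epsilon> / 2"]) fact
        then show ?thesis using that triangle[of "y n" "e i" "g i"] M by (simp add: commute)
      qed
      \<comment> \<open>The indices below \<open>j\<close>, where no bound on \<open>u j\<close> is
        assumed, contribute their own points as centres.\<close>
      show "\<exists>K. finite K \<and> K \<subseteq> range y \<and> range y \<subseteq> (\<Union>x\<in>K. mball x \<epsilon>)"
      proof (intro exI[of _ "g ` {..<I} \<union> y ` {..<j}"] conjI subsetI)
        fix x assume "x \<in> range y"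
        then obtain n where n: "x = y n" by auto
        show "x \<in> (\<Union>x\<in>g ` {..<I} \<union> y ` {..<j}. mball x \<epsilon>)"
        proof (cases "n < j")
          case True then have "x \<in> mball (y n) \<epsilon>" using n \<open>\<epsilon> > 0\<close> unfolding mb by (simp add: M)
          then show ?thesis using True by blast
        next
          case False
          then obtain i where "i < I" "d (y n) (e i) < \<epsilon> / 2" using near[of n] by auto
          then have "x \<in> mball (g i) \<epsilon>" using g[of n i] n unfolding mb by (simp add: commute)
          then show ?thesis using \<open>i < I\<close> by blast
        qed
      qed (auto simp: g_def)
    qed
    then obtain s where s: "strict_mono (s::nat\<Rightarrow>nat)" "MCauchy (y \<circ> s)"
      unfolding mtotally_bounded_sequentially by blast
    then obtain l where "limitin mtopology (y \<circ> s) l sequentially" using mc unfolding mcomplete_def by blast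
    then have "(y \<circ> s) \<longlonglongrightarrow> l" by (simp flip: top)
    with s show "\<exists>s l. strict_mono (s :: nat \<Rightarrow> nat) \<and> (y \<circ> s) \<longlonglongrightarrow> l" by blast
  qed
  then show thesis by (rule that)
qed

section \<open>Functions of bounded growth and convergence against them\<close>

text \<open>Estimating by the larger of the two distances, instead of by convexity, makes this valid
  for every \<open>r > 0\<close>.\<close>

lemma dist_powr_le:
  fixes x y z :: "'a::metric_space"
  assumes "r > 0"
  shows "dist x z powr r \<le> 2 powr r * (dist x y powr r + dist y z powr r)"
proof -
  have "dist x z \<le> 2 * max (dist x y) (dist y z)" using dist_triangle[of x z y] by simp
  then have "dist x z powr r \<le> (2 * max (dist x y) (dist y z)) powr r"
    using assms by (intro powr_mono2) auto
  also have "\<dots> = 2 powr r * max (dist x y) (dist y z) powr r" by (simp add: powr_mult max_def)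
  also have "max (dist x y) (dist y z) powr r \<le> dist x y powr r + dist y z powr r"
    by (auto simp: max_def)
  finally show ?thesis by simp
qed

lemma continuous_dist_powr: "r > 0 \<Longrightarrow> continuous_on UNIV (\<lambda>y. dist y y0 powr r)"
  by (intro continuous_on_powr' continuous_intros) auto

text \<open>Frees the choice of the reference point, which \<open>Phi\<close> quantifies
  existentially; moving it from \<open>z\<close> to \<open>y0\<close> costs the factor
  \<open>1 + D\<close>.\<close>

lemma Phi_bound:
  assumes "\<psi> \<in> Phi r" "r > 0"
  obtains c where "c \<ge> 0" "\<And>y. \<bar>\<psi> y\<bar> \<le> c * (1 + dist y y0 powr r)"
proof -
  obtain z c where c: "\<And>y. \<bar>\<psi> y\<bar> \<le> c * (1 + dist y z powr r)" using assms by (auto simp: Phi_def)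
  have c0: "c \<ge> 0"
  proof (rule ccontr)
    assume "\<not> c \<ge> 0"
    then have "c * (1 + dist z z powr r) < 0" by (intro mult_neg_pos) (auto simp: add_pos_nonneg)
    with c[of z] show False by linarith
  qed
  define D where "D = 2 powr r * (1 + dist y0 z powr r)"
  have D: "1 \<le> D" "2 powr r \<le> D"
    using assms(2) ge_one_powr_ge_zero[of 2 r] mult_mono[of 1 "2 powr r" 1 "1 + dist y0 z powr r"] by (auto simp: D_def)
  have "\<bar>\<psi> y\<bar> \<le> c * (1 + D) * (1 + dist y y0 powr r)" for y
  proof -
    have "1 + dist y z powr r \<le> 1 + 2 powr r * (dist y y0 powr r + dist y0 z powr r)"
      using dist_powr_le[OF assms(2), of y z y0] by simp
    also have "\<dots> \<le> 1 + D + 2 powr r * dist y y0 powr r" by (simp add: D_def algebra_simps)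
    also have "\<dots> \<le> 1 + D + D * dist y y0 powr r" using D by (simp add: mult_right_mono)
    also have "\<dots> \<le> (1 + D) * (1 + dist y y0 powr r)" by (simp add: algebra_simps)
    finally have "c * (1 + dist y z powr r) \<le> c * ((1 + D) * (1 + dist y y0 powr r))"
      using c0 by (rule mult_left_mono)
    with c[of y] show ?thesis by (simp add: mult.assoc)
  qed
  then show thesis using c0 D by (intro that[of "c * (1 + D)"]) auto
qed

lemma Phi_I: "continuous_on UNIV \<psi> \<Longrightarrow> (\<And>y. \<bar>\<psi> y\<bar> \<le> c * (1 + dist y y0 powr r)) \<Longrightarrow> \<psi> \<in> Phi r"
  by (auto simp: Phi_def)

lemma Phi_cont: "\<psi> \<in> Phi r \<Longrightarrow> continuous_on UNIV \<psi>"
  by (auto simp: Phi_def)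

lemma Phi_bounded:
  fixes \<psi> :: "'b::metric_space \<Rightarrow> real"
  assumes "continuous_on UNIV \<psi>" "\<And>y. \<bar>\<psi> y\<bar> \<le> c" shows "\<psi> \<in> Phi r"
proof (rule Phi_I[OF assms(1), of c undefined])
  fix y :: 'b
  have "0 \<le> c" using assms(2)[of y] by linarith
  then have "c * 1 \<le> c * (1 + dist y undefined powr r)" by (intro mult_left_mono) auto
  then show "\<bar>\<psi> y\<bar> \<le> c * (1 + dist y undefined powr r)" using assms(2)[of y] by linarith
qed

lemma Phi_const: "(\<lambda>_. c) \<in> Phi r"
  by (rule Phi_bounded[of _ "\<bar>c\<bar>"]) auto

lemma Phi_dist: "r > 0 \<Longrightarrow> (\<lambda>y. dist y y0 powr r) \<in> Phi r"
  by (rule Phi_I[of _ 1 y0]) (auto intro: continuous_dist_powr)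

lemma Phi_add:
  assumes "\<phi> \<in> Phi r" "\<psi> \<in> Phi r" "r > 0" shows "(\<lambda>y. \<phi> y + \<psi> y) \<in> Phi r"
proof -
  obtain c where c: "\<And>y. \<bar>\<phi> y\<bar> \<le> c * (1 + dist y undefined powr r)" using Phi_bound[OF assms(1,3)] by metis
  obtain d where d: "\<And>y. \<bar>\<psi> y\<bar> \<le> d * (1 + dist y undefined powr r)" using Phi_bound[OF assms(2,3)] by metis
  show ?thesis
  proof (rule Phi_I[of _ "c + d" undefined])
    show "continuous_on UNIV (\<lambda>y. \<phi> y + \<psi> y)" using assms by (intro continuous_intros Phi_cont)
    show "\<bar>\<phi> y + \<psi> y\<bar> \<le> (c + d) * (1 + dist y undefined powr r)" for y
      using c[of y] d[of y] abs_triangle_ineq[of "\<phi> y" "\<psi> y"] by (simp only: distrib_right)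
  qed
qed

lemma Phi_dominated:
  assumes "continuous_on UNIV \<phi>" "\<psi> \<in> Phi r" "r > 0" "\<And>y. \<bar>\<phi> y\<bar> \<le> C * \<bar>\<psi> y\<bar>"
  shows "\<phi> \<in> Phi r"
proof -
  obtain c where c: "c \<ge> 0" "\<And>y. \<bar>\<psi> y\<bar> \<le> c * (1 + dist y undefined powr r)" using Phi_bound[OF assms(2,3)] by metis
  show ?thesis
  proof (rule Phi_I[OF assms(1), of "\<bar>C\<bar> * c" undefined])
    fix y
    have "\<bar>\<phi> y\<bar> \<le> C * \<bar>\<psi> y\<bar>" by fact
    also have "\<dots> \<le> \<bar>C\<bar> * \<bar>\<psi> y\<bar>" by (intro mult_right_mono) auto
    also have "\<dots> \<le> \<bar>C\<bar> * (c * (1 + dist y undefined powr r))" using c by (intro mult_left_mono) auto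
    finally show "\<bar>\<phi> y\<bar> \<le> \<bar>C\<bar> * c * (1 + dist y undefined powr r)" by (simp add: mult.assoc)
  qed
qed

lemma Phi_scale: "\<psi> \<in> Phi r \<Longrightarrow> r > 0 \<Longrightarrow> (\<lambda>y. c * \<psi> y) \<in> Phi r"
  by (rule Phi_dominated[where \<psi> = \<psi> and C = "\<bar>c\<bar>"]) (auto intro!: continuous_intros intro: Phi_cont simp: abs_mult)

lemma Phi_minus: "\<psi> \<in> Phi r \<Longrightarrow> r > 0 \<Longrightarrow> (\<lambda>y. - \<psi> y) \<in> Phi r"
  using Phi_scale[of \<psi> r "-1"] by simp

lemma Phi_diff: "\<phi> \<in> Phi r \<Longrightarrow> \<psi> \<in> Phi r \<Longrightarrow> r > 0 \<Longrightarrow> (\<lambda>y. \<phi> y - \<psi> y) \<in> Phi r"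
  using Phi_add[OF _ Phi_minus, of \<phi> r \<psi>] by simp

lemma Phi_sum:
  assumes "finite A" "r > 0" "\<And>i. i \<in> A \<Longrightarrow> f i \<in> Phi r" shows "(\<lambda>y. \<Sum>i\<in>A. f i y) \<in> Phi r"
  using assms by (induction A rule: finite_induct) (auto simp: Phi_const intro!: Phi_add)

lemma Pr_prob: "p \<in> Pr r \<Longrightarrow> prob_space p" and Pr_sets: "p \<in> Pr r \<Longrightarrow> sets p = sets borel"
  by (auto simp: Pr_def)

lemma Pr_space: "p \<in> Pr r \<Longrightarrow> space p = UNIV"
  using sets_eq_imp_space_eq[OF Pr_sets] by fastforce

lemma Phi_measurable: "\<psi> \<in> Phi r \<Longrightarrow> sets p = sets borel \<Longrightarrow> \<psi> \<in> borel_measurable p"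
  using borel_measurable_continuous_onI[OF Phi_cont] by (simp cong: measurable_cong_sets)

lemma Phi_integrable:
  assumes p: "p \<in> Pr r" and \<psi>: "\<psi> \<in> Phi r" and r: "r > 0"
  shows "integrable p \<psi>"
proof -
  interpret prob_space p by (rule Pr_prob[OF p])
  obtain z where z: "(\<integral>\<^sup>+ x. ennreal (dist x z powr r) \<partial>p) < \<infinity>" using p by (auto simp: Pr_def)
  have "(\<lambda>x. dist x z powr r) \<in> borel_measurable p"
    by (rule Phi_measurable[OF Phi_dist Pr_sets]) (use r p in auto)
  then have "integrable p (\<lambda>x. dist x z powr r)"
    by (rule integrableI_bounded) (use z in auto)
  then have ic: "integrable p (\<lambda>y. c * (1 + dist y z powr r))" for c by simp
  obtain c where c: "\<And>y. \<bar>\<psi> y\<bar> \<le> c * (1 + dist y z powr r)" using Phi_bound[OF \<psi> r] by metis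
  show ?thesis
  proof (rule Bochner_Integration.integrable_bound[OF ic])
    show "\<psi> \<in> borel_measurable p" by (rule Phi_measurable[OF \<psi> Pr_sets[OF p]])
    have "norm (\<psi> y) \<le> norm (c * (1 + dist y z powr r))" for y
      using c[of y] abs_ge_self[of "c * (1 + dist y z powr r)"] unfolding real_norm_def by linarith
    then show "AE y in p. norm (\<psi> y) \<le> norm (c * (1 + dist y z powr r))" by simp
  qed
qed

lemma Pr_I:
  assumes "prob_space p" "sets p = sets borel" "integrable p (\<lambda>y. dist y y0 powr r)"
  shows "p \<in> Pr r"
  using assms nn_integral_eq_integral[OF assms(3)] unfolding Pr_def
  by (auto intro!: exI[of _ y0])

text \<open>Convergence against \<open>Phi r\<close> takes the place of Wasserstein convergence; the lower semicontinuity assumption is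
  only ever used through the implication from the former to the latter.\<close>

definition Phi_conv :: "real \<Rightarrow> (nat \<Rightarrow> 'b::metric_space measure) \<Rightarrow> 'b measure \<Rightarrow> bool" where
  "Phi_conv r ps p \<longleftrightarrow> (\<forall>\<psi>\<in>Phi r. (\<lambda>n. \<integral>y. \<psi> y \<partial>(ps n)) \<longlonglongrightarrow> (\<integral>y. \<psi> y \<partial>p))"

text \<open>A countable class that determines convergence: approximation from below turns
  convergence of the integrals of the \<open>G j\<close> into lower semicontinuity for every
  nonnegative continuous integrand of bounded growth.\<close>

definition lower_family :: "(nat \<Rightarrow> 'b::topological_space \<Rightarrow> real) \<Rightarrow> bool" where
  "lower_family G \<longleftrightarrow> (\<forall>j. continuous_on UNIV (G j)) \<and> (\<forall>j y. 0 \<le> G j y) \<and> (\<forall>j. \<exists>c. \<forall>y. G j y \<le> c) \<and>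
     (\<forall>f. continuous_on UNIV f \<longrightarrow> (\<forall>y. 0 \<le> f y) \<longrightarrow>
        (\<exists>k. (\<forall>j y. G (k j) y \<le> f y) \<and> (\<forall>y. (\<lambda>j. G (k j) y) \<longlonglongrightarrow> f y)))"

text \<open>A continuous \<open>f \<ge> 0\<close> is the supremum of 0 and of the cones below it
  that have rational height, integer slope and apex in a dense sequence. Finite maxima of cones are
  numbered by the binary code of the set of their indices, so that the maxima of the first cones
  below \<open>f\<close> form a sequence within the family.\<close>

lemma lower_family_exists:
  obtains G :: "nat \<Rightarrow> 'b::{metric_space, second_countable_topology} \<Rightarrow> real" where "lower_family G"
proof -
  obtain D :: "'b set" where D: "countable D" "\<And>X. open X \<Longrightarrow> X \<noteq> {} \<Longrightarrow> \<exists>z\<in>D. z \<in> X"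
    using countable_dense_setE by blast
  then have "D \<noteq> {}" using D(2)[of UNIV] by auto
  define e where "e = from_nat_into D"
  have dense: "\<exists>i. dist y (e i) < \<delta>" if "\<delta> > 0" for y \<delta>
  proof -
    obtain z where z: "z \<in> D" "z \<in> ball y \<delta>" using D(2)[of "ball y \<delta>"] \<open>\<delta> > 0\<close> by auto
    then obtain i where "z = e i" unfolding e_def using from_nat_into_surj[OF D(1) z(1)] by auto
    then show ?thesis using z by auto
  qed
  define B0 where "B0 q k i y = max 0 (of_rat q - real k * dist y (e i))" for q :: rat and k i :: nat and y
  define enum :: "nat \<Rightarrow> rat \<times> nat \<times> nat" where "enum = from_nat"
  have enum: "surj enum" unfolding enum_def by (rule surj_from_nat)
  define B where "B m = (case enum m of (q, k, i) \<Rightarrow> B0 q k i)" for m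
  have Bc: "continuous_on UNIV (B m)" for m
    unfolding B_def B0_def by (cases "enum m") (auto intro!: continuous_intros)
  have B0: "0 \<le> B m y" for m y unfolding B_def B0_def by (cases "enum m") auto
  have Bb: "\<exists>c. \<forall>y. B m y \<le> c" for m
  proof -
    obtain q k i where m: "enum m = (q, k, i)" by (cases "enum m")
    have "B m y \<le> \<bar>of_rat q\<bar>" for y
      using mult_nonneg_nonneg[OF of_nat_0_le_iff[of k] zero_le_dist[of y "e i"]] abs_ge_self[of "real_of_rat q"]
      unfolding B_def m B0_def prod.case by (intro max.boundedI) (linarith | simp)+
    then show ?thesis by blast
  qed
  define G where "G n y = Max (insert 0 ((\<lambda>m. B m y) ` set_decode n))" for n y
  have G0: "0 \<le> G n y" for n y unfolding G_def by (intro Max_ge) auto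
  have Gc: "continuous_on UNIV (G n)" for n
  proof -
    have "continuous_on UNIV (\<lambda>y. Max (insert 0 ((\<lambda>m. B m y) ` F)))" if "finite F" for F :: "nat set"
      using that
    proof (induction F rule: finite_induct)
      case (insert x F)
      have "Max (insert 0 ((\<lambda>m. B m y) ` insert x F)) = max (B x y) (Max (insert 0 ((\<lambda>m. B m y) ` F)))" for y
        using insert(1) Max_insert[of "insert 0 ((\<lambda>m. B m y) ` F)" "B x y"] by (simp only: image_insert insert_commute[of 0]) simp
      then show ?case using insert by (auto intro!: continuous_intros Bc)
    qed auto
    then show ?thesis unfolding G_def by simp
  qed
  have Gb: "\<exists>c. \<forall>y. G n y \<le> c" for n
  proof -
    obtain c where c: "\<And>m y. B m y \<le> c m" using Bb by metis
    have "B m y \<le> (\<Sum>k\<in>set_decode n. max 0 (c k))" if "m \<in> set_decode n" for m y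
    proof -
      have "B m y \<le> max 0 (c m)" using c[of m y] by simp
      also have "\<dots> \<le> (\<Sum>k\<in>set_decode n. max 0 (c k))" using that by (intro member_le_sum) auto
      finally show ?thesis .
    qed
    then show ?thesis unfolding G_def
      by (intro exI[of _ "\<Sum>k\<in>set_decode n. max 0 (c k)"]) (auto intro!: sum_nonneg)
  qed
  have "lower_family G" unfolding lower_family_def
  proof (intro conjI allI impI)
    fix f :: "'b \<Rightarrow> real" assume f: "continuous_on UNIV f" "\<forall>y. 0 \<le> f y"
    define S where "S = {m. \<forall>y. B m y \<le> f y}"
    define k where "k j = set_encode (S \<inter> {..<j})" for j
    have dk: "set_decode (k j) = S \<inter> {..<j}" for j by (simp add: k_def set_encode_inverse)
    have le: "G (k j) y \<le> f y" for j y unfolding G_def dk using f by (auto simp: S_def)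
    have "(\<lambda>j. G (k j) y) \<longlonglongrightarrow> f y" for y
    proof (rule order_tendstoI)
      fix a assume "f y < a" then show "\<forall>\<^sub>F j in sequentially. G (k j) y < a"
        using le by (auto intro!: always_eventually intro: le_less_trans)
    next
      fix a assume a: "a < f y"
      show "\<forall>\<^sub>F j in sequentially. a < G (k j) y"
      proof (cases "a < 0")
        case True then show ?thesis using G0 by (auto intro!: always_eventually intro: less_le_trans)
      next
        case False
        obtain q :: rat where q: "a < of_rat q" "of_rat q < f y" using of_rat_dense[OF a] by auto
        have "open {z. of_rat q < f z}" using open_Collect_less[of "\<lambda>_. of_rat q" f] f by auto
        then obtain \<delta> where \<delta>: "\<delta> > 0" "\<And>z. dist z y < \<delta> \<Longrightarrow> of_rat q < f z"
          using q by (auto simp: open_dist)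
        \<comment> \<open>The slope is so steep that a cone of height \<open>q\<close> vanishes at
          distance \<open>\<delta> / 2\<close> from its apex.\<close>
        obtain K :: nat where K: "2 * of_rat q / \<delta> < real K" using reals_Archimedean2 by blast
        have q0: "0 < real_of_rat q" using False q by linarith
        then have K0: "0 < real K" using K \<delta> by (smt (verit) divide_nonneg_pos)
        \<comment> \<open>Within \<open>\<delta> / 2\<close> of \<open>y\<close> the support of the
          cone stays in the ball where \<open>f\<close> exceeds \<open>q\<close>; the second bound
          keeps the cone above \<open>a\<close> at \<open>y\<close>.\<close>
        obtain i where i: "dist y (e i) < min (\<delta>/2) ((of_rat q - a) / real K)"
          using dense[of "min (\<delta>/2) ((of_rat q - a) / real K)" y] \<delta> q K0 by auto
        obtain m where m: "enum m = (q, K, i)" using enum by (metis surj_def)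
        have "B m z \<le> f z" for z
        proof (cases "real K * dist z (e i) < of_rat q")
          case True
          have "dist z (e i) < \<delta> / 2"
          proof (rule ccontr)
            assume "\<not> dist z (e i) < \<delta> / 2"
            then have "real K * (\<delta> / 2) \<le> real K * dist z (e i)" using K0 by (intro mult_left_mono) auto
            then show False using True K \<delta> by (simp add: field_simps)
          qed
          then have "dist z y < \<delta>" using i dist_triangle[of z y "e i"] by (simp add: dist_commute)
          then have "of_rat q < f z" by (rule \<delta>(2))
          moreover have "0 \<le> real K * dist z (e i)" by simp
          ultimately show ?thesis using q0 unfolding B_def m B0_def prod.case
            by (intro max.boundedI) linarith+
        qed (use f in \<open>auto simp: B_def m B0_def\<close>)
        then have mS: "m \<in> S" by (simp add: S_def)
        have aB: "a < B m y" using i K0 by (auto simp: B_def m B0_def field_simps)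
        have "a < G (k j) y" if "j \<ge> Suc m" for j
        proof -
          have "B m y \<le> G (k j) y" unfolding G_def dk using mS that by (intro Max_ge) auto
          then show ?thesis using aB by simp
        qed
        then show ?thesis unfolding eventually_sequentially by blast
      qed
    qed
    with le show "\<exists>k. (\<forall>j y. G (k j) y \<le> f y) \<and> (\<forall>y. (\<lambda>j. G (k j) y) \<longlonglongrightarrow> f y)" by blast
  qed (use Gc G0 Gb in auto)
  then show thesis by (rule that)
qed

lemma lower_family_Phi:
  fixes G :: "nat \<Rightarrow> 'b::metric_space \<Rightarrow> real"
  assumes "lower_family G" shows "G j \<in> Phi r"
proof -
  obtain c where "\<And>y. G j y \<le> c" using assms unfolding lower_family_def by blast
  then show ?thesis using assms unfolding lower_family_def by (intro Phi_bounded[of _ c]) simp_all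
qed

text \<open>Approximation by \<open>G\<close> from below yields only lower bounds, for nonnegative
  integrands. Applied to \<open>w + \<psi>\<close> and \<open>w - \<psi>\<close>, where
  \<open>w\<close> is a multiple of \<open>1 + dist y y0 powr r\<close> dominating
  \<open>\<psi>\<close> and the integrals of \<open>w\<close> converge by assumption, they become
  bounds for \<open>\<psi>\<close> from both sides.\<close>

lemma Phi_convI:
  fixes G :: "nat \<Rightarrow> 'b::metric_space \<Rightarrow> real"
  assumes G: "lower_family G" and r: "r > 0" and ps: "\<And>n. ps n \<in> Pr r" and p: "p \<in> Pr r"
    and cG: "\<And>j. (\<lambda>n. \<integral>y. G j y \<partial>(ps n)) \<longlonglongrightarrow> (\<integral>y. G j y \<partial>p)"
    and cd: "(\<lambda>n. \<integral>y. dist y y0 powr r \<partial>(ps n)) \<longlonglongrightarrow> (\<integral>y. dist y y0 powr r \<partial>p)"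
  shows "Phi_conv r ps p"
proof -
  have lower: "\<forall>\<^sub>F n in sequentially. a < (\<integral>y. f y \<partial>(ps n))"
    if f: "f \<in> Phi r" "\<And>y. 0 \<le> f y" and a: "a < (\<integral>y. f y \<partial>p)" for f a
  proof -
    obtain k where k: "\<And>j y. G (k j) y \<le> f y" "\<And>y. (\<lambda>j. G (k j) y) \<longlonglongrightarrow> f y"
      using G Phi_cont[OF f(1)] f(2) unfolding lower_family_def by meson
    have G0: "0 \<le> G j y" for j y using G by (auto simp: lower_family_def)
    have "(\<lambda>j. \<integral>y. G (k j) y \<partial>p) \<longlonglongrightarrow> (\<integral>y. f y \<partial>p)"
    proof (rule integral_dominated_convergence[where w=f])
      show "f \<in> borel_measurable p" "(\<lambda>y. G (k j) y) \<in> borel_measurable p" for j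
        using Phi_measurable[OF f(1) Pr_sets[OF p]] Phi_measurable[OF lower_family_Phi[OF G] Pr_sets[OF p]] by auto
      show "integrable p f" by (rule Phi_integrable[OF p f(1) r])
    qed (use k G0 in auto)
    then have "\<forall>\<^sub>F j in sequentially. a < (\<integral>y. G (k j) y \<partial>p)" using a by (rule order_tendstoD(1))
    then obtain j where "a < (\<integral>y. G (k j) y \<partial>p)" by (auto simp: eventually_sequentially)
    then have ev: "\<forall>\<^sub>F n in sequentially. a < (\<integral>y. G (k j) y \<partial>(ps n))"
      by (rule order_tendstoD(1)[OF cG])
    have le: "(\<integral>y. G (k j) y \<partial>(ps n)) \<le> (\<integral>y. f y \<partial>(ps n))" for n
      by (rule integral_mono[OF Phi_integrable[OF ps lower_family_Phi[OF G] r] Phi_integrable[OF ps f(1) r] k(1)])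
    show ?thesis by (rule eventually_mono[OF ev]) (erule less_le_trans[OF _ le])
  qed
  show ?thesis unfolding Phi_conv_def
  proof (intro ballI order_tendstoI)
    fix \<psi> :: "'b \<Rightarrow> real" assume \<psi>: "\<psi> \<in> Phi r"
    obtain c where c: "\<And>y. \<bar>\<psi> y\<bar> \<le> c * (1 + dist y y0 powr r)" using Phi_bound[OF \<psi> r] by metis
    define w where "w y = c * (1 + dist y y0 powr r)" for y
    have w: "w \<in> Phi r" unfolding w_def by (intro Phi_scale Phi_add Phi_const Phi_dist r)
    have wi: "(\<integral>y. w y \<partial>q) = c + c * (\<integral>y. dist y y0 powr r \<partial>q)" if "q \<in> Pr r" for q
    proof -
      interpret prob_space q by (rule Pr_prob[OF that])
      have "integrable q (\<lambda>y. dist y y0 powr r)" by (rule Phi_integrable[OF that Phi_dist[OF r] r])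
      then show ?thesis unfolding w_def by (simp add: prob_space distrib_left)
    qed
    have cw: "(\<lambda>n. \<integral>y. w y \<partial>(ps n)) \<longlonglongrightarrow> (\<integral>y. w y \<partial>p)"
      unfolding wi[OF ps] wi[OF p] by (intro tendsto_intros cd)
    have wp: "0 \<le> w y + \<psi> y" "0 \<le> w y - \<psi> y" for y using c[of y] by (auto simp: w_def abs_le_iff)
    have ip: "(\<integral>y. w y + \<psi> y \<partial>q) = (\<integral>y. w y \<partial>q) + (\<integral>y. \<psi> y \<partial>q)"
      "(\<integral>y. w y - \<psi> y \<partial>q) = (\<integral>y. w y \<partial>q) - (\<integral>y. \<psi> y \<partial>q)" if "q \<in> Pr r" for q
      using Phi_integrable[OF that w r] Phi_integrable[OF that \<psi> r] by simp_all
    { fix a assume a: "a < (\<integral>y. \<psi> y \<partial>p)"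
      define e where "e = (\<integral>y. \<psi> y \<partial>p) - a"
      have "\<forall>\<^sub>F n in sequentially. (\<integral>y. w y \<partial>p) + (\<integral>y. \<psi> y \<partial>p) - e/2 < (\<integral>y. w y + \<psi> y \<partial>(ps n))"
        by (rule lower[OF Phi_add[OF w \<psi> r] wp(1)]) (use a in \<open>simp add: ip[OF p] e_def\<close>)
      moreover have "\<forall>\<^sub>F n in sequentially. (\<integral>y. w y \<partial>(ps n)) < (\<integral>y. w y \<partial>p) + e/2"
        using cw by (rule order_tendstoD(2)) (use a in \<open>auto simp: e_def\<close>)
      ultimately show "\<forall>\<^sub>F n in sequentially. a < (\<integral>y. \<psi> y \<partial>(ps n))"
        by eventually_elim (unfold ip[OF ps] e_def, simp add: field_simps) }
    { fix a assume a: "(\<integral>y. \<psi> y \<partial>p) < a"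
      define e where "e = a - (\<integral>y. \<psi> y \<partial>p)"
      have "\<forall>\<^sub>F n in sequentially. (\<integral>y. w y \<partial>p) - (\<integral>y. \<psi> y \<partial>p) - e/2 < (\<integral>y. w y - \<psi> y \<partial>(ps n))"
        by (rule lower[OF Phi_diff[OF w \<psi> r] wp(2)]) (use a in \<open>simp add: ip[OF p] e_def\<close>)
      moreover have "\<forall>\<^sub>F n in sequentially. (\<integral>y. w y \<partial>(ps n)) < (\<integral>y. w y \<partial>p) + e/2"
        using cw by (rule order_tendstoD(2)) (use a in \<open>auto simp: e_def\<close>)
      ultimately show "\<forall>\<^sub>F n in sequentially. (\<integral>y. \<psi> y \<partial>(ps n)) < a"
        by eventually_elim (unfold ip[OF ps] e_def, simp add: field_simps) }
  qed
qed

section \<open>Wasserstein convergence\<close>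

lemma wasserstein_le:
  assumes "\<pi> \<in> couplings p q" "(\<integral>\<^sup>+ z. ennreal (dist (fst z) (snd z) powr r) \<partial>\<pi>) \<le> ennreal c" "c \<ge> 0" "r > 0"
  shows "wasserstein r p q powr r \<le> c"
proof -
  let ?I = "INF \<pi>\<in>couplings p q. \<integral>\<^sup>+ z. ennreal (dist (fst z) (snd z) powr r) \<partial>\<pi>"
  have "?I \<le> ennreal c" using assms(1,2) by (rule INF_lower2)
  then have "enn2real ?I \<le> c" using assms(3) by (rule enn2real_leI[rotated])
  moreover have "wasserstein r p q powr r = enn2real ?I" using assms(4) by (simp add: wasserstein_def powr_powr)
  ultimately show ?thesis by simp
qed

lemma wasserstein_return_le:
  fixes y0 :: "'b::{metric_space, second_countable_topology}"
  assumes p: "p \<in> Pr r" and r: "r > 0"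
  shows "wasserstein r p (return borel y0) powr r \<le> (\<integral>y. dist y y0 powr r \<partial>p)"
proof (rule wasserstein_le[OF _ _ _ r])
  interpret prob_space p by (rule Pr_prob[OF p])
  note [measurable_cong] = Pr_sets[OF p]
  let ?\<pi> = "distr p (borel \<Otimes>\<^sub>M borel) (\<lambda>y. (y, y0))"
  have m: "(\<lambda>y. (y, y0)) \<in> measurable p (borel \<Otimes>\<^sub>M borel)" by measurable
  have "distr ?\<pi> borel fst = distr p borel (\<lambda>y. y)" by (subst distr_distr) (auto simp: o_def m)
  also have "\<dots> = p" using Pr_sets[OF p] by (intro distr_id2) simp
  moreover have "distr ?\<pi> borel snd = distr p borel (\<lambda>_. y0)" by (subst distr_distr) (auto simp: o_def m)
  moreover have "distr p borel (\<lambda>_. y0) = return borel y0" by simp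
  moreover have "prob_space ?\<pi>" by (rule prob_space_distr[OF m])
  ultimately show "?\<pi> \<in> couplings p (return borel y0)" by (simp add: couplings_def)
  have i: "integrable p (\<lambda>y. dist y y0 powr r)" by (rule Phi_integrable[OF p Phi_dist[OF r] r])
  have "(\<integral>\<^sup>+ z. ennreal (dist (fst z) (snd z) powr r) \<partial>?\<pi>) = (\<integral>\<^sup>+ y. ennreal (dist y y0 powr r) \<partial>p)"
    by (subst nn_integral_distr[OF m]) (auto simp: split_beta')
  also have "\<dots> = ennreal (\<integral>y. dist y y0 powr r \<partial>p)"
    by (rule nn_integral_eq_integral[OF i]) simp
  finally show "(\<integral>\<^sup>+ z. ennreal (dist (fst z) (snd z) powr r) \<partial>?\<pi>) \<le> ennreal (\<integral>y. dist y y0 powr r \<partial>p)" by simp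
  show "0 \<le> (\<integral>y. dist y y0 powr r \<partial>p)" by simp
qed

text \<open>For a partition of unity \<open>\<eta>\<close> with small supports (apart from the last member), the coupling has density
  \<open>\<Sum>\<^sub>i w\<^sub>i \<eta>\<^sub>i(x) \<eta>\<^sub>i(y) + b(y)\<close> with respect to the product measure, where \<open>b\<close> corrects the marginals.\<close>

lemma partition_coupling:
  fixes p q :: "'b::{metric_space, second_countable_topology} measure" and \<eta> :: "nat \<Rightarrow> 'b \<Rightarrow> real"
  assumes q: "q \<in> Pr r" and p: "p \<in> Pr r" and r: "r > 0"
    and \<eta>c: "\<And>i. continuous_on UNIV (\<eta> i)" and \<eta>0: "\<And>i y. 0 \<le> \<eta> i y" and \<eta>1: "\<And>i y. \<eta> i y \<le> 1"
    and \<eta>s: "\<And>y. (\<Sum>i\<le>k. \<eta> i y) = 1"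
    and \<eta>d: "\<And>i x y. i < k \<Longrightarrow> \<eta> i x \<noteq> 0 \<Longrightarrow> \<eta> i y \<noteq> 0 \<Longrightarrow> dist x y \<le> \<rho>"
    and a: "\<And>i. a i = (\<integral>y. \<eta> i y \<partial>p)" and c: "\<And>i. c i = (\<integral>y. \<eta> i y \<partial>q)"
    and w0: "\<And>i. 0 \<le> w i" and wa: "\<And>i. w i * a i \<le> 1" and wc: "\<And>i. w i * c i \<le> 1"
    and wac: "\<And>i. i \<le> k \<Longrightarrow> a i \<noteq> 0 \<Longrightarrow> w i * c i = l" and l: "0 \<le> l" "l \<le> 1"
  shows "wasserstein r q p powr r \<le> \<rho> powr r
     + 2 powr r * ((\<integral>y. \<eta> k y * dist y y0 powr r \<partial>q) + (\<integral>y. \<eta> k y * dist y y0 powr r \<partial>p))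
     + 2 powr r * (((\<integral>y. dist y y0 powr r \<partial>q) - (\<Sum>i\<le>k. w i * a i * (\<integral>y. \<eta> i y * dist y y0 powr r \<partial>q)))
         + (1 - l) * (\<integral>y. dist y y0 powr r \<partial>p))" (is "_ \<le> ?B")
proof -
  interpret P: prob_space p by (rule Pr_prob[OF p])
  interpret Q: prob_space q by (rule Pr_prob[OF q])
  interpret QP: pair_sigma_finite q p ..
  note [measurable_cong] = Pr_sets[OF p] Pr_sets[OF q]
  define d where "d y = dist y y0 powr r" for y
  define M where "M = (2::real) powr r"
  have M0: "0 \<le> M" by (simp add: M_def)
  have d0: "0 \<le> d y" for y by (simp add: d_def)
  have [measurable]: "\<eta> i \<in> borel_measurable borel" for i by (rule borel_measurable_continuous_onI[OF \<eta>c])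
  have [measurable]: "d \<in> borel_measurable borel"
    unfolding d_def by (rule borel_measurable_continuous_onI[OF continuous_dist_powr[OF r]])
  have \<eta>P: "\<eta> i \<in> Phi r" for i by (rule Phi_bounded[OF \<eta>c, of _ 1]) (use \<eta>0 \<eta>1 in \<open>simp add: abs_of_nonneg\<close>)
  have dP: "d \<in> Phi r" unfolding d_def by (rule Phi_dist[OF r])
  have \<eta>dP: "(\<lambda>y. \<eta> i y * d y) \<in> Phi r" for i
    by (rule Phi_dominated[OF _ dP r, of _ 1])
      (use \<eta>0 \<eta>1 d0 in \<open>auto intro!: continuous_intros \<eta>c Phi_cont[OF dP] simp: abs_mult abs_of_nonneg mult_left_le_one_le\<close>)
  have ip[simp]: "integrable p (\<eta> i)" "integrable p d" "integrable p (\<lambda>y. \<eta> i y * d y)" for i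
    using \<eta>P dP \<eta>dP by (auto intro!: Phi_integrable[OF p _ r])
  have iq[simp]: "integrable q (\<eta> i)" "integrable q d" "integrable q (\<lambda>y. \<eta> i y * d y)" for i
    using \<eta>P dP \<eta>dP by (auto intro!: Phi_integrable[OF q _ r])
  have a0: "0 \<le> a i" and c0: "0 \<le> c i" for i unfolding a c using \<eta>0 by simp_all
  have as: "(\<Sum>i\<le>k. a i) = 1"
  proof -
    have "(\<Sum>i\<le>k. a i) = (\<integral>y. (\<Sum>i\<le>k. \<eta> i y) \<partial>p)" unfolding a by (simp add: Bochner_Integration.integral_sum)
    then show ?thesis by (simp add: \<eta>s P.prob_space)
  qed
  \<comment> \<open>The share of \<open>q\<close> at \<open>y\<close> that the blocks leave
    unmatched. Adding it makes the first marginal exact; \<open>wac\<close> then makes the second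
    one exact.\<close>
  define b where "b y = 1 - (\<Sum>i\<le>k. w i * a i * \<eta> i y)" for y
  have b0: "0 \<le> b y" for y
  proof -
    have "(\<Sum>i\<le>k. w i * a i * \<eta> i y) \<le> (\<Sum>i\<le>k. 1 * \<eta> i y)"
      by (intro sum_mono mult_right_mono wa \<eta>0)
    then show ?thesis by (simp add: b_def \<eta>s)
  qed
  have [measurable]: "b \<in> borel_measurable borel" unfolding b_def by measurable
  define D where "D y x = (\<Sum>i\<le>k. w i * \<eta> i x * \<eta> i y) + b y" for y x
  have D0: "0 \<le> D y x" for y x unfolding D_def by (intro add_nonneg_nonneg sum_nonneg mult_nonneg_nonneg w0 \<eta>0 b0)
  have Dm[measurable]: "(\<lambda>z. D (fst z) (snd z)) \<in> borel_measurable (q \<Otimes>\<^sub>M p)" unfolding D_def by measurable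
  have [measurable]: "D y \<in> borel_measurable p" "(\<lambda>y. D y x) \<in> borel_measurable q" for x y
    unfolding D_def by measurable
  have e2: "w i * a i * c i = l * a i" if "i \<le> k" for i using wac[OF that] by (cases "a i = 0") (auto simp: mult.commute mult.left_commute)
  define \<pi> where "\<pi> = density (q \<Otimes>\<^sub>M p) (\<lambda>z. ennreal (D (fst z) (snd z)))"
  have sets_\<pi>: "sets \<pi> = sets (borel \<Otimes>\<^sub>M borel)"
    unfolding \<pi>_def using Pr_sets[OF p] Pr_sets[OF q] by (simp cong: sets_pair_measure_cong)
  have D1: "(\<integral>\<^sup>+ x. ennreal (D y x) \<partial>p) = 1" for y
  proof -
    have "(\<integral>\<^sup>+ x. ennreal (D y x) \<partial>p) = ennreal (\<integral>x. D y x \<partial>p)"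
      by (rule nn_integral_eq_integral) (use D0 in \<open>auto simp: D_def\<close>)
    also have "(\<integral>x. D y x \<partial>p) = (\<Sum>i\<le>k. w i * a i * \<eta> i y) + b y"
      unfolding D_def by (simp add: Bochner_Integration.integral_sum a P.prob_space)
    finally show ?thesis by (simp add: b_def)
  qed
  \<comment> \<open>Only \<open>p\<close>-almost everywhere: \<open>wac\<close> says nothing about
    members with \<open>a i = 0\<close>, which vanish almost everywhere under
    \<open>p\<close>.\<close>
  have D2: "AE x in p. (\<integral>\<^sup>+ y. ennreal (D y x) \<partial>q) = 1"
  proof -
    have "AE x in p. a i = 0 \<longrightarrow> \<eta> i x = 0" for i
    proof (cases "a i = 0")
      case True
      then have "AE x in p. \<eta> i x = 0"
        using integral_nonneg_eq_0_iff_AE[OF ip(1), of i] \<eta>0 by (simp add: a)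
      then show ?thesis by auto
    qed simp
    then have "AE x in p. \<forall>i. a i = 0 \<longrightarrow> \<eta> i x = 0" by (simp add: AE_all_countable)
    then show ?thesis
    proof eventually_elim
      fix x assume x: "\<forall>i. a i = 0 \<longrightarrow> \<eta> i x = 0"
      have e1: "w i * c i * \<eta> i x = l * \<eta> i x" if "i \<le> k" for i using wac[OF that] x by (cases "a i = 0") auto
      have "(\<integral>\<^sup>+ y. ennreal (D y x) \<partial>q) = ennreal (\<integral>y. D y x \<partial>q)"
        by (rule nn_integral_eq_integral) (use D0 in \<open>auto simp: D_def b_def\<close>)
      also have "(\<integral>y. D y x \<partial>q) = (\<Sum>i\<le>k. w i * \<eta> i x * c i) + (1 - (\<Sum>i\<le>k. w i * a i * c i))"
        unfolding D_def b_def by (simp add: Bochner_Integration.integral_sum c Q.prob_space)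
      also have "(\<Sum>i\<le>k. w i * \<eta> i x * c i) = (\<Sum>i\<le>k. l * \<eta> i x)"
        using e1 by (intro sum.cong) (auto simp: mult_ac)
      also have "\<dots> = l" by (simp add: \<eta>s flip: sum_distrib_left)
      also have "(\<Sum>i\<le>k. w i * a i * c i) = (\<Sum>i\<le>k. l * a i)" by (rule sum.cong) (simp_all add: e2)
      also have "\<dots> = l" by (simp add: as flip: sum_distrib_left)
      finally show "(\<integral>\<^sup>+ y. ennreal (D y x) \<partial>q) = 1" by simp
    qed
  qed
  have m1: "distr \<pi> borel fst = q"
  proof (rule measure_eqI)
    fix A assume "A \<in> sets (distr \<pi> borel fst)"
    then have A[measurable]: "A \<in> sets borel" by simp
    have "emeasure (distr \<pi> borel fst) A = emeasure \<pi> (fst -` A \<inter> space \<pi>)"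
      by (rule emeasure_distr) (auto simp: measurable_cong_sets[OF sets_\<pi> refl])
    also have "\<dots> = (\<integral>\<^sup>+ z. ennreal (D (fst z) (snd z)) * indicator (fst -` A \<inter> space \<pi>) z \<partial>(q \<Otimes>\<^sub>M p))"
      unfolding \<pi>_def by (rule emeasure_density) (auto intro!: measurable_sets[OF measurable_fst''])
    also have "\<dots> = (\<integral>\<^sup>+ z. ennreal (D (fst z) (snd z)) * indicator A (fst z) \<partial>(q \<Otimes>\<^sub>M p))"
      by (rule nn_integral_cong) (auto simp: \<pi>_def indicator_def)
    also have "\<dots> = (\<integral>\<^sup>+ y. \<integral>\<^sup>+ x. ennreal (D y x) * indicator A y \<partial>p \<partial>q)"
      by (subst P.nn_integral_fst[symmetric]) auto
    also have "\<dots> = (\<integral>\<^sup>+ y. indicator A y \<partial>q)"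
      by (rule nn_integral_cong) (simp add: nn_integral_multc D1)
    finally show "emeasure (distr \<pi> borel fst) A = emeasure q A" by simp
  qed (simp add: Pr_sets[OF q])
  have m2: "distr \<pi> borel snd = p"
  proof (rule measure_eqI)
    fix A assume "A \<in> sets (distr \<pi> borel snd)"
    then have A[measurable]: "A \<in> sets borel" by simp
    have "emeasure (distr \<pi> borel snd) A = emeasure \<pi> (snd -` A \<inter> space \<pi>)"
      by (rule emeasure_distr) (auto simp: measurable_cong_sets[OF sets_\<pi> refl])
    also have "\<dots> = (\<integral>\<^sup>+ z. ennreal (D (fst z) (snd z)) * indicator (snd -` A \<inter> space \<pi>) z \<partial>(q \<Otimes>\<^sub>M p))"
      unfolding \<pi>_def by (rule emeasure_density) (auto intro!: measurable_sets[OF measurable_snd''])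
    also have "\<dots> = (\<integral>\<^sup>+ z. ennreal (D (fst z) (snd z)) * indicator A (snd z) \<partial>(q \<Otimes>\<^sub>M p))"
      by (rule nn_integral_cong) (auto simp: \<pi>_def indicator_def)
    also have "\<dots> = (\<integral>\<^sup>+ x. \<integral>\<^sup>+ y. ennreal (D y x) * indicator A x \<partial>q \<partial>p)"
      by (subst QP.nn_integral_snd[symmetric]) auto
    also have "\<dots> = (\<integral>\<^sup>+ x. indicator A x \<partial>p)"
      using D2 by (intro nn_integral_cong_AE, eventually_elim) (simp add: nn_integral_multc)
    finally show "emeasure (distr \<pi> borel snd) A = emeasure p A" by simp
  qed (simp add: Pr_sets[OF p])
  have "prob_space \<pi>"
  proof
    have "emeasure \<pi> (space \<pi>) = emeasure (distr \<pi> borel fst) UNIV"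
      by (subst emeasure_distr) (auto simp: measurable_cong_sets[OF sets_\<pi> refl])
    then show "emeasure \<pi> (space \<pi>) = 1" using Q.emeasure_space_1 by (simp add: m1 Pr_space[OF q])
  qed
  then have coup: "\<pi> \<in> couplings q p" using sets_\<pi> m1 m2 by (simp add: couplings_def)
  \<comment> \<open>A majorant of the cost density: distances within the blocks \<open>i < k\<close>
    are at most \<open>\<rho>\<close>, while the last block and the unmatched mass are estimated
    through the reference point \<open>y0\<close>.\<close>
  define F where "F y x = (\<Sum>i<k. w i * \<eta> i x * \<eta> i y * \<rho> powr r) + w k * \<eta> k x * \<eta> k y * (M * (d y + d x))
     + b y * (M * (d y + d x))" for y x
  have DF: "D y x * dist y x powr r \<le> F y x" for y x
  proof -
    have dd: "dist y x powr r \<le> M * (d y + d x)"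
      using dist_powr_le[OF r, of y x y0] by (simp add: M_def d_def dist_commute)
    have "w i * \<eta> i x * \<eta> i y * dist y x powr r \<le> w i * \<eta> i x * \<eta> i y * \<rho> powr r" if "i < k" for i
    proof (cases "\<eta> i x = 0 \<or> \<eta> i y = 0")
      case False
      then have "dist y x powr r \<le> \<rho> powr r" using \<eta>d[OF that, of y x] r by (intro powr_mono2) auto
      then show ?thesis by (intro mult_left_mono mult_nonneg_nonneg w0 \<eta>0)
    qed auto
    then have 1: "(\<Sum>i<k. w i * \<eta> i x * \<eta> i y * dist y x powr r) \<le> (\<Sum>i<k. w i * \<eta> i x * \<eta> i y * \<rho> powr r)"
      by (intro sum_mono) simp
    have 2: "w k * \<eta> k x * \<eta> k y * dist y x powr r \<le> w k * \<eta> k x * \<eta> k y * (M * (d y + d x))"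
      by (intro mult_left_mono dd mult_nonneg_nonneg w0 \<eta>0)
    have 3: "b y * dist y x powr r \<le> b y * (M * (d y + d x))" by (intro mult_left_mono dd b0)
    have "D y x * dist y x powr r = (\<Sum>i<k. w i * \<eta> i x * \<eta> i y * dist y x powr r)
        + w k * \<eta> k x * \<eta> k y * dist y x powr r + b y * dist y x powr r"
      by (simp add: D_def lessThan_Suc_atMost[symmetric] distrib_right sum_distrib_right)
    with 1 2 3 show ?thesis by (simp add: F_def)
  qed
  have F0: "0 \<le> F y x" for y x
    by (rule order_trans[OF _ DF]) (simp add: D0)
  define pd where "pd = (\<integral>x. d x \<partial>p)"
  define pk where "pk = (\<integral>x. \<eta> k x * d x \<partial>p)"
  define F1 where "F1 y = (\<Sum>i<k. w i * a i * \<eta> i y * \<rho> powr r) + w k * M * (a k * (\<eta> k y * d y) + pk * \<eta> k y)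
     + M * (b y * d y + b y * pd)" for y
  have Fp: "(\<integral>\<^sup>+ x. ennreal (F y x) \<partial>p) = ennreal (F1 y)" for y
  proof -
    have eq: "F y x = (\<Sum>i<k. (w i * \<eta> i y * \<rho> powr r) * \<eta> i x) + (w k * \<eta> k y * M * d y) * \<eta> k x
        + (w k * \<eta> k y * M) * (\<eta> k x * d x) + b y * M * d y + (b y * M) * d x" for x
      by (simp add: F_def algebra_simps)
    have i: "integrable p (F y)" unfolding eq[abs_def] by simp
    have "(\<integral>x. F y x \<partial>p) = (\<Sum>i<k. (w i * \<eta> i y * \<rho> powr r) * a i) + (w k * \<eta> k y * M * d y) * a k
        + (w k * \<eta> k y * M) * pk + b y * M * d y + (b y * M) * pd"
      unfolding eq pd_def pk_def by (simp add: Bochner_Integration.integral_sum a P.prob_space)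
    also have "\<dots> = F1 y" unfolding F1_def by (simp add: algebra_simps)
    finally have "(\<integral>x. F y x \<partial>p) = F1 y" .
    then show ?thesis using nn_integral_eq_integral[OF i] F0 by simp
  qed
  have bd: "b y * d y = d y - (\<Sum>i\<le>k. w i * a i * (\<eta> i y * d y))" for y
    by (simp add: b_def left_diff_distrib sum_distrib_right mult.assoc)
  have ib: "integrable q b" "integrable q (\<lambda>y. b y * d y)"
    unfolding bd by (simp_all add: b_def[abs_def])
  have iF1: "integrable q F1" unfolding F1_def using ib by simp
  have F10: "0 \<le> F1 y" for y
    unfolding F1_def pk_def pd_def using M0 \<eta>0 d0 a0 b0 w0 by (intro add_nonneg_nonneg sum_nonneg mult_nonneg_nonneg integral_nonneg) auto
  have qb: "(\<integral>y. b y \<partial>q) = 1 - l"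
  proof -
    have "(\<integral>y. b y \<partial>q) = 1 - (\<Sum>i\<le>k. w i * a i * c i)"
      unfolding b_def by (simp add: Bochner_Integration.integral_sum c Q.prob_space)
    also have "(\<Sum>i\<le>k. w i * a i * c i) = (\<Sum>i\<le>k. l * a i)"
      by (rule sum.cong) (simp_all add: e2)
    also have "\<dots> = l" by (simp add: as flip: sum_distrib_left)
    finally show ?thesis .
  qed
  have "(\<integral>\<^sup>+ z. ennreal (dist (fst z) (snd z) powr r) \<partial>\<pi>)
      = (\<integral>\<^sup>+ z. ennreal (D (fst z) (snd z)) * ennreal (dist (fst z) (snd z) powr r) \<partial>(q \<Otimes>\<^sub>M p))"
    unfolding \<pi>_def by (rule nn_integral_density) auto
  also have "\<dots> = (\<integral>\<^sup>+ y. \<integral>\<^sup>+ x. ennreal (D y x) * ennreal (dist y x powr r) \<partial>p \<partial>q)"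
    by (subst P.nn_integral_fst[symmetric]) auto
  also have "\<dots> \<le> (\<integral>\<^sup>+ y. \<integral>\<^sup>+ x. ennreal (F y x) \<partial>p \<partial>q)"
    by (intro nn_integral_mono) (simp add: DF D0 ennreal_leI flip: ennreal_mult)
  also have "\<dots> = (\<integral>\<^sup>+ y. ennreal (F1 y) \<partial>q)" by (simp add: Fp)
  also have "\<dots> = ennreal (\<integral>y. F1 y \<partial>q)" by (rule nn_integral_eq_integral[OF iF1]) (simp add: F10)
  finally have cost: "(\<integral>\<^sup>+ z. ennreal (dist (fst z) (snd z) powr r) \<partial>\<pi>) \<le> ennreal (\<integral>y. F1 y \<partial>q)" .
  have "wasserstein r q p powr r \<le> (\<integral>y. F1 y \<partial>q)"
    by (rule wasserstein_le[OF coup cost _ r]) (simp add: F10)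
  also have "(\<integral>y. F1 y \<partial>q) = (\<Sum>i<k. w i * a i * c i) * \<rho> powr r
      + M * (w k * a k * (\<integral>y. \<eta> k y * d y \<partial>q) + w k * c k * pk) + M * ((\<integral>y. b y * d y \<partial>q) + (1 - l) * pd)"
  proof -
    have "(\<integral>y. F1 y \<partial>q) = (\<Sum>i<k. w i * a i * c i * \<rho> powr r) + w k * M * (a k * (\<integral>y. \<eta> k y * d y \<partial>q) + pk * c k)
        + M * ((\<integral>y. b y * d y \<partial>q) + (1 - l) * pd)"
      unfolding F1_def using ib by (simp add: Bochner_Integration.integral_sum c qb)
    then show ?thesis unfolding sum_distrib_right[symmetric] by (simp add: algebra_simps)
  qed
  also have "\<dots> \<le> 1 * \<rho> powr r + M * (1 * (\<integral>y. \<eta> k y * d y \<partial>q) + 1 * pk) + M * ((\<integral>y. b y * d y \<partial>q) + (1 - l) * pd)"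
  proof -
    have "(\<Sum>i<k. w i * a i * c i) \<le> (\<Sum>i\<le>k. w i * a i * c i)"
      by (rule sum_mono2) (use w0 a0 c0 in auto)
    also have "\<dots> = (\<Sum>i\<le>k. l * a i)" by (rule sum.cong) (simp_all add: e2)
    also have "\<dots> = l" by (simp add: as flip: sum_distrib_left)
    finally have "(\<Sum>i<k. w i * a i * c i) * \<rho> powr r \<le> 1 * \<rho> powr r" using l(2) by (intro mult_right_mono) auto
    moreover have "0 \<le> pk" "0 \<le> (\<integral>y. \<eta> k y * d y \<partial>q)" unfolding pk_def using \<eta>0 d0 by simp_all
    then have "M * (w k * a k * (\<integral>y. \<eta> k y * d y \<partial>q) + w k * c k * pk) \<le> M * (1 * (\<integral>y. \<eta> k y * d y \<partial>q) + 1 * pk)"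
      by (intro mult_left_mono add_mono mult_right_mono wa wc M0)
    ultimately show ?thesis by linarith
  qed
  also have "(\<integral>y. b y * d y \<partial>q) = (\<integral>y. d y \<partial>q) - (\<Sum>i\<le>k. w i * a i * (\<integral>y. \<eta> i y * d y \<partial>q))"
    unfolding bd by (simp add: Bochner_Integration.integral_sum)
  finally show ?thesis by (simp add: M_def pd_def pk_def d_def)
qed

text \<open>With a fixed finite partition of unity, the bound of \<open>partition_coupling\<close>
  consists of finitely many integrals of members of \<open>Phi r\<close> and of weights that
  converge with them. In the limit only the diameter of the blocks and the moment carried by the
  last member remain.\<close>

lemma wasserstein_tendsto_0:
  fixes p :: "'b::{metric_space, second_countable_topology} measure"
  assumes ps: "\<And>n. ps n \<in> Pr r" and p: "p \<in> Pr r" and r: "r > 0" and conv: "Phi_conv r ps p"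
  shows "(\<lambda>n. wasserstein r (ps n) p) \<longlonglongrightarrow> 0"
proof (rule order_tendstoI)
  fix x :: real assume "x < 0"
  moreover have "0 \<le> wasserstein r (ps n) p" for n by (simp add: wasserstein_def)
  ultimately show "\<forall>\<^sub>F n in sequentially. x < wasserstein r (ps n) p"
    by (intro always_eventually allI) (rule less_le_trans)
next
  fix e :: real assume e: "0 < e"
  interpret P: prob_space p by (rule Pr_prob[OF p])
  define y0 :: 'b where "y0 = undefined"
  define d where "d y = dist y y0 powr r" for y
  have d0: "0 \<le> d y" for y by (simp add: d_def)
  have dP: "d \<in> Phi r" unfolding d_def by (rule Phi_dist[OF r])
  define M where "M = (2::real) powr r"
  have M0: "0 < M" by (simp add: M_def)
  obtain D :: "'b set" where D: "countable D" "\<And>X. open X \<Longrightarrow> X \<noteq> {} \<Longrightarrow> \<exists>z\<in>D. z \<in> X"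
    using countable_dense_setE by blast
  then have "D \<noteq> {}" using D(2)[of UNIV] by auto
  define t where "t = from_nat_into D"
  have dense: "\<exists>i. dist y (t i) < \<delta>" if "\<delta> > 0" for y \<delta>
  proof -
    obtain z where z: "z \<in> D" "z \<in> ball y \<delta>" using D(2)[of "ball y \<delta>"] \<open>\<delta> > 0\<close> by auto
    then obtain i where "z = t i" unfolding t_def using from_nat_into_surj[OF D(1) z(1)] by auto
    then show ?thesis using z by auto
  qed
  \<comment> \<open>\<open>\<rho>\<close> is chosen so that the diameter term is a quarter of
    \<open>e powr r\<close>; the two tail terms, with \<open>k\<close> chosen below, add less than
    another quarter.\<close>
  define \<rho> where "\<rho> = e / 4 powr (1/r)"
  have \<rho>: "\<rho> > 0" using e by (simp add: \<rho>_def)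
  have \<rho>r: "\<rho> powr r = e powr r / 4"
    using e r by (simp add: \<rho>_def powr_divide powr_powr)
  define \<beta> where "\<beta> i y = min 1 (max 0 (2 - dist y (t i) / (\<rho> / 4)))" for i y
  have \<beta>01: "0 \<le> \<beta> i y" "\<beta> i y \<le> 1" for i y by (auto simp: \<beta>_def)
  have \<beta>c: "continuous_on UNIV (\<beta> i)" for i unfolding \<beta>_def using \<rho> by (intro continuous_intros) auto
  \<comment> \<open>What is left of 1 after the first \<open>k\<close> bumps have taken their
    shares. It becomes exactly zero at each point, because a dense point within
    \<open>\<rho> / 4\<close> has a bump equal to 1 there.\<close>
  define R where "R k y = (\<Prod>i<k. 1 - \<beta> i y)" for k y
  have R01: "0 \<le> R k y" "R k y \<le> 1" for k y
    unfolding R_def using \<beta>01 by (auto intro!: prod_nonneg prod_le_1)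
  have Rc: "continuous_on UNIV (R k)" for k unfolding R_def by (intro continuous_intros \<beta>c)
  have RS: "(\<Sum>i<k. \<beta> i y * R i y) = 1 - R k y" for k y
    by (induction k) (auto simp: R_def algebra_simps)
  have Rd: "(\<lambda>y. R k y * d y) \<in> Phi r" for k
    by (rule Phi_dominated[OF _ dP r, of _ 1])
      (use R01 d0 in \<open>auto intro!: continuous_intros Rc Phi_cont[OF dP] simp: abs_mult abs_of_nonneg mult_left_le_one_le\<close>)
  have "(\<lambda>k. \<integral>y. R k y * d y \<partial>p) \<longlonglongrightarrow> (\<integral>y. 0 \<partial>p)"
  proof (rule integral_dominated_convergence[where w=d])
    show "(\<lambda>y. R k y * d y) \<in> borel_measurable p" for k by (rule Phi_measurable[OF Rd Pr_sets[OF p]])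
    show "integrable p d" by (rule Phi_integrable[OF p dP r])
    have "(\<lambda>k. R k y * d y) \<longlonglongrightarrow> 0" for y
    proof -
      obtain i where i: "dist y (t i) < \<rho> / 4" using dense[of "\<rho>/4" y] \<rho> by auto
      then have "dist y (t i) / (\<rho> / 4) \<le> 1" using \<rho> by (simp add: field_simps)
      then have "\<beta> i y = 1" by (simp add: \<beta>_def)
      then have "R k y = 0" if "k \<ge> Suc i" for k
        unfolding R_def using that by (intro prod_zero) auto
      then have "\<forall>\<^sub>F k in sequentially. R k y * d y = 0" unfolding eventually_sequentially by (intro exI[of _ "Suc i"]) simp
      then show ?thesis by (rule tendsto_eventually)
    qed
    then show "AE y in p. (\<lambda>k. R k y * d y) \<longlonglongrightarrow> 0" by simp
    show "AE y in p. norm (R k y * d y) \<le> d y" for k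
      using R01 d0 by (simp add: abs_mult abs_of_nonneg mult_left_le_one_le)
  qed simp
  then have "(\<lambda>k. \<integral>y. R k y * d y \<partial>p) \<longlonglongrightarrow> 0" by simp
  then have "\<forall>\<^sub>F k in sequentially. (\<integral>y. R k y * d y \<partial>p) < e powr r / (8 * M)"
    by (rule order_tendstoD(2)) (use e M0 in simp)
  then obtain k where k: "(\<integral>y. R k y * d y \<partial>p) < e powr r / (8 * M)" by (auto simp: eventually_sequentially)
  define \<eta> where "\<eta> i y = (if i < k then \<beta> i y * R i y else R k y)" for i y
  have \<eta>c: "continuous_on UNIV (\<eta> i)" for i
    unfolding \<eta>_def by (cases "i < k") (simp_all add: continuous_on_mult[OF \<beta>c Rc] Rc)
  have \<eta>0: "0 \<le> \<eta> i y" for i y unfolding \<eta>_def using \<beta>01 R01 by simp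
  have \<eta>1: "\<eta> i y \<le> 1" for i y unfolding \<eta>_def using \<beta>01 R01 by (simp add: mult_le_one)
  have \<eta>s: "(\<Sum>i\<le>k. \<eta> i y) = 1" for y
  proof -
    have "(\<Sum>i\<le>k. \<eta> i y) = (\<Sum>i<k. \<beta> i y * R i y) + R k y"
      by (simp add: lessThan_Suc_atMost[symmetric] \<eta>_def)
    then show ?thesis by (simp add: RS)
  qed
  have \<eta>d: "dist x y \<le> \<rho>" if "i < k" "\<eta> i x \<noteq> 0" "\<eta> i y \<noteq> 0" for i x y
  proof -
    have *: "dist z (t i) \<le> \<rho> / 2" if "\<eta> i z \<noteq> 0" for z
    proof (rule ccontr)
      assume "\<not> dist z (t i) \<le> \<rho> / 2"
      then have "2 - dist z (t i) / (\<rho> / 4) \<le> 0" using \<rho> by (simp add: field_simps)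
      then have "\<beta> i z = 0" by (simp add: \<beta>_def)
      then show False using that \<open>i < k\<close> by (simp add: \<eta>_def)
    qed
    then show ?thesis using *[OF that(2)] *[OF that(3)] dist_triangle2[of x y "t i"] by simp
  qed
  have \<eta>P: "\<eta> i \<in> Phi r" for i by (rule Phi_bounded[OF \<eta>c, of _ 1]) (use \<eta>0 \<eta>1 in \<open>simp add: abs_of_nonneg\<close>)
  have \<eta>dP: "(\<lambda>y. \<eta> i y * d y) \<in> Phi r" for i
    by (rule Phi_dominated[OF _ dP r, of _ 1])
      (use \<eta>0 \<eta>1 d0 in \<open>auto intro!: continuous_intros \<eta>c Phi_cont[OF dP] simp: abs_mult abs_of_nonneg mult_left_le_one_le\<close>)
  define a where "a i = (\<integral>y. \<eta> i y \<partial>p)" for i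
  define c where "c n i = (\<integral>y. \<eta> i y \<partial>(ps n))" for n i
  have a0: "0 \<le> a i" and c0: "0 \<le> c n i" for n i unfolding a_def c_def using \<eta>0 by simp_all
  define J where "J = {i\<in>{..k}. a i > 0}"
  \<comment> \<open>A common proportion in which every block charged by \<open>p\<close> can be
    matched: a product of numbers in \<open>[0, 1]\<close> is at most each factor, and all the
    factors tend to 1.\<close>
  define l where "l n = (\<Prod>i\<in>J. min 1 (c n i / a i))" for n
  define w where "w n i = (if i \<in> J then l n / c n i else 0)" for n i
  have l0: "0 \<le> l n" for n unfolding l_def using a0 c0 by (intro prod_nonneg) auto
  have l1: "l n \<le> 1" for n unfolding l_def using a0 c0 by (intro prod_le_1) auto
  have fJ: "finite J" by (simp add: J_def)
  have lc: "l n * a i \<le> c n i" if "i \<in> J" for n i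
  proof -
    have "l n = min 1 (c n i / a i) * (\<Prod>i\<in>J - {i}. min 1 (c n i / a i))"
      unfolding l_def using that fJ by (rule prod.remove[rotated])
    also have "\<dots> \<le> min 1 (c n i / a i) * 1"
      using a0 c0 by (intro mult_left_mono prod_le_1) auto
    also have "\<dots> \<le> c n i / a i" by simp
    finally show ?thesis using that by (simp add: J_def field_simps)
  qed
  \<comment> \<open>A block without mass under \<open>ps n\<close> forces \<open>l n = 0\<close>, so
    the division by zero in \<open>w\<close> does no harm.\<close>
  have lc0: "l n = 0" if "i \<in> J" "c n i = 0" for n i
    using lc[OF that(1), of n] l0[of n] that mult_nonneg_nonneg[OF l0[of n] a0[of i]] by (auto simp: J_def)
  define B where "B n = \<rho> powr r + M * ((\<integral>y. \<eta> k y * d y \<partial>(ps n)) + (\<integral>y. \<eta> k y * d y \<partial>p))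
     + M * (((\<integral>y. d y \<partial>(ps n)) - (\<Sum>i\<le>k. w n i * a i * (\<integral>y. \<eta> i y * d y \<partial>(ps n)))) + (1 - l n) * (\<integral>y. d y \<partial>p))" for n
  have a_zero: "a i = 0" if "i \<le> k" "i \<notin> J" for i using that a0[of i] by (simp add: J_def)
  have WB: "wasserstein r (ps n) p powr r \<le> B n" for n
    unfolding B_def d_def M_def
  proof (rule partition_coupling[OF ps p r \<eta>c \<eta>0 \<eta>1 \<eta>s \<eta>d a_def c_def])
    show "0 \<le> w n i" for i using l0 c0 by (simp add: w_def)
    show "w n i * a i \<le> 1" for i
      using lc[of i n] lc0[of i n] c0[of n i] by (cases "c n i = 0") (auto simp: w_def field_simps)
    show "w n i * c n i \<le> 1" for i using l1[of n] by (simp add: w_def)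
    show "w n i * c n i = l n" if "i \<le> k" "a i \<noteq> 0" for i
      using a_zero[OF that(1)] that(2) lc0[of i n] by (cases "c n i = 0") (auto simp: w_def)
  qed (use l0 l1 in auto)
  have ca: "(\<lambda>n. c n i) \<longlonglongrightarrow> a i" for i
    using conv \<eta>P unfolding Phi_conv_def c_def a_def by blast
  have cd: "(\<lambda>n. \<integral>y. \<eta> i y * d y \<partial>(ps n)) \<longlonglongrightarrow> (\<integral>y. \<eta> i y * d y \<partial>p)" for i
    using conv \<eta>dP[of i] unfolding Phi_conv_def by (rule bspec)
  have cdd: "(\<lambda>n. \<integral>y. d y \<partial>(ps n)) \<longlonglongrightarrow> (\<integral>y. d y \<partial>p)"
    using conv dP unfolding Phi_conv_def by (rule bspec)
  have l_lim: "l \<longlonglongrightarrow> 1"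
  proof -
    have "(\<lambda>n. \<Prod>i\<in>J. min 1 (c n i / a i)) \<longlonglongrightarrow> (\<Prod>i\<in>J. min 1 (a i / a i))"
      by (intro tendsto_prod tendsto_min tendsto_const tendsto_divide ca) (auto simp: J_def)
    also have "(\<Prod>i\<in>J. min 1 (a i / a i)) = 1" by (intro prod.neutral) (auto simp: J_def)
    finally show ?thesis unfolding l_def .
  qed
  have wl: "(\<lambda>n. w n i * a i * (\<integral>y. \<eta> i y * d y \<partial>(ps n))) \<longlonglongrightarrow> (\<integral>y. \<eta> i y * d y \<partial>p)" if "i \<le> k" for i
  proof (cases "i \<in> J")
    case True
    then have "a i \<noteq> 0" by (simp add: J_def)
    then have "(\<lambda>n. l n / c n i * a i * (\<integral>y. \<eta> i y * d y \<partial>(ps n))) \<longlonglongrightarrow> 1 / a i * a i * (\<integral>y. \<eta> i y * d y \<partial>p)"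
      by (intro tendsto_intros l_lim ca cd)
    then show ?thesis using True \<open>a i \<noteq> 0\<close> by (simp add: w_def)
  next
    case False
    then have "AE y in p. \<eta> i y = 0"
      using integral_nonneg_eq_0_iff_AE[OF Phi_integrable[OF p \<eta>P[of i] r]] \<eta>0 a_zero[OF that False] by (simp add: a_def)
    then have "(\<integral>y. \<eta> i y * d y \<partial>p) = (\<integral>y. 0 \<partial>p)"
      by (intro integral_cong_AE Phi_measurable[OF \<eta>dP Pr_sets[OF p]]) auto
    then show ?thesis using False by (simp add: w_def)
  qed
  have "(\<Sum>i\<le>k. \<integral>y. \<eta> i y * d y \<partial>p) = (\<integral>y. (\<Sum>i\<le>k. \<eta> i y * d y) \<partial>p)"
    by (rule Bochner_Integration.integral_sum[symmetric]) (rule Phi_integrable[OF p \<eta>dP r])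
  also have "\<dots> = (\<integral>y. d y \<partial>p)" by (simp add: \<eta>s flip: sum_distrib_right)
  finally have sd: "(\<Sum>i\<le>k. \<integral>y. \<eta> i y * d y \<partial>p) = (\<integral>y. d y \<partial>p)" .
  have "B \<longlonglongrightarrow> \<rho> powr r + M * ((\<integral>y. \<eta> k y * d y \<partial>p) + (\<integral>y. \<eta> k y * d y \<partial>p))
     + M * (((\<integral>y. d y \<partial>p) - (\<Sum>i\<le>k. \<integral>y. \<eta> i y * d y \<partial>p)) + (1 - 1) * (\<integral>y. d y \<partial>p))"
    unfolding B_def by (intro tendsto_intros cd cdd l_lim wl) auto
  then have "\<forall>\<^sub>F n in sequentially. B n < e powr r"
  proof (rule order_tendstoD(2))
    have "M * (\<integral>y. \<eta> k y * d y \<partial>p) < e powr r / 8" using k M0 by (simp add: \<eta>_def field_simps)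
    moreover have "0 < e powr r" using e by simp
    ultimately have "e powr r / 4 + 2 * (M * (\<integral>y. \<eta> k y * d y \<partial>p)) < e powr r" by linarith
    then show "\<rho> powr r + M * ((\<integral>y. \<eta> k y * d y \<partial>p) + (\<integral>y. \<eta> k y * d y \<partial>p))
     + M * (((\<integral>y. d y \<partial>p) - (\<Sum>i\<le>k. \<integral>y. \<eta> i y * d y \<partial>p)) + (1 - 1) * (\<integral>y. d y \<partial>p)) < e powr r"
      unfolding sd \<rho>r distrib_left by simp
  qed
  then show "\<forall>\<^sub>F n in sequentially. wasserstein r (ps n) p < e"
  proof eventually_elim
    case (elim n)
    then have "wasserstein r (ps n) p powr r < e powr r" using WB[of n] by simp
    then show ?case using r e powr_mono2[of r e "wasserstein r (ps n) p"] by force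
  qed
qed

section \<open>Relative compactness\<close>

text \<open>A continuous substitute for the indicator of \<open>u > N\<close>: a value below 1 still
  gives \<open>u y < N + 1\<close>.\<close>

definition cut :: "real \<Rightarrow> ('b \<Rightarrow> real) \<Rightarrow> 'b \<Rightarrow> real" where
  "cut N u y = min 1 (max 0 (u y - N))"

definition tail :: "real \<Rightarrow> 'b::metric_space \<Rightarrow> real \<Rightarrow> 'b \<Rightarrow> real" where
  "tail r y0 N y = max 0 (dist y y0 powr r - N)"

lemma cut_range: "0 \<le> cut N u y" "cut N u y \<le> 1"
  by (auto simp: cut_def)

lemma cut_cont: "continuous_on UNIV u \<Longrightarrow> continuous_on UNIV (cut N u)"
  unfolding cut_def by (intro continuous_intros)

lemma cut_Phi: "continuous_on UNIV u \<Longrightarrow> cut N u \<in> Phi r"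
  by (rule Phi_bounded[OF cut_cont, of _ _ 1]) (use cut_range[of N u] in \<open>auto simp: abs_le_iff intro: order_trans\<close>)

lemma tail_nonneg: "0 \<le> tail r y0 N y" by (simp add: tail_def)

lemma tail_Phi:
  assumes "r > 0" shows "tail r y0 N \<in> Phi r"
proof (rule Phi_dominated[where C = 1])
  show "continuous_on UNIV (tail r y0 N)"
    unfolding tail_def by (intro continuous_on_max continuous_on_diff continuous_on_const continuous_dist_powr assms)
  show "(\<lambda>y. dist y y0 powr r + \<bar>N\<bar>) \<in> Phi r" by (intro Phi_add Phi_dist Phi_const assms)
  show "\<bar>tail r y0 N y\<bar> \<le> 1 * \<bar>dist y y0 powr r + \<bar>N\<bar>\<bar>" for y by (simp add: tail_def)
qed (rule assms)

lemma cut_mono: "u y \<le> v y \<Longrightarrow> cut N u y \<le> cut N v y"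
  unfolding cut_def by (intro min.mono max.mono) simp_all

lemma coercive_cont: "coercive u \<Longrightarrow> continuous_on UNIV (u j)"
  by (simp add: coercive_def)

lemma coercive_mono: assumes "coercive u" "i \<le> j" shows "u i y \<le> u j y"
  using assms(2)
proof (induction j rule: dec_induct)
  case (step n)
  have "u n y \<le> u (Suc n) y" using assms(1) by (simp add: coercive_def)
  with step show ?case by simp
qed simp

lemma open_eq_pos:
  fixes U :: "'b::metric_space set"
  assumes "open U"
  obtains h :: "'b \<Rightarrow> real" where "continuous_on UNIV h" "\<And>x. 0 \<le> h x" "\<And>x. h x \<le> 1" "U = {x. 0 < h x}"
proof (cases "U = UNIV")
  case True
  then show thesis by (intro that[of "\<lambda>_. 1"]) auto
next
  case False
  have "closed (- U)" "- U \<noteq> {}" using assms False by auto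
  then have "x \<in> - U \<longleftrightarrow> infdist x (- U) = 0" for x by (rule in_closed_iff_infdist_zero)
  moreover have "0 \<le> infdist x (- U)" for x by (rule infdist_nonneg)
  ultimately have "x \<in> U \<longleftrightarrow> 0 < infdist x (- U)" for x by (metis ComplD ComplI order_less_le)
  then show thesis
    by (intro that[of "\<lambda>x. min 1 (infdist x (- U))"]) (auto intro!: continuous_intros simp: infdist_nonneg)
qed

text \<open>Dini's argument with compactness replaced by penalties \<open>w\<close> that are small
  under \<open>l\<close>. If \<open>f n \<le> d + C * w n\<close> failed for every \<open>n\<close>,
  violating points \<open>s n\<close> would satisfy \<open>w n (s n) \<le> 1\<close>, because
  \<open>f n \<le> C\<close>; along a convergent subsequence every \<open>f m\<close> would be at
  least \<open>d\<close> at the limit point. The penalty may change with its index, so the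
  \<open>n\<close>-th one needs to enforce only finitely many constraints, which is enough along a
  sequence.\<close>

lemma vanishing_on_tight:
  fixes \<Omega> :: "'s set" and l :: "('s \<Rightarrow> real) \<Rightarrow> real" and f :: "nat \<Rightarrow> 's \<Rightarrow> real"
  assumes V_add: "\<And>f g. f \<in> V \<Longrightarrow> g \<in> V \<Longrightarrow> (\<lambda>x. f x + g x) \<in> V"
    and V_scale: "\<And>c f. f \<in> V \<Longrightarrow> (\<lambda>x. c * f x) \<in> V" and one: "(\<lambda>_. 1) \<in> V"
    and l_add: "\<And>f g. f \<in> V \<Longrightarrow> g \<in> V \<Longrightarrow> l (\<lambda>x. f x + g x) = l f + l g"
    and l_scale: "\<And>c f. f \<in> V \<Longrightarrow> l (\<lambda>x. c * f x) = c * l f"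
    and l_mono: "\<And>f g. f \<in> V \<Longrightarrow> g \<in> V \<Longrightarrow> (\<And>x. x \<in> \<Omega> \<Longrightarrow> f x \<le> g x) \<Longrightarrow> l f \<le> l g"
    and l_one: "l (\<lambda>_. 1) = 1"
    and fV: "\<And>n. f n \<in> V" and dec: "\<And>n x. x \<in> \<Omega> \<Longrightarrow> f (Suc n) x \<le> f n x"
    and f0: "\<And>n x. x \<in> \<Omega> \<Longrightarrow> 0 \<le> f n x" and lim: "\<And>x. x \<in> \<Omega> \<Longrightarrow> (\<lambda>n. f n x) \<longlonglongrightarrow> 0"
    and bnd: "\<And>x. x \<in> \<Omega> \<Longrightarrow> f 0 x \<le> c"
    and tight: "\<And>e. e > 0 \<Longrightarrow> \<exists>w. (\<forall>J. w J \<in> V \<and> l (w J) \<le> e \<and> (\<forall>x\<in>\<Omega>. 0 \<le> w J x)) \<and>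
       (\<forall>s :: nat \<Rightarrow> 's. (\<forall>n. s n \<in> \<Omega> \<and> w n (s n) \<le> 1) \<longrightarrow>
          (\<exists>k x. strict_mono k \<and> x \<in> \<Omega> \<and> (\<forall>m. (\<lambda>n. f m (s (k n))) \<longlonglongrightarrow> f m x)))"
  shows "(\<lambda>n. l (f n)) \<longlonglongrightarrow> 0"
proof -
  define C where "C = max 1 c"
  have anti: "f n x \<le> f m x" if "x \<in> \<Omega>" "m \<le> n" for m n x
    using that(2) by (induction n rule: dec_induct) (use dec[OF that(1)] in \<open>auto intro: order_trans\<close>)
  have zero: "(\<lambda>_. 0) \<in> V" "l (\<lambda>_. 0) = 0" using V_scale[OF one, of 0] l_scale[OF one, of 0] by auto
  have l0: "0 \<le> l (f n)" for n using l_mono[OF zero(1) fV f0] zero(2) by simp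
  have lanti: "l (f n) \<le> l (f m)" if "m \<le> n" for m n by (rule l_mono[OF fV fV anti[OF _ that]])
  have "\<exists>n. l (f n) \<le> e" if e: "e > 0" for e
  proof -
    \<comment> \<open>Chosen so that the constant \<open>d\<close> and the penalty term
      \<open>C * d\<close> add up to \<open>e\<close>.\<close>
    define d where "d = e / (1 + C)"
    have d: "d > 0" "d * (1 + C) = e" using e by (auto simp: d_def C_def field_simps)
    obtain w where w: "\<And>J. w J \<in> V" "\<And>J. l (w J) \<le> d" "\<And>J x. x \<in> \<Omega> \<Longrightarrow> 0 \<le> w J x"
      and seq: "\<And>s :: nat \<Rightarrow> 's. (\<forall>n. s n \<in> \<Omega> \<and> w n (s n) \<le> 1) \<Longrightarrow>
          \<exists>k x. strict_mono k \<and> x \<in> \<Omega> \<and> (\<forall>m. (\<lambda>n. f m (s (k n))) \<longlonglongrightarrow> f m x)"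
      using tight[OF d(1)] by metis
    have "\<exists>n. \<forall>x\<in>\<Omega>. f n x \<le> d + C * w n x"
    proof (rule ccontr)
      assume "\<nexists>n. \<forall>x\<in>\<Omega>. f n x \<le> d + C * w n x"
      then have "\<forall>n. \<exists>x. x \<in> \<Omega> \<and> d + C * w n x < f n x" by (meson not_le)
      then obtain s where s: "\<And>n. s n \<in> \<Omega>" "\<And>n. d + C * w n (s n) < f n (s n)" by metis
      have "w n (s n) \<le> 1" for n
      proof -
        have "f n (s n) \<le> C" using anti[OF s(1), of 0 n n] bnd[OF s(1)[of n]] by (simp add: C_def)
        then have "C * w n (s n) \<le> C * 1" using s(2)[of n] d by simp
        then show ?thesis by (rule mult_left_le_imp_le) (simp add: C_def)
      qed
      then obtain k x where k: "strict_mono k" "x \<in> \<Omega>" "\<And>m. (\<lambda>n. f m (s (k n))) \<longlonglongrightarrow> f m x"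
        using seq[of s] s(1) by blast
      have "d \<le> f m x" for m
      proof (rule LIMSEQ_le_const[OF k(3)], intro exI allI impI)
        fix n assume "m \<le> n"
        then have "m \<le> k n" using seq_suble[OF k(1), of n] by simp
        then have "f (k n) (s (k n)) \<le> f m (s (k n))" by (rule anti[OF s(1)])
        moreover have "0 \<le> C * w (k n) (s (k n))" using w(3)[OF s(1)] by (simp add: C_def)
        ultimately show "d \<le> f m (s (k n))" using s(2)[of "k n"] by linarith
      qed
      then have "d \<le> 0" using LIMSEQ_le_const[OF lim[OF k(2)]] by blast
      with d show False by simp
    qed
    then obtain n where n: "\<And>x. x \<in> \<Omega> \<Longrightarrow> f n x \<le> d + C * w n x" by blast
    have cd: "(\<lambda>_. d * 1) \<in> V" by (rule V_scale[OF one])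
    have "l (f n) \<le> l (\<lambda>x. d * 1 + C * w n x)"
      by (rule l_mono[OF fV V_add[OF cd V_scale[OF w(1)]]]) (use n in auto)
    also have "\<dots> = d + C * l (w n)"
      using l_add[OF cd V_scale[OF w(1)]] l_scale[OF one, of d] l_scale[OF w(1)] l_one by simp
    also have "\<dots> \<le> d + C * d" using w(2)[of n] by (intro add_left_mono mult_left_mono) (auto simp: C_def)
    also have "\<dots> = e" using d(2) by (simp add: algebra_simps)
    finally show ?thesis by blast
  qed
  then have ex: "\<exists>n. l (f n) < e" if "e > 0" for e using that half_gt_zero[OF that] by (metis field_sum_of_halves less_add_same_cancel1 order_le_less_trans)
  show ?thesis
  proof (rule order_tendstoI)
    fix a :: real assume "0 < a"
    then obtain n where "l (f n) < a" using ex by blast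
    then have "l (f m) < a" if "m \<ge> n" for m using lanti[OF that] by simp
    then show "\<forall>\<^sub>F n in sequentially. l (f n) < a" unfolding eventually_sequentially by blast
  next
    fix a :: real assume "a < 0"
    then show "\<forall>\<^sub>F n in sequentially. a < l (f n)" using l0 by (intro always_eventually allI) (rule less_le_trans)
  qed
qed

lemma diagonal_convergent:
  fixes z :: "nat \<Rightarrow> nat \<Rightarrow> real"
  assumes "\<And>j n. \<bar>z n j\<bar> \<le> b j"
  obtains s where "strict_mono s" "\<And>j. convergent (\<lambda>n. z (s n) j)"
proof -
  define P where "P j s \<longleftrightarrow> convergent (\<lambda>n. z (s n) j)" for j and s :: "nat \<Rightarrow> nat"
  interpret subseqs P
  proof
    fix j and s :: "nat \<Rightarrow> nat" assume "strict_mono s"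
    have "bounded (range (\<lambda>n. z (s n) j))" using assms[of _ j] by (auto simp: bounded_iff)
    then obtain l k where "strict_mono k" "((\<lambda>n. z (s n) j) \<circ> k) \<longlonglongrightarrow> l"
      using bounded_imp_convergent_subsequence by blast
    then show "\<exists>k. strict_mono k \<and> P j (s \<circ> k)" unfolding P_def convergent_def by (auto simp: o_def)
  qed
  show thesis
  proof (rule that[OF subseq_diagseq])
    fix j
    have "P j (diagseq \<circ> (+) (Suc j))"
    proof (rule diagseq_holds)
      fix r s :: "nat \<Rightarrow> nat" and n assume rs: "strict_mono r" "P n s"
      then obtain L where "(\<lambda>i. z (s i) n) \<longlonglongrightarrow> L" unfolding P_def convergent_def by blast
      from LIMSEQ_subseq_LIMSEQ[OF this rs(1)] show "P n (s \<circ> r)" unfolding P_def convergent_def by (auto simp: o_def)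
    qed
    then obtain L where "(\<lambda>n. z (diagseq (n + Suc j)) j) \<longlonglongrightarrow> L"
      unfolding P_def convergent_def by (auto simp: o_def add.commute)
    then have "(\<lambda>n. z (diagseq n) j) \<longlonglongrightarrow> L" by (rule LIMSEQ_offset)
    then show "convergent (\<lambda>n. z (diagseq n) j)" unfolding convergent_def by blast
  qed
qed

text \<open>Bookkeeping for the penalties. The factor \<open>2 ^ Suc i\<close> turns a total of at
  most 1 into the bound \<open>(1/2) ^ Suc i\<close> on the \<open>i\<close>-th term, while terms of
  size \<open>e / 4 ^ Suc i\<close> keep the weighted total below \<open>e\<close>.\<close>

lemma sum_weights_le: "(\<Sum>i\<le>J. 2 ^ Suc i * (e / 4 ^ Suc i)) \<le> (e::real)" if "e \<ge> 0"
proof -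
  have "(\<Sum>i\<le>J. 2 ^ Suc i * (e / 4 ^ Suc i)) = (\<Sum>i\<le>J. (1/2) ^ Suc i * e)"
    by (rule sum.cong) (auto simp: power_divide field_simps simp flip: power_mult_distrib)
  also have "\<dots> = e * (\<Sum>i\<le>J. (1/2) ^ Suc i)" by (simp add: sum_distrib_left mult.commute)
  also have "(\<Sum>i\<le>J. (1/2::real) ^ Suc i) = 1 - (1/2) ^ Suc J" by (induction J) auto
  also have "e * (1 - (1/2) ^ Suc J) \<le> e * 1" using that by (intro mult_left_mono) auto
  finally show ?thesis by simp
qed

text \<open>Limits along a diagonal subsequence exist on a countable family only; extending them by a linear functional below the
  limes superior makes the Daniell--Stone theorem applicable.\<close>

theorem Phi_compact:
  fixes u :: "nat \<Rightarrow> 'b::{metric_space, second_countable_topology} \<Rightarrow> real"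
  assumes u: "coercive u" and r: "r > 0" and ps: "\<And>n. ps n \<in> Pr r"
    and cutb: "\<And>j n. j \<le> n \<Longrightarrow> (\<integral>y. cut (N j) (u j) y \<partial>(ps n)) \<le> (1/2) ^ Suc j"
    and tailb: "\<And>j n. j \<le> n \<Longrightarrow> (\<integral>y. tail r y0 (N j) y \<partial>(ps n)) \<le> (1/2) ^ Suc j"
  obtains s p where "strict_mono s" "p \<in> Pr r" "Phi_conv r (\<lambda>n. ps (s n)) p"
proof -
  obtain G :: "nat \<Rightarrow> 'b \<Rightarrow> real" where G: "lower_family G" by (rule lower_family_exists)
  define d where "d y = dist y y0 powr r" for y
  have d0: "0 \<le> d y" for y by (simp add: d_def)
  have dP: "d \<in> Phi r" unfolding d_def by (rule Phi_dist[OF r])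
  have ipn: "integrable (ps n) f" if "f \<in> Phi r" for n f by (rule Phi_integrable[OF ps that r])
  have mono_n: "(\<integral>y. f y \<partial>(ps n)) \<le> (\<integral>y. g y \<partial>(ps n))" if "f \<in> Phi r" "g \<in> Phi r" "\<And>y. f y \<le> g y" for f g n
    by (rule integral_mono[OF ipn[OF that(1)] ipn[OF that(2)] that(3)])
  have const_n[simp]: "measure (ps n) (space (ps n)) = 1" for n
    by (rule prob_space.prob_space[OF Pr_prob[OF ps]])
  have db: "(\<integral>y. d y \<partial>(ps n)) \<le> \<bar>N 0\<bar> + 1" for n
  proof -
    have "(\<integral>y. d y \<partial>(ps n)) \<le> (\<integral>y. \<bar>N 0\<bar> + tail r y0 (N 0) y \<partial>(ps n))"
      by (rule mono_n[OF dP Phi_add[OF Phi_const tail_Phi[OF r] r]]) (simp add: tail_def d_def)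
    also have "\<dots> = \<bar>N 0\<bar> + (\<integral>y. tail r y0 (N 0) y \<partial>(ps n))"
      using ipn[OF tail_Phi[OF r]] ipn[OF Phi_const] by (simp add: const_n)
    finally show ?thesis using tailb[of 0 n] by simp
  qed
  have bdd: "\<exists>C. \<forall>n. \<bar>\<integral>y. f y \<partial>(ps n)\<bar> \<le> C" if f: "f \<in> Phi r" for f
  proof -
    obtain c where c: "c \<ge> 0" "\<And>y. \<bar>f y\<bar> \<le> c * (1 + dist y y0 powr r)" using Phi_bound[OF f r] by metis
    have g: "(\<lambda>y. c * (1 + d y)) \<in> Phi r" by (intro Phi_scale Phi_add Phi_const dP r)
    have gi: "(\<integral>y. c * (1 + d y) \<partial>(ps n)) \<le> c * (1 + (\<bar>N 0\<bar> + 1))" for n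
    proof -
      have "(\<integral>y. c * (1 + d y) \<partial>(ps n)) = c * (1 + (\<integral>y. d y \<partial>(ps n)))"
        using ipn[OF dP] ipn[OF Phi_const] by (simp add: const_n)
      also have "\<dots> \<le> c * (1 + (\<bar>N 0\<bar> + 1))" using db c(1) by (intro mult_left_mono add_left_mono) auto
      finally show ?thesis .
    qed
    have "\<bar>\<integral>y. f y \<partial>(ps n)\<bar> \<le> c * (1 + (\<bar>N 0\<bar> + 1))" for n
    proof -
      have 1: "(\<integral>y. f y \<partial>(ps n)) \<le> (\<integral>y. c * (1 + d y) \<partial>(ps n))"
        by (rule mono_n[OF f g]) (use c(2) in \<open>simp add: abs_le_iff d_def\<close>)
      have 2: "(\<integral>y. - f y \<partial>(ps n)) \<le> (\<integral>y. c * (1 + d y) \<partial>(ps n))"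
        by (rule mono_n[OF Phi_minus[OF f r] g]) (use c(2) in \<open>simp add: abs_le_iff d_def\<close>)
      then have "- (\<integral>y. f y \<partial>(ps n)) \<le> (\<integral>y. c * (1 + d y) \<partial>(ps n))" by simp
      with 1 gi[of n] show ?thesis by linarith
    qed
    then show ?thesis by blast
  qed
  \<comment> \<open>Index 0 carries the moment and the later indices the family \<open>G\<close>:
    exactly the test functions that \<open>Phi_convI\<close> asks for.\<close>
  define T where "T j = (case j of 0 \<Rightarrow> d | Suc i \<Rightarrow> G i)" for j
  have TP: "T j \<in> Phi r" for j by (cases j) (auto simp: T_def dP lower_family_Phi[OF G])
  obtain b where b: "\<And>j n. \<bar>\<integral>y. T j y \<partial>(ps n)\<bar> \<le> b j" using bdd[OF TP] by metis
  obtain s where s: "strict_mono s" and conv: "\<And>j. convergent (\<lambda>n. \<integral>y. T j y \<partial>(ps (s n)))"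
    using diagonal_convergent[of "\<lambda>n j. \<integral>y. T j y \<partial>(ps n)" b] b by metis
  define q where "q n = ps (s n)" for n
  have iq: "integrable (q n) f" if "f \<in> Phi r" for n f unfolding q_def by (rule ipn[OF that])
  \<comment> \<open>\<open>Inf (S f)\<close> is the limes superior of the integrals against
    \<open>q n\<close>; written as an infimum of eventual upper bounds, it is subadditive because
    such bounds add.\<close>
  define S where "S f = {c. \<forall>\<^sub>F n in sequentially. (\<integral>y. f y \<partial>(q n)) \<le> c}" for f :: "'b \<Rightarrow> real"
  define U where "U f = Inf (S f)" for f
  have Sne: "S f \<noteq> {}" and Sbd: "bdd_below (S f)" if f: "f \<in> Phi r" for f
  proof -
    obtain C where C: "\<And>n. \<bar>\<integral>y. f y \<partial>(ps n)\<bar> \<le> C" using bdd[OF f] by auto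
    then have "C \<in> S f" unfolding S_def q_def by (auto simp: abs_le_iff intro!: always_eventually)
    then show "S f \<noteq> {}" by blast
    have "- C \<le> c" if c: "c \<in> S f" for c
    proof -
      obtain n where "(\<integral>y. f y \<partial>(q n)) \<le> c" using eventually_happens'[OF sequentially_bot c[unfolded S_def mem_Collect_eq]] by blast
      with C[of "s n"] show ?thesis by (auto simp: q_def)
    qed
    then show "bdd_below (S f)" by (rule bdd_belowI)
  qed
  have Ule: "U f \<le> c" if "f \<in> Phi r" "c \<in> S f" for f c unfolding U_def by (rule cInf_lower[OF that(2) Sbd[OF that(1)]])
  have Uap: "\<exists>c\<in>S f. c < U f + e" if "f \<in> Phi r" "e > 0" for f e
    using cInf_less_iff[OF Sne[OF that(1)] Sbd[OF that(1)], of "U f + e"] that(2) unfolding U_def by simp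
  obtain l where lU: "\<And>f. f \<in> Phi r \<Longrightarrow> l f \<le> U f"
    and l_add: "\<And>f g. f \<in> Phi r \<Longrightarrow> g \<in> Phi r \<Longrightarrow> l (\<lambda>x. f x + g x) = l f + l g"
    and l_scale: "\<And>c f. f \<in> Phi r \<Longrightarrow> l (\<lambda>x. c * f x) = c * l f"
  proof (rule dominated_extension[of "Phi r" U])
    fix f g :: "'b \<Rightarrow> real" assume fg: "f \<in> Phi r" "g \<in> Phi r"
    show "U (\<lambda>x. f x + g x) \<le> U f + U g"
    proof (rule field_le_epsilon)
      fix e :: real assume "e > 0"
      then obtain c1 c2 where c: "c1 \<in> S f" "c1 < U f + e/2" "c2 \<in> S g" "c2 < U g + e/2"
        using Uap[OF fg(1), of "e/2"] Uap[OF fg(2), of "e/2"] by auto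
      have "\<forall>\<^sub>F n in sequentially. (\<integral>y. f y + g y \<partial>(q n)) \<le> c1 + c2"
        using c(1,3) unfolding S_def mem_Collect_eq
        by eventually_elim (simp add: iq[OF fg(1)] iq[OF fg(2)])
      then have "U (\<lambda>x. f x + g x) \<le> c1 + c2" by (intro Ule Phi_add fg r) (simp add: S_def)
      then show "U (\<lambda>x. f x + g x) \<le> U f + U g + e" using c by simp
    qed
  next
    fix f :: "'b \<Rightarrow> real" and a :: real assume f: "f \<in> Phi r" and a: "a > 0"
    show "U (\<lambda>x. a * f x) \<le> a * U f"
    proof (rule field_le_epsilon)
      fix e :: real assume "e > 0"
      then obtain c where c: "c \<in> S f" "c < U f + e/a" using Uap[OF f, of "e/a"] a by auto
      have "\<forall>\<^sub>F n in sequentially. (\<integral>y. a * f y \<partial>(q n)) \<le> a * c"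
        using c(1) unfolding S_def mem_Collect_eq by eventually_elim (use a in simp)
      then have "U (\<lambda>x. a * f x) \<le> a * c" by (intro Ule Phi_scale f r) (simp add: S_def)
      also have "\<dots> \<le> a * (U f + e/a)" using c a by (intro mult_left_mono) auto
      also have "\<dots> = a * U f + e" using a by (simp add: field_simps)
      finally show "U (\<lambda>x. a * f x) \<le> a * U f + e" .
    qed
  qed (auto intro: Phi_const Phi_add[OF _ _ r] Phi_scale[OF _ r])
  have l_le: "l f \<le> c" if "f \<in> Phi r" "\<forall>\<^sub>F n in sequentially. (\<integral>y. f y \<partial>(q n)) \<le> c" for f c
    using lU[OF that(1)] Ule[OF that(1), of c] that(2) by (simp add: S_def)
  have l_minus: "l (\<lambda>x. - f x) = - l f" if "f \<in> Phi r" for f using l_scale[OF that, of "-1"] by simp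
  have l_ge: "c \<le> l f" if f: "f \<in> Phi r" and ev: "\<forall>\<^sub>F n in sequentially. c \<le> (\<integral>y. f y \<partial>(q n))" for f c
  proof -
    have "\<forall>\<^sub>F n in sequentially. (\<integral>y. - f y \<partial>(q n)) \<le> - c" using ev by eventually_elim simp
    from l_le[OF Phi_minus[OF f r] this] show ?thesis using l_minus[OF f] by simp
  qed
  have l_lim: "l f = a" if f: "f \<in> Phi r" and lim: "(\<lambda>n. \<integral>y. f y \<partial>(q n)) \<longlonglongrightarrow> a" for f a
  proof (rule antisym)
    show "l f \<le> a"
    proof (rule field_le_epsilon)
      fix e :: real assume "e > 0"
      then have "\<forall>\<^sub>F n in sequentially. (\<integral>y. f y \<partial>(q n)) < a + e" using order_tendstoD(2)[OF lim] by simp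
      then show "l f \<le> a + e" by (intro l_le[OF f]) (auto elim: eventually_mono)
    qed
    show "a \<le> l f"
    proof (rule field_le_epsilon)
      fix e :: real assume "e > 0"
      then have "\<forall>\<^sub>F n in sequentially. a - e < (\<integral>y. f y \<partial>(q n))" using order_tendstoD(1)[OF lim] by simp
      then have "a - e \<le> l f" by (intro l_ge[OF f]) (auto elim: eventually_mono)
      then show "a \<le> l f + e" by simp
    qed
  qed
  have l_mono: "l f \<le> l g" if "f \<in> Phi r" "g \<in> Phi r" "\<And>x. f x \<le> g x" for f g
  proof -
    have gf: "(\<lambda>x. g x + - f x) \<in> Phi r" by (rule Phi_add[OF that(2) Phi_minus[OF that(1) r] r])
    have "0 \<le> l (\<lambda>x. g x + - f x)"
      using that(3) by (intro l_ge[OF gf] always_eventually allI integral_nonneg) simp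
    then show ?thesis using l_add[OF that(2) Phi_minus[OF that(1) r]] l_minus[OF that(1)] by simp
  qed
  have l_const: "l (\<lambda>_. c) = c" for c
    by (rule l_lim[OF Phi_const]) (simp add: q_def)
  have lT: "(\<lambda>n. \<integral>y. T j y \<partial>(q n)) \<longlonglongrightarrow> l (T j)" for j
    using conv[of j] l_lim[OF TP] unfolding convergent_def q_def by fastforce
  have sn: "n \<le> s n" for n using seq_suble[OF s] .
  have small: "\<exists>M. l (cut M (u i)) \<le> e" if "e > 0" for i e
  proof -
    have "(\<lambda>j. (1/2::real) ^ Suc j) \<longlonglongrightarrow> 0" by (intro LIMSEQ_Suc LIMSEQ_realpow_zero) auto
    then have "\<forall>\<^sub>F j in sequentially. (1/2::real) ^ Suc j < e" using that by (rule order_tendstoD(2))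
    then obtain j where j: "i \<le> j" "(1/2::real) ^ Suc j < e"
      unfolding eventually_sequentially by (meson nat_le_linear order_refl)
    have "(\<integral>y. cut (N j) (u i) y \<partial>(q n)) \<le> e" if "j \<le> n" for n
    proof -
      have "(\<integral>y. cut (N j) (u i) y \<partial>(q n)) \<le> (\<integral>y. cut (N j) (u j) y \<partial>(q n))"
        unfolding q_def
        by (rule mono_n[OF cut_Phi cut_Phi cut_mono]) (intro coercive_cont[OF u] coercive_mono[OF u j(1)])+
      also have "\<dots> \<le> (1/2) ^ Suc j" unfolding q_def using that sn[of n] by (intro cutb) simp
      finally show ?thesis using j(2) by simp
    qed
    then have "l (cut (N j) (u i)) \<le> e"
      by (intro l_le[OF cut_Phi[OF coercive_cont[OF u]]]) (auto simp: eventually_sequentially)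
    then show ?thesis by blast
  qed
  define H where "H = {f :: 'b \<Rightarrow> real. continuous_on UNIV f \<and> (\<exists>c. \<forall>x. \<bar>f x\<bar> \<le> c)}"
  have HP: "f \<in> Phi r" if "f \<in> H" for f using that Phi_bounded by (auto simp: H_def)
  have HI: "f \<in> H" if "continuous_on UNIV f" "\<And>x. \<bar>f x\<bar> \<le> c" for f c using that by (auto simp: H_def)
  have dan: "daniell UNIV H l"
  proof
    fix f g :: "'b \<Rightarrow> real" and a :: real assume f: "f \<in> H" and g: "g \<in> H"
    obtain c where c: "continuous_on UNIV f" "\<And>x. \<bar>f x\<bar> \<le> c" using f by (auto simp: H_def)
    obtain c' where c': "continuous_on UNIV g" "\<And>x. \<bar>g x\<bar> \<le> c'" using g by (auto simp: H_def)
    show "(\<lambda>x. f x + g x) \<in> H"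
      by (rule HI[of _ "c + c'"], intro continuous_intros c c') (use c(2) c'(2) abs_triangle_ineq add_mono order_trans in blast)
    show "(\<lambda>x. max (f x) (g x)) \<in> H"
    proof (rule HI[of _ "max c c'"], intro continuous_intros c c')
      show "\<bar>max (f x) (g x)\<bar> \<le> max c c'" for x using c(2)[of x] c'(2)[of x] by (simp add: max_def abs_le_iff)
    qed
    show "l (\<lambda>x. f x + g x) = l f + l g" by (rule l_add[OF HP[OF f] HP[OF g]])
  next
    fix f :: "'b \<Rightarrow> real" and a :: real assume f: "f \<in> H"
    obtain c where c: "continuous_on UNIV f" "\<And>x. \<bar>f x\<bar> \<le> c" using f by (auto simp: H_def)
    show "(\<lambda>x. a * f x) \<in> H"
      by (rule HI[of _ "\<bar>a\<bar> * c"], intro continuous_intros c) (use c(2) in \<open>simp add: abs_mult mult_left_mono\<close>)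
    show "l (\<lambda>x. a * f x) = a * l f" by (rule l_scale[OF HP[OF f]])
    show "\<exists>c. \<forall>x\<in>UNIV. \<bar>f x\<bar> \<le> c" using c by blast
    show "0 \<le> l f" if "\<And>x. x \<in> UNIV \<Longrightarrow> 0 \<le> f x"
      using l_mono[OF Phi_const[of 0] HP[OF f]] that l_const[of 0] by simp
  next
    show "(\<lambda>_. 1) \<in> H" by (rule HI[of _ 1]) auto
    show "l (\<lambda>_. 1) = 1" by (rule l_const)
  next
    fix f :: "nat \<Rightarrow> 'b \<Rightarrow> real"
    assume fH: "\<And>n. f n \<in> H" and dec: "\<And>n x. x \<in> UNIV \<Longrightarrow> f (Suc n) x \<le> f n x"
      and f0: "\<And>n x. x \<in> UNIV \<Longrightarrow> 0 \<le> f n x" and lim: "\<And>x. x \<in> UNIV \<Longrightarrow> (\<lambda>n. f n x) \<longlonglongrightarrow> 0"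
    obtain c where c: "\<And>x. \<bar>f 0 x\<bar> \<le> c" using fH[of 0] by (auto simp: H_def)
    have fc: "continuous_on UNIV (f m)" for m using fH[of m] by (simp add: H_def)
    show "(\<lambda>n. l (f n)) \<longlonglongrightarrow> 0"
    proof (rule vanishing_on_tight[where V="Phi r" and \<Omega>=UNIV and c=c and l=l and f=f])
      fix e :: real assume e: "e > 0"
      have "\<exists>M. \<forall>i. l (cut (M i) (u i)) \<le> e / 4 ^ Suc i"
        by (rule choice, rule allI, rule small) (use e in simp)
      then obtain M where M: "\<And>i. l (cut (M i) (u i)) \<le> e / 4 ^ Suc i" by blast
      define w where "w J y = (\<Sum>i\<le>J. 2 ^ Suc i * cut (M i) (u i) y)" for J y
      have wP: "w J \<in> Phi r" for J
        unfolding w_def by (intro Phi_sum Phi_scale cut_Phi coercive_cont[OF u] r) auto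
      have lw: "l (w J) = (\<Sum>i\<le>J. 2 ^ Suc i * l (cut (M i) (u i)))" for J
      proof (induction J)
        case 0 then show ?case unfolding w_def by (simp add: l_scale[OF cut_Phi[OF coercive_cont[OF u]], of 2, simplified])
      next
        case (Suc J)
        have "w (Suc J) = (\<lambda>y. w J y + 2 ^ Suc (Suc J) * cut (M (Suc J)) (u (Suc J)) y)" by (simp add: w_def fun_eq_iff)
        then have "l (w (Suc J)) = l (w J) + l (\<lambda>y. 2 ^ Suc (Suc J) * cut (M (Suc J)) (u (Suc J)) y)"
          using l_add[OF wP Phi_scale[OF cut_Phi[OF coercive_cont[OF u]] r]] by simp
        then show ?case using Suc l_scale[OF cut_Phi[OF coercive_cont[OF u]], of "2 ^ Suc (Suc J)"] by simp
      qed
      have lwe: "l (w J) \<le> e" for J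
      proof -
        have "l (w J) \<le> (\<Sum>i\<le>J. 2 ^ Suc i * (e / 4 ^ Suc i))"
          unfolding lw by (intro sum_mono mult_left_mono M) simp
        also have "\<dots> \<le> e" by (rule sum_weights_le) (use e in simp)
        finally show ?thesis .
      qed
      have sq: "\<exists>k x. strict_mono k \<and> x \<in> UNIV \<and> (\<forall>m. (\<lambda>n. f m (t (k n))) \<longlonglongrightarrow> f m x)"
        if t: "\<forall>n. t n \<in> UNIV \<and> w n (t n) \<le> 1" for t :: "nat \<Rightarrow> 'b"
      proof -
        have "u j (t n) \<le> M j + 1" if "j \<le> n" for j n
        proof -
          have "2 ^ Suc j * cut (M j) (u j) (t n) \<le> w n (t n)"
            unfolding w_def by (rule member_le_sum) (use that in \<open>auto intro!: mult_nonneg_nonneg cut_range\<close>)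
          also have "\<dots> \<le> 1" using t by blast
          finally have "2 ^ Suc j * cut (M j) (u j) (t n) \<le> 1" .
          moreover have "(2::real) \<le> 2 ^ Suc j" by simp
          then have "2 * cut (M j) (u j) (t n) \<le> 2 ^ Suc j * cut (M j) (u j) (t n)"
            by (rule mult_right_mono[OF _ cut_range(1)])
          ultimately have "cut (M j) (u j) (t n) < 1" by linarith
          then show ?thesis unfolding cut_def by (simp add: min_def max_def split: if_splits)
        qed
        then have "\<forall>j. \<forall>n\<ge>j. u j (t n) \<le> M j + 1" by blast
        then have "\<exists>k x. strict_mono (k :: nat \<Rightarrow> nat) \<and> (t \<circ> k) \<longlonglongrightarrow> x"
          using u[unfolded coercive_def] by (elim conjE) (drule spec[of _ t], drule spec[of _ "\<lambda>j. M j + 1"], blast)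
        then obtain k x where k: "strict_mono (k :: nat \<Rightarrow> nat)" "(t \<circ> k) \<longlonglongrightarrow> x" by blast
        have "(\<lambda>n. f m (t (k n))) \<longlonglongrightarrow> f m x" for m
          using continuous_on_tendsto_compose[OF fc k(2)] by (simp add: o_def)
        then show ?thesis using k(1) by blast
      qed
      have w0: "0 \<le> w J x" for J x unfolding w_def by (intro sum_nonneg mult_nonneg_nonneg cut_range) simp
      show "\<exists>w. (\<forall>J. w J \<in> Phi r \<and> l (w J) \<le> e \<and> (\<forall>x\<in>UNIV. 0 \<le> w J x)) \<and>
         (\<forall>s :: nat \<Rightarrow> 'b. (\<forall>n. s n \<in> UNIV \<and> w n (s n) \<le> 1) \<longrightarrow>
            (\<exists>k x. strict_mono k \<and> x \<in> UNIV \<and> (\<forall>m. (\<lambda>n. f m (s (k n))) \<longlonglongrightarrow> f m x)))"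
      proof (rule exI[of _ w], intro conjI allI impI)
        show "w J \<in> Phi r" "l (w J) \<le> e" "\<forall>x\<in>UNIV. 0 \<le> w J x" for J using wP lwe w0 by auto
      qed (rule sq)
    next
      show "f 0 x \<le> c" for x using c[of x] by (simp add: abs_le_iff)
    qed (use fH dec f0 lim HP l_mono l_const in \<open>auto intro: Phi_add[OF _ _ r] Phi_scale[OF _ r] Phi_const l_add l_scale\<close>)
  qed
  obtain m where m: "prob_space m" "space m = UNIV" "\<And>f. f \<in> H \<Longrightarrow> f \<in> borel_measurable m"
    "\<And>f. f \<in> H \<Longrightarrow> integral\<^sup>L m f = l f"
    using daniell_stone[OF dan] by metis
  \<comment> \<open>The sigma-algebra of \<open>m\<close> is known only to make \<open>H\<close>
    measurable. Every open set is the positivity set of a member of \<open>H\<close>, so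
    \<open>m\<close> can be transported to the Borel sets.\<close>
  have idm: "(\<lambda>x. x) \<in> measurable m borel"
  proof (rule borel_measurableI)
    fix S :: "'b set" assume "open S"
    then obtain h :: "'b \<Rightarrow> real" where h: "continuous_on UNIV h" "\<And>x. 0 \<le> h x" "\<And>x. h x \<le> 1" "S = {x. 0 < h x}"
      using open_eq_pos[of S] by metis
    have "h \<in> H" by (rule HI[OF h(1), of 1]) (use h in \<open>simp add: abs_of_nonneg\<close>)
    then have "h \<in> borel_measurable m" by (rule m(3))
    then have "{x \<in> space m. 0 < h x} \<in> sets m" by measurable
    then show "(\<lambda>x. x) -` S \<inter> space m \<in> sets m" by (simp add: h(4) m(2))
  qed
  define p where "p = distr m borel (\<lambda>x. x)"
  have pp: "prob_space p" unfolding p_def by (rule prob_space.prob_space_distr[OF m(1) idm])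
  have sp: "sets p = sets borel" by (simp add: p_def)
  have pl: "integral\<^sup>L p f = l f" if "f \<in> H" for f
    unfolding p_def using that m(4)[OF that]
    by (subst integral_distr[OF idm]) (auto simp: H_def intro: borel_measurable_continuous_onI)
  \<comment> \<open>\<open>p\<close> represents \<open>l\<close> on bounded functions only.
    Truncation reaches \<open>d\<close>: the deficit \<open>d - min d K\<close> is the tail
    function, whose value under \<open>l\<close> tends to 0 by the uniform bounds
    \<open>tailb\<close>.\<close>
  have dH: "(\<lambda>y. min (d y) (real K)) \<in> H" for K
    by (rule HI[of _ "real K"]) (use d0 in \<open>auto intro!: continuous_intros Phi_cont[OF dP] simp: abs_le_iff\<close>)
  have lmin: "l (\<lambda>y. min (d y) (real K)) = l d - l (tail r y0 (real K))" for K
  proof -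
    have "(\<lambda>y. min (d y) (real K) + tail r y0 (real K) y) = d" by (auto simp: tail_def d_def fun_eq_iff)
    then show ?thesis using l_add[OF HP[OF dH[of K]] tail_Phi[OF r, of y0 "real K"]] by simp
  qed
  have ltail: "(\<lambda>K. l (tail r y0 (real K))) \<longlonglongrightarrow> 0"
  proof (rule order_tendstoI)
    fix a :: real assume "a < 0"
    moreover have "0 \<le> l (tail r y0 (real K))" for K
      using l_mono[OF Phi_const[of 0] tail_Phi[OF r] tail_nonneg] l_const[of 0] by simp
    ultimately show "\<forall>\<^sub>F K in sequentially. a < l (tail r y0 (real K))"
      by (intro always_eventually allI) (rule less_le_trans)
  next
    fix a :: real assume a: "0 < a"
    have "(\<lambda>j. (1/2::real) ^ Suc j) \<longlonglongrightarrow> 0" by (intro LIMSEQ_Suc LIMSEQ_realpow_zero) auto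
    then have "\<forall>\<^sub>F j in sequentially. (1/2::real) ^ Suc j < a" using a by (rule order_tendstoD(2))
    then obtain j where j: "(1/2::real) ^ Suc j < a" unfolding eventually_sequentially by blast
    obtain K0 :: nat where K0: "N j \<le> real K0" using real_arch_simple by blast
    have "l (tail r y0 (real K)) < a" if "K \<ge> K0" for K
    proof -
      have "(\<integral>y. tail r y0 (real K) y \<partial>(q n)) \<le> (1/2) ^ Suc j" if "j \<le> n" for n
      proof -
        have "(\<integral>y. tail r y0 (real K) y \<partial>(q n)) \<le> (\<integral>y. tail r y0 (N j) y \<partial>(q n))"
          unfolding q_def by (rule mono_n[OF tail_Phi[OF r] tail_Phi[OF r]]) (use K0 \<open>K \<ge> K0\<close> in \<open>simp add: tail_def\<close>)
        also have "\<dots> \<le> (1/2) ^ Suc j" unfolding q_def using that sn[of n] by (intro tailb) simp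
        finally show ?thesis .
      qed
      then have "l (tail r y0 (real K)) \<le> (1/2) ^ Suc j"
        by (intro l_le[OF tail_Phi[OF r]]) (auto simp: eventually_sequentially)
      then show ?thesis using j by simp
    qed
    then show "\<forall>\<^sub>F K in sequentially. l (tail r y0 (real K)) < a" unfolding eventually_sequentially by blast
  qed
  have limd: "(\<lambda>K. \<integral>y. min (d y) (real K) \<partial>p) \<longlonglongrightarrow> l d"
    using tendsto_diff[OF tendsto_const[of "l d"] ltail] by (simp add: pl[OF dH] lmin)
  have iH: "integrable p f" if f: "f \<in> H" for f
  proof -
    interpret prob_space p by (rule pp)
    obtain c where "\<And>x. \<bar>f x\<bar> \<le> c" using f unfolding H_def by blast
    then show ?thesis by (intro integrable_const_bound[of _ c] Phi_measurable[OF HP[OF f] sp]) auto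
  qed
  have tod: "(\<lambda>K. min (d y) (real K)) \<longlonglongrightarrow> d y" for y
  proof -
    obtain K0 :: nat where "d y \<le> real K0" using real_arch_simple by blast
    then have "\<forall>\<^sub>F K in sequentially. min (d y) (real K) = d y"
      unfolding eventually_sequentially by (intro exI[of _ K0]) auto
    then show ?thesis by (rule tendsto_eventually)
  qed
  have incm: "AE y in p. mono (\<lambda>K. min (d y) (real K))" by (intro AE_I2) (auto intro!: monoI min.mono)
  have id: "integrable p d" and intd: "integral\<^sup>L p d = l d"
    using integrable_monotone_convergence[OF iH[OF dH] incm _ limd, of d]
      integral_monotone_convergence[OF iH[OF dH] incm _ limd, of d] tod Phi_measurable[OF dP sp] by auto
  have pPr: "p \<in> Pr r" using Pr_I[OF pp sp id[unfolded d_def]] .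
  have "Phi_conv r q p"
  proof (rule Phi_convI[OF G r _ pPr])
    show "q n \<in> Pr r" for n by (simp add: q_def ps)
    have GH: "G j \<in> H" for j
    proof -
      obtain c where "\<And>y. G j y \<le> c" using G unfolding lower_family_def by blast
      then show ?thesis using G unfolding lower_family_def by (intro HI[of _ c]) (simp_all add: abs_of_nonneg)
    qed
    show "(\<lambda>n. integral\<^sup>L (q n) (G j)) \<longlonglongrightarrow> integral\<^sup>L p (G j)" for j
      using lT[of "Suc j"] by (simp add: T_def pl[OF GH])
    show "(\<lambda>n. \<integral>y. dist y y0 powr r \<partial>q n) \<longlonglongrightarrow> (\<integral>y. dist y y0 powr r \<partial>p)"
      using lT[of 0] by (simp add: T_def intd[symmetric]) (simp add: d_def[abs_def])
  qed
  then show thesis using that[OF s pPr] unfolding q_def by blast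
qed

section \<open>Measurability on the space of pairs\<close>

lemma Cb_I: "continuous_on UNIV f \<Longrightarrow> (\<And>x. \<bar>f x\<bar> \<le> c) \<Longrightarrow> f \<in> Cb"
  unfolding Cb_def by (auto simp: bounded_iff)

lemma Cb_D:
  assumes "f \<in> Cb" obtains c where "continuous_on UNIV f" "\<And>x. \<bar>f x\<bar> \<le> c"
  using assms unfolding Cb_def by (auto simp: bounded_iff)

lemma Cb_Phi: "f \<in> Cb \<Longrightarrow> f \<in> Phi r"
  by (erule Cb_D) (rule Phi_bounded)

lemma open_approx:
  fixes U :: "'b::metric_space set"
  assumes "open U"
  obtains f :: "nat \<Rightarrow> 'b \<Rightarrow> real" where "\<And>k. f k \<in> Cb" "\<And>k x. 0 \<le> f k x" "\<And>k x. f k x \<le> 1"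
    "\<And>x. (\<lambda>k. f k x) \<longlonglongrightarrow> indicator U x"
proof -
  obtain h :: "'b \<Rightarrow> real" where h: "continuous_on UNIV h" "\<And>x. 0 \<le> h x" "U = {x. 0 < h x}"
    using open_eq_pos[OF assms] by metis
  define f where "f k x = min 1 (real k * h x)" for k x
  have f: "0 \<le> f k x" "f k x \<le> 1" for k x using h(2) by (auto simp: f_def)
  have "f k \<in> Cb" for k
    by (rule Cb_I[of _ 1]) (use f h(1) in \<open>auto simp: f_def[abs_def] intro!: continuous_intros\<close>)
  moreover have "(\<lambda>k. f k x) \<longlonglongrightarrow> indicator U x" for x
  proof (cases "x \<in> U")
    case True
    then have hx: "0 < h x" using h(3) by simp
    obtain K :: nat where K: "1 / h x < real K" using reals_Archimedean2 by blast
    have "f k x = 1" if "k \<ge> K" for k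
    proof -
      have "1 / h x \<le> real k" using K that by simp
      then show ?thesis using hx by (simp add: f_def field_simps)
    qed
    then have "\<forall>\<^sub>F k in sequentially. f k x = indicator U x"
      unfolding eventually_sequentially using True by auto
    then show ?thesis by (rule tendsto_eventually)
  next
    case False
    then have "h x = 0" using h(2)[of x] h(3) by auto
    then show ?thesis using False by (simp add: f_def)
  qed
  ultimately show thesis using f that by blast
qed

lemma integral_open_approx:
  assumes p: "prob_space p" "sets p = sets borel" and U: "open (U :: 'b::metric_space set)"
    and f: "\<And>k. f k \<in> Cb" "\<And>k x. 0 \<le> f k x" "\<And>k x. f k x \<le> 1" "\<And>x. (\<lambda>k. f k x) \<longlonglongrightarrow> indicator U x"
  shows "(\<lambda>k. \<integral>x. f k x \<partial>p) \<longlonglongrightarrow> measure p U"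
proof -
  interpret prob_space p by fact
  have U': "U \<in> sets p" using U p by simp
  have "(\<lambda>k. \<integral>x. f k x \<partial>p) \<longlonglongrightarrow> (\<integral>x. indicator U x \<partial>p)"
  proof (rule integral_dominated_convergence[where w="\<lambda>_. 1"])
    show "f k \<in> borel_measurable p" for k by (rule Phi_measurable[OF Cb_Phi[OF f(1)] p(2)])
  qed (use U' f in auto)
  then show ?thesis using U' sets.sets_into_space[OF U'] by (simp add: Int_absorb2)
qed

lemma prob_eqI_Cb:
  fixes p q :: "'b::metric_space measure"
  assumes p: "prob_space p" "sets p = sets borel" and q: "prob_space q" "sets q = sets borel"
    and eq: "\<And>f. f \<in> Cb \<Longrightarrow> (\<integral>x. f x \<partial>p) = (\<integral>x. f x \<partial>q)"
  shows "p = q"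
proof (rule measure_eqI_generator_eq[where E="{U. open U}" and \<Omega>=UNIV and A="\<lambda>_. UNIV"])
  interpret P: prob_space p by fact
  interpret Q: prob_space q by fact
  show "emeasure p U = emeasure q U" if "U \<in> {U. open U}" for U
  proof -
    have U: "open U" using that by simp
    then obtain f :: "nat \<Rightarrow> 'b \<Rightarrow> real" where f: "\<And>k. f k \<in> Cb" "\<And>k x. 0 \<le> f k x" "\<And>k x. f k x \<le> 1"
      "\<And>x. (\<lambda>k. f k x) \<longlonglongrightarrow> indicator U x" by (rule open_approx) blast
    have "measure p U = measure q U"
      using integral_open_approx[OF p U f] integral_open_approx[OF q U f] eq[OF f(1)] LIMSEQ_unique by simp
    then show ?thesis by (simp add: P.emeasure_eq_measure Q.emeasure_eq_measure)
  qed
  show "emeasure p UNIV \<noteq> \<infinity>" for i :: nat by simp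
qed (auto simp: Int_stable_def p q borel_def)

lemma completion_measurable_null:
  assumes g: "g \<in> borel_measurable M" and N: "N \<in> null_sets M" and eq: "\<And>x. x \<in> space M - N \<Longrightarrow> f x = g x"
  shows "f \<in> measurable (completion M) borel"
proof (rule measurableI)
  fix A :: "'b set" assume A: "A \<in> sets borel"
  have eq': "f -` A \<inter> space (completion M) = (g -` A \<inter> space M - N) \<union> (f -` A \<inter> space M \<inter> N)"
    using eq by auto
  have "g -` A \<inter> space M - N \<in> sets M" using measurable_sets[OF g A] N by auto
  then have "g -` A \<inter> space M - N \<in> sets (completion M)" by (rule sets_completionI_sets)
  moreover have "f -` A \<inter> space M \<inter> N \<in> sets (completion M)" by (rule null_sets_completion[OF N]) auto
  ultimately show "f -` A \<inter> space (completion M) \<in> sets (completion M)" unfolding eq' by (rule sets.Un)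
qed simp

lemma tendsto_fun_iff:
  fixes f :: "'c \<Rightarrow> 'i \<Rightarrow> 'd::topological_space"
  shows "(f \<longlongrightarrow> l) F \<longleftrightarrow> (\<forall>i. ((\<lambda>n. f n i) \<longlongrightarrow> l i) F)"
  using limitin_componentwise[of "\<lambda>_. euclidean :: 'd topology" UNIV f l F]
  by (simp add: euclidean_product_topology)

text \<open>On \<open>UNIV \<times> Pr r\<close> this is an embedding into a second countable metric space for which convergence of
  images is \<open>Phi_conv\<close>.\<close>

definition stats :: "real \<Rightarrow> 'b::metric_space \<Rightarrow> (nat \<Rightarrow> 'b \<Rightarrow> real) \<Rightarrow> 'a \<times> 'b measure \<Rightarrow> 'a \<times> (nat \<Rightarrow> real)" where
  "stats r y0 G z = (fst z, \<lambda>j. case j of 0 \<Rightarrow> (\<integral>y. dist y y0 powr r \<partial>(snd z)) | Suc i \<Rightarrow> (\<integral>y. G i y \<partial>(snd z)))"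

abbreviation kern :: "('a::topological_space \<times> 'b::topological_space measure) measure" where
  "kern \<equiv> borel \<Otimes>\<^sub>M prob_algebra borel"

lemma space_kern: "z \<in> space kern \<longleftrightarrow> prob_space (snd z) \<and> sets (snd z) = sets borel"
  by (cases z) (simp add: space_pair_measure space_prob_algebra conj_commute)

lemma snd_subprob[measurable]: "snd \<in> measurable kern (subprob_algebra borel)"
  by (rule measurable_prob_algebraD) measurable

lemma integral_kern_measurable:
  fixes f :: "'b::topological_space \<Rightarrow> real"
  assumes "f \<in> borel_measurable borel"
  shows "(\<lambda>z. \<integral>y. f y \<partial>(snd z)) \<in> borel_measurable kern"
  using measurable_compose[OF snd_subprob integral_measurable_subprob_algebra[OF assms]] .

lemma stats_measurable:
  fixes y0 :: "'b::metric_space"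
  assumes G: "lower_family G" and r: "r > 0"
  shows "stats r y0 G \<in> measurable (kern :: ('a::{metric_space,second_countable_topology} \<times> 'b measure) measure) borel"
proof -
  have "(\<lambda>z. \<integral>y. dist y y0 powr r \<partial>(snd z)) \<in> borel_measurable (kern :: ('a \<times> 'b measure) measure)"
    by (rule integral_kern_measurable[OF borel_measurable_continuous_onI[OF continuous_dist_powr[OF r]]])
  moreover have "(\<lambda>z. \<integral>y. G i y \<partial>(snd z)) \<in> borel_measurable (kern :: ('a \<times> 'b measure) measure)" for i
    by (rule integral_kern_measurable[OF borel_measurable_continuous_onI[OF Phi_cont[OF lower_family_Phi[OF G]]]])
  ultimately have coord: "(\<lambda>z. case j of 0 \<Rightarrow> (\<integral>y. dist y y0 powr r \<partial>(snd z)) | Suc i \<Rightarrow> (\<integral>y. G i y \<partial>(snd z)))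
      \<in> borel_measurable (kern :: ('a \<times> 'b measure) measure)" for j
    by (cases j) auto
  show ?thesis unfolding stats_def
    by (intro borel_measurable_Pair measurable_coordinatewise_then_product coord) measurable
qed

lemma stats_conv:
  fixes y0 :: "'b::metric_space"
  assumes G: "lower_family G" and r: "r > 0" and ps: "\<And>n. ps n \<in> Pr r" and p: "p \<in> Pr r"
    and lim: "(\<lambda>n. stats r y0 G (xs n, ps n)) \<longlonglongrightarrow> stats r y0 G (x, p)"
  shows "xs \<longlonglongrightarrow> x" "Phi_conv r ps p"
proof -
  show "xs \<longlonglongrightarrow> x" using tendsto_fst[OF lim] by (simp add: stats_def)
  define t where "t q j = (case j of 0 \<Rightarrow> (\<integral>y. dist y y0 powr r \<partial>q) | Suc i \<Rightarrow> (\<integral>y. G i y \<partial>q))" for q and j :: nat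
  have "(\<lambda>n. t (ps n)) \<longlonglongrightarrow> t p" using tendsto_snd[OF lim] unfolding stats_def t_def[abs_def] snd_conv .
  then have t: "(\<lambda>n. t (ps n) j) \<longlonglongrightarrow> t p j" for j by (simp add: tendsto_fun_iff)
  show "Phi_conv r ps p"
    by (rule Phi_convI[OF G r ps p, where ?y0.0 = y0]) (use t[of "Suc _"] t[of 0] in \<open>simp_all add: t_def\<close>)
qed

lemma conv_stats:
  fixes y0 :: "'b::metric_space"
  assumes G: "lower_family G" and r: "r > 0" and x: "xs \<longlonglongrightarrow> x" and c: "Phi_conv r ps p"
  shows "(\<lambda>n. stats r y0 G (xs n, ps n)) \<longlonglongrightarrow> stats r y0 G (x, p)"
proof -
  have 0: "(\<lambda>n. \<integral>y. dist y y0 powr r \<partial>(ps n)) \<longlonglongrightarrow> (\<integral>y. dist y y0 powr r \<partial>p)"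
    using c Phi_dist[OF r] unfolding Phi_conv_def by (rule bspec)
  have S: "(\<lambda>n. \<integral>y. G i y \<partial>(ps n)) \<longlonglongrightarrow> (\<integral>y. G i y \<partial>p)" for i
    using c lower_family_Phi[OF G] unfolding Phi_conv_def by (rule bspec)
  have "(\<lambda>n. (\<lambda>j. case j of 0 \<Rightarrow> (\<integral>y. dist y y0 powr r \<partial>(ps n)) | Suc i \<Rightarrow> (\<integral>y. G i y \<partial>(ps n)))) \<longlonglongrightarrow>
      (\<lambda>j. case j of 0 \<Rightarrow> (\<integral>y. dist y y0 powr r \<partial>p) | Suc i \<Rightarrow> (\<integral>y. G i y \<partial>p))"
    unfolding tendsto_fun_iff using 0 S by (auto split: nat.split)
  then show ?thesis unfolding stats_def fst_conv snd_conv by (intro tendsto_Pair x)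
qed

text \<open>Closedness relative to \<open>UNIV \<times> Pr r\<close>. Sequences capture it because
  \<open>stats\<close> identifies this convergence with convergence in a metric space.\<close>

definition seq_closed :: "real \<Rightarrow> ('a::metric_space \<times> 'b::metric_space measure) set \<Rightarrow> bool" where
  "seq_closed r F \<longleftrightarrow> F \<subseteq> UNIV \<times> Pr r \<and>
     (\<forall>xs ps x p. (\<forall>n. (xs n, ps n) \<in> F) \<and> xs \<longlonglongrightarrow> x \<and> p \<in> Pr r \<and> Phi_conv r ps p \<longrightarrow> (x, p) \<in> F)"

lemma Pr_kern:
  fixes y0 :: "'b::metric_space"
  assumes r: "r > 0"
  shows "UNIV \<times> Pr r = {z \<in> space (kern :: ('a::metric_space \<times> 'b measure) measure). (\<integral>\<^sup>+ y. ennreal (dist y y0 powr r) \<partial>(snd z)) < \<infinity>}"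
proof (intro set_eqI iffI)
  fix z :: "'a \<times> 'b measure" assume z: "z \<in> UNIV \<times> Pr r"
  then have s: "snd z \<in> Pr r" by auto
  have "(\<integral>\<^sup>+ y. ennreal (dist y y0 powr r) \<partial>(snd z)) = ennreal (\<integral>y. dist y y0 powr r \<partial>(snd z))"
    by (rule nn_integral_eq_integral[OF Phi_integrable[OF s Phi_dist[OF r] r]]) simp
  then show "z \<in> {z \<in> space kern. (\<integral>\<^sup>+ y. ennreal (dist y y0 powr r) \<partial>(snd z)) < \<infinity>}"
    using s Pr_prob[OF s] Pr_sets[OF s] by (simp add: space_kern)
next
  fix z :: "'a \<times> 'b measure" assume "z \<in> {z \<in> space kern. (\<integral>\<^sup>+ y. ennreal (dist y y0 powr r) \<partial>(snd z)) < \<infinity>}"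
  then have "snd z \<in> Pr r" unfolding Pr_def by (auto simp: space_kern)
  then show "z \<in> UNIV \<times> Pr r" by (cases z) simp
qed

lemma Pr_kern_sets:
  assumes r: "r > 0"
  shows "UNIV \<times> Pr r \<in> sets (kern :: ('a::metric_space \<times> 'b::metric_space measure) measure)"
proof -
  have [measurable]: "(\<lambda>y::'b. dist y undefined powr r) \<in> borel_measurable borel"
    by (rule borel_measurable_continuous_onI[OF continuous_dist_powr[OF r]])
  have "(\<lambda>z. \<integral>\<^sup>+ y. ennreal (dist y undefined powr r) \<partial>(snd z)) \<in> borel_measurable (kern :: ('a \<times> 'b measure) measure)"
    by (rule measurable_compose[OF snd_subprob nn_integral_measurable_subprob_algebra]) measurable
  then show ?thesis unfolding Pr_kern[OF r, of undefined] by measurable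
qed

text \<open>Within \<open>UNIV \<times> Pr r\<close>, \<open>F\<close> is the preimage under
  \<open>stats\<close> of the closure of its image, since convergence of the images implies
  convergence of the pairs.\<close>

lemma seq_closed_sets:
  fixes F :: "('a::{metric_space,second_countable_topology} \<times> 'b::{metric_space,second_countable_topology} measure) set"
  assumes F: "seq_closed r F" and r: "r > 0"
  shows "F \<in> sets kern"
proof -
  obtain G :: "nat \<Rightarrow> 'b \<Rightarrow> real" where G: "lower_family G" by (rule lower_family_exists)
  define \<tau> where "\<tau> = (stats r undefined G :: 'a \<times> 'b measure \<Rightarrow> _)"
  have \<tau>: "\<tau> \<in> measurable kern borel" unfolding \<tau>_def by (rule stats_measurable[OF G r])
  have "F = (\<tau> -` closure (\<tau> ` F) \<inter> space kern) \<inter> (UNIV \<times> Pr r)"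
  proof (intro set_eqI iffI)
    fix z assume z: "z \<in> F"
    then have "z \<in> UNIV \<times> Pr r" using F by (auto simp: seq_closed_def)
    moreover have "\<tau> z \<in> closure (\<tau> ` F)" by (rule subsetD[OF closure_subset]) (rule imageI[OF z])
    ultimately show "z \<in> (\<tau> -` closure (\<tau> ` F) \<inter> space kern) \<inter> (UNIV \<times> Pr r)"
      unfolding Pr_kern[OF r, of undefined] by auto
  next
    fix z assume z: "z \<in> (\<tau> -` closure (\<tau> ` F) \<inter> space kern) \<inter> (UNIV \<times> Pr r)"
    obtain x p where xp: "z = (x, p)" by (cases z)
    have p: "p \<in> Pr r" using z xp by auto
    have "\<tau> z \<in> closure (\<tau> ` F)" using z by simp
    then obtain t where t: "\<And>n. t n \<in> \<tau> ` F" "t \<longlonglongrightarrow> \<tau> z" unfolding closure_sequential by metis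
    have "\<forall>n. \<exists>w. w \<in> F \<and> t n = \<tau> w" using t(1) by blast
    then obtain w where w: "\<And>n. w n \<in> F" and tw: "t = (\<lambda>n. \<tau> (w n))" by metis
    define xs ps where "xs n = fst (w n)" and "ps n = snd (w n)" for n
    have ps: "ps n \<in> Pr r" for n using w[of n] F by (auto simp: seq_closed_def ps_def)
    have "(\<lambda>n. stats r undefined G (xs n, ps n)) \<longlonglongrightarrow> stats r undefined G (x, p)"
      using t(2) by (simp add: tw \<tau>_def xp xs_def ps_def)
    from stats_conv[OF G r ps p this] have "xs \<longlonglongrightarrow> x" "Phi_conv r ps p" .
    moreover have "(xs n, ps n) \<in> F" for n using w by (simp add: xs_def ps_def)
    ultimately show "z \<in> F" using F p unfolding seq_closed_def xp by blast
  qed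
  also have "\<dots> \<in> sets kern"
    using measurable_sets[OF \<tau>, of "closure (\<tau> ` F)"] Pr_kern_sets[OF r] by auto
  finally show ?thesis .
qed

lemma lsc_Wr_conv:
  fixes C :: "'a::metric_space \<Rightarrow> 'b::{metric_space,second_countable_topology} measure \<Rightarrow> ereal"
  assumes "lsc_Wr r C" "r > 0" "\<And>n. ps n \<in> Pr r" "p \<in> Pr r" "xs \<longlonglongrightarrow> x" "Phi_conv r ps p"
  shows "C x p \<le> liminf (\<lambda>n. C (xs n) (ps n))"
  using assms(1,3-5) wasserstein_tendsto_0[OF assms(3,4,2,6)] unfolding lsc_Wr_def by blast

text \<open>The sublevel sets are tilted by the integral of \<open>\<psi>\<close> because
  \<open>RC r C \<psi>\<close> compares \<open>C x p\<close> with this integral. The tilt is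
  continuous along \<open>Phi_conv\<close>.\<close>

lemma lsc_seq_closed:
  fixes C :: "'a::metric_space \<Rightarrow> 'b::{metric_space,second_countable_topology} measure \<Rightarrow> ereal"
  assumes "lsc_Wr r C" "r > 0" "\<psi> \<in> Phi r"
  shows "seq_closed r {(x, p). p \<in> Pr r \<and> C x p \<le> ereal (a + (\<integral>y. \<psi> y \<partial>p))}"
  unfolding seq_closed_def
proof (intro conjI allI impI)
  fix xs :: "nat \<Rightarrow> 'a" and ps :: "nat \<Rightarrow> 'b measure" and x p
  assume A: "(\<forall>n. (xs n, ps n) \<in> {(x, p). p \<in> Pr r \<and> C x p \<le> ereal (a + (\<integral>y. \<psi> y \<partial>p))}) \<and> xs \<longlonglongrightarrow> x \<and> p \<in> Pr r \<and> Phi_conv r ps p"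
  then have ps: "\<And>n. ps n \<in> Pr r" and le: "\<And>n. C (xs n) (ps n) \<le> ereal (a + (\<integral>y. \<psi> y \<partial>(ps n)))" by auto
  have "(\<lambda>n. ereal (a + (\<integral>y. \<psi> y \<partial>(ps n)))) \<longlonglongrightarrow> ereal (a + (\<integral>y. \<psi> y \<partial>p))"
    using A assms(3) unfolding Phi_conv_def by (intro tendsto_intros) blast
  then have "liminf (\<lambda>n. ereal (a + (\<integral>y. \<psi> y \<partial>(ps n)))) = ereal (a + (\<integral>y. \<psi> y \<partial>p))"
    by (rule lim_imp_Liminf[OF sequentially_bot])
  moreover have "liminf (\<lambda>n. C (xs n) (ps n)) \<le> liminf (\<lambda>n. ereal (a + (\<integral>y. \<psi> y \<partial>(ps n))))"
    using le by (intro Liminf_mono always_eventually) auto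
  moreover have "C x p \<le> liminf (\<lambda>n. C (xs n) (ps n))"
    using A ps by (intro lsc_Wr_conv[OF assms(1,2)]) auto
  ultimately show "(x, p) \<in> {(x, p). p \<in> Pr r \<and> C x p \<le> ereal (a + (\<integral>y. \<psi> y \<partial>p))}" using A by auto
qed auto

text \<open>Off \<open>Pr r\<close> the value of \<open>C\<close> is arbitrary; with infinity there,
  every sublevel set at a finite level lies in \<open>UNIV \<times> Pr r\<close> and is sequentially
  closed.\<close>

lemma lsc_measurable:
  fixes C :: "'a::{metric_space,second_countable_topology} \<Rightarrow> 'b::{metric_space,second_countable_topology} measure \<Rightarrow> ereal"
  assumes C: "lsc_Wr r C" and r: "r > 0"
  shows "(\<lambda>z. if z \<in> UNIV \<times> Pr r then C (fst z) (snd z) else \<infinity>) \<in> borel_measurable kern"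
proof -
  let ?f = "\<lambda>z. if z \<in> UNIV \<times> Pr r then C (fst z) (snd z) else \<infinity>"
  have real: "{z \<in> UNIV \<times> Pr r. C (fst z) (snd z) \<le> ereal a} \<in> sets kern" for a
  proof -
    have "{z \<in> UNIV \<times> Pr r. C (fst z) (snd z) \<le> ereal a} = {(x, p). p \<in> Pr r \<and> C x p \<le> ereal (a + (\<integral>y. 0 \<partial>p))}" by auto
    also have "\<dots> \<in> sets kern" by (rule seq_closed_sets[OF lsc_seq_closed[OF C r Phi_const] r])
    finally show ?thesis .
  qed
  have "{z \<in> space kern. ?f z \<le> a} \<in> sets kern" for a
  proof (cases a)
    case (real b)
    have "{z \<in> space kern. ?f z \<le> a} = {z \<in> UNIV \<times> Pr r. C (fst z) (snd z) \<le> ereal b}"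
      unfolding real Pr_kern[OF r, of undefined] by auto
    then show ?thesis using \<open>\<And>a. {z \<in> UNIV \<times> Pr r. C (fst z) (snd z) \<le> ereal a} \<in> sets kern\<close> by simp
  next
    case PInf
    then show ?thesis by simp
  next
    case MInf
    have "{z \<in> space kern. ?f z \<le> a} = (\<Inter>n::nat. {z \<in> UNIV \<times> Pr r. C (fst z) (snd z) \<le> ereal (- real n)})"
    proof (intro set_eqI iffI)
      fix z assume "z \<in> {z \<in> space kern. ?f z \<le> a}"
      then show "z \<in> (\<Inter>n::nat. {z \<in> UNIV \<times> Pr r. C (fst z) (snd z) \<le> ereal (- real n)})"
        using MInf by (auto split: if_splits)
    next
      fix z assume z: "z \<in> (\<Inter>n::nat. {z \<in> UNIV \<times> Pr r. C (fst z) (snd z) \<le> ereal (- real n)})"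
      then have "C (fst z) (snd z) \<le> ereal (- real n)" for n by auto
      then have "C (fst z) (snd z) = - \<infinity>"
      proof (intro ereal_bot)
        fix B
        obtain n where "- B \<le> real n" using real_arch_simple by blast
        then have "ereal (- real n) \<le> ereal B" by simp
        then show "C (fst z) (snd z) \<le> ereal B" using \<open>\<And>n. C (fst z) (snd z) \<le> ereal (- real n)\<close> order_trans by blast
      qed
      then show "z \<in> {z \<in> space kern. ?f z \<le> a}" using z MInf unfolding Pr_kern[OF r, of undefined] by auto
    qed
    also have "\<dots> \<in> sets kern" by (intro sets.countable_INT') (auto intro!: real)
    finally show ?thesis .
  qed
  then show ?thesis unfolding borel_measurable_iff_Iic_ereal by (auto simp: vimage_def Int_def conj_commute)
qed

text \<open>\<open>Lambda\<close> tests the marginals with bounded continuous functions only. These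
  determine the image of \<open>P\<close> under \<open>fst\<close> and the mixture
  \<open>P \<bind> snd\<close>, and the latter, being \<open>\<nu>\<close>, transfers the finite
  moment: the moment of \<open>p\<close> has a finite \<open>P\<close>-integral, hence is finite
  almost surely.\<close>

lemma
  fixes \<mu> :: "'a::metric_space measure" and \<nu> :: "'b::metric_space measure"
  assumes P: "P \<in> Lambda \<mu> \<nu>" and mu: "\<mu> \<in> Pr r" and nu: "\<nu> \<in> Pr r" and r: "r > 0"
  shows Lambda_fst: "distr P borel fst = \<mu>"
    and Lambda_Pr: "AE z in P. z \<in> UNIV \<times> Pr r"
    and Lambda_snd: "\<And>\<psi>. \<psi> \<in> Phi r \<Longrightarrow> integrable P (\<lambda>z. \<integral>y. \<psi> y \<partial>(snd z)) \<and> (\<integral>z. (\<integral>y. \<psi> y \<partial>(snd z)) \<partial>P) = (\<integral>y. \<psi> y \<partial>\<nu>)"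
proof -
  have pP: "prob_space P" and sP: "sets P = sets kern"
    and c1: "\<And>g. g \<in> Cb \<Longrightarrow> (\<integral>z. (\<integral>y. g (fst z) \<partial>(snd z)) \<partial>P) = (\<integral>x. g x \<partial>\<mu>)"
    and c2: "\<And>h. h \<in> Cb \<Longrightarrow> (\<integral>z. (\<integral>y. h y \<partial>(snd z)) \<partial>P) = (\<integral>y. h y \<partial>\<nu>)"
    using P by (auto simp: Lambda_def intensity_def)
  interpret prob_space P by fact
  note [measurable_cong] = sP
  have spP: "space P = space kern" by (rule sets_eq_imp_space_eq[OF sP])
  have m1: "fst \<in> measurable P borel" by measurable
  have m2: "snd \<in> measurable P (subprob_algebra borel)" using snd_subprob measurable_cong_sets[OF sP refl] by blast
  show "distr P borel fst = \<mu>"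
  proof (rule prob_eqI_Cb)
    show "prob_space (distr P borel fst)" by (rule prob_space_distr[OF m1])
    fix f :: "'a \<Rightarrow> real" assume f: "f \<in> Cb"
    have "f \<in> borel_measurable borel" by (rule Phi_measurable[OF Cb_Phi[OF f] refl])
    then have "(\<integral>x. f x \<partial>distr P borel fst) = (\<integral>z. f (fst z) \<partial>P)" by (rule integral_distr[OF m1])
    also have "\<dots> = (\<integral>z. (\<integral>y. f (fst z) \<partial>(snd z)) \<partial>P)"
      by (rule Bochner_Integration.integral_cong) (auto simp: spP space_kern prob_space.prob_space)
    also have "\<dots> = (\<integral>x. f x \<partial>\<mu>)" by (rule c1[OF f])
    finally show "(\<integral>x. f x \<partial>distr P borel fst) = (\<integral>x. f x \<partial>\<mu>)" .
  qed (use mu in \<open>auto simp: Pr_def\<close>)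
  have bind: "P \<bind> snd = \<nu>"
  proof (rule prob_eqI_Cb)
    have ps: "AE x in P. prob_space (snd x)" by (rule AE_I2) (simp add: spP space_kern)
    show "prob_space (P \<bind> snd)" by (rule prob_space_bind[OF ps m2])
    show "sets (P \<bind> snd) = sets borel" by (rule sets_bind[OF _ not_empty]) (simp add: spP space_kern)
    fix f :: "'b \<Rightarrow> real" assume f: "f \<in> Cb"
    obtain c where c: "\<And>x. \<bar>f x\<bar> \<le> c" using f by (rule Cb_D) blast
    have fm: "f \<in> borel_measurable borel" by (rule Phi_measurable[OF Cb_Phi[OF f] refl])
    have "(\<integral>x. f x \<partial>(P \<bind> snd)) = (\<integral>z. (\<integral>y. f y \<partial>(snd z)) \<partial>P)"
      by (rule integral_bind[OF fm _ m2, where B=c and B'=1])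
        (use c in \<open>auto intro!: AE_I2 finite_measure_axioms simp: spP space_kern prob_space.emeasure_space_1\<close>)
    then show "(\<integral>x. f x \<partial>(P \<bind> snd)) = (\<integral>x. f x \<partial>\<nu>)" by (simp add: c2[OF f])
  qed (use nu in \<open>auto simp: Pr_def\<close>)
  have nn: "(\<integral>\<^sup>+ z. (\<integral>\<^sup>+ y. ennreal (f y) \<partial>(snd z)) \<partial>P) = ennreal (\<integral>y. f y \<partial>\<nu>)"
    if f: "f \<in> Phi r" and f0: "\<And>y. 0 \<le> f y" for f
  proof -
    have fm: "f \<in> borel_measurable borel" by (rule Phi_measurable[OF f refl])
    have "(\<integral>\<^sup>+ z. (\<integral>\<^sup>+ y. ennreal (f y) \<partial>(snd z)) \<partial>P) = (\<integral>\<^sup>+ y. ennreal (f y) \<partial>(P \<bind> snd))"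
      by (rule nn_integral_bind[symmetric, OF _ m2]) (use fm in measurable)
    also have "\<dots> = ennreal (\<integral>y. f y \<partial>\<nu>)"
      unfolding bind by (rule nn_integral_eq_integral[OF Phi_integrable[OF nu f r]]) (simp add: f0)
    finally show ?thesis .
  qed
  show AES: "AE z in P. z \<in> UNIV \<times> Pr r"
  proof -
    have dm: "(\<lambda>y::'b. ennreal (dist y undefined powr r)) \<in> borel_measurable borel"
      by (intro measurable_compose[OF _ measurable_ennreal] borel_measurable_continuous_onI continuous_dist_powr r)
    have "(\<integral>\<^sup>+ z. (\<integral>\<^sup>+ y. ennreal (dist y undefined powr r) \<partial>(snd z)) \<partial>P) \<noteq> \<infinity>"
      unfolding nn[OF Phi_dist[OF r] powr_ge_zero] by simp
    then have "AE z in P. (\<integral>\<^sup>+ y. ennreal (dist y undefined powr r) \<partial>(snd z)) \<noteq> \<infinity>"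
      by (rule nn_integral_PInf_AE[rotated]) (rule measurable_compose[OF m2 nn_integral_measurable_subprob_algebra[OF dm]])
    then show ?thesis
      by (rule AE_mp) (auto simp: Pr_kern[OF r, of undefined] spP less_top intro!: AE_I2)
  qed
  have pos: "integrable P (\<lambda>z. \<integral>y. f y \<partial>(snd z)) \<and> (\<integral>z. (\<integral>y. f y \<partial>(snd z)) \<partial>P) = (\<integral>y. f y \<partial>\<nu>)"
    if f: "f \<in> Phi r" and f0: "\<And>y. 0 \<le> f y" for f
  proof -
    have m: "(\<lambda>z. \<integral>y. f y \<partial>(snd z)) \<in> borel_measurable P"
      by (rule measurable_compose[OF m2 integral_measurable_subprob_algebra[OF Phi_measurable[OF f refl]]])
    have "(\<integral>\<^sup>+ z. ennreal (\<integral>y. f y \<partial>(snd z)) \<partial>P) = (\<integral>\<^sup>+ z. (\<integral>\<^sup>+ y. ennreal (f y) \<partial>(snd z)) \<partial>P)"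
      using AES
    proof (intro nn_integral_cong_AE, eventually_elim)
      fix z :: "'a \<times> 'b measure" assume "z \<in> UNIV \<times> Pr r"
      then have "snd z \<in> Pr r" by auto
      from nn_integral_eq_integral[OF Phi_integrable[OF this f r]] f0
      show "ennreal (\<integral>y. f y \<partial>(snd z)) = (\<integral>\<^sup>+ y. ennreal (f y) \<partial>(snd z))" by simp
    qed
    also have "\<dots> = ennreal (\<integral>y. f y \<partial>\<nu>)" by (rule nn[OF f f0])
    finally have e: "(\<integral>\<^sup>+ z. ennreal (\<integral>y. f y \<partial>(snd z)) \<partial>P) = ennreal (\<integral>y. f y \<partial>\<nu>)" .
    have i: "integrable P (\<lambda>z. \<integral>y. f y \<partial>(snd z))"
      by (rule integrableI_nonneg[OF m]) (use e f0 in auto)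
    then show ?thesis using e f0 nn_integral_eq_integral[OF i] by simp
  qed
  fix \<psi> :: "'b \<Rightarrow> real" assume \<psi>: "\<psi> \<in> Phi r"
  obtain c where c: "\<And>y. \<bar>\<psi> y\<bar> \<le> c * (1 + dist y undefined powr r)" using Phi_bound[OF \<psi> r] by metis
  \<comment> \<open>Both \<open>w\<close> and \<open>w + \<psi>\<close> are nonnegative, so the
    signed integrand is a difference of two cases already settled.\<close>
  define w where "w y = c * (1 + dist y undefined powr r)" for y :: 'b
  have w: "w \<in> Phi r" unfolding w_def by (intro Phi_scale Phi_add Phi_const Phi_dist r)
  have w0: "0 \<le> w y" "0 \<le> w y + \<psi> y" for y using c[of y] by (auto simp: w_def abs_le_iff)
  have p1: "integrable P (\<lambda>z. \<integral>y. w y \<partial>(snd z))" "(\<integral>z. (\<integral>y. w y \<partial>(snd z)) \<partial>P) = (\<integral>y. w y \<partial>\<nu>)"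
    using pos[OF w w0(1)] by auto
  have p2: "integrable P (\<lambda>z. \<integral>y. w y + \<psi> y \<partial>(snd z))" "(\<integral>z. (\<integral>y. w y + \<psi> y \<partial>(snd z)) \<partial>P) = (\<integral>y. w y + \<psi> y \<partial>\<nu>)"
    using pos[OF Phi_add[OF w \<psi> r] w0(2)] by auto
  have sum: "(\<integral>y. w y + \<psi> y \<partial>q) = (\<integral>y. w y \<partial>q) + (\<integral>y. \<psi> y \<partial>q)" if "q \<in> Pr r" for q
    using Phi_integrable[OF that w r] Phi_integrable[OF that \<psi> r] by simp
  have mm: "(\<lambda>z. \<integral>y. \<psi> y \<partial>(snd z)) \<in> borel_measurable P"
    by (rule measurable_compose[OF m2 integral_measurable_subprob_algebra[OF Phi_measurable[OF \<psi> refl]]])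
  have dI: "integrable P (\<lambda>z. (\<integral>y. w y + \<psi> y \<partial>(snd z)) - (\<integral>y. w y \<partial>(snd z)))" using p1(1) p2(1) by simp
  have ae: "AE z in P. (\<integral>y. w y + \<psi> y \<partial>(snd z)) - (\<integral>y. w y \<partial>(snd z)) = (\<integral>y. \<psi> y \<partial>(snd z))"
    using AES by eventually_elim (auto simp: sum)
  have "integrable P (\<lambda>z. \<integral>y. \<psi> y \<partial>(snd z))"
    using integrable_cong_AE_imp[OF dI mm] ae by (simp add: eq_commute)
  moreover have "(\<integral>z. (\<integral>y. \<psi> y \<partial>(snd z)) \<partial>P) = (\<integral>z. (\<integral>y. w y + \<psi> y \<partial>(snd z)) - (\<integral>y. w y \<partial>(snd z)) \<partial>P)"
    using ae by (intro integral_cong_AE mm borel_measurable_integrable[OF dI]) (simp add: eq_commute)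
  ultimately show "integrable P (\<lambda>z. \<integral>y. \<psi> y \<partial>(snd z)) \<and> (\<integral>z. (\<integral>y. \<psi> y \<partial>(snd z)) \<partial>P) = (\<integral>y. \<psi> y \<partial>\<nu>)"
    using p1 p2 sum[OF nu] by simp
qed

section \<open>Universal measurability of projections\<close>

lemma cut_tail_tendsto:
  assumes "\<And>y. 0 \<le> f y" "f \<in> Phi r" and p: "p \<in> Pr r" and r: "r > 0"
    and h: "\<And>N. h N \<in> Phi r" "\<And>N y. 0 \<le> h N y" "\<And>N y. h N y \<le> f y"
    and z: "\<And>y. \<exists>K. \<forall>N\<ge>K. h N y = 0"
  shows "(\<lambda>N::nat. \<integral>y. h N y \<partial>p) \<longlonglongrightarrow> 0"
proof -
  have "(\<lambda>N. \<integral>y. h N y \<partial>p) \<longlonglongrightarrow> (\<integral>y. 0 \<partial>p)"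
  proof (rule integral_dominated_convergence[where w = f])
    show "h N \<in> borel_measurable p" for N by (rule Phi_measurable[OF h(1) Pr_sets[OF p]])
    show "integrable p f" by (rule Phi_integrable[OF p assms(2) r])
    show "AE y in p. norm (h N y) \<le> f y" for N using h(2,3) by (simp add: abs_of_nonneg)
    have "(\<lambda>N. h N y) \<longlonglongrightarrow> 0" for y
      by (rule tendsto_eventually) (use z[of y] in \<open>simp add: eventually_sequentially\<close>)
    then show "AE y in p. (\<lambda>N. h N y) \<longlonglongrightarrow> 0" by simp
  qed simp
  then show ?thesis by simp
qed

text \<open>A capacity argument: by continuity of the outer measure along increasing sets, \<open>F\<close> can be cut down to a decreasing
  sequence of sets with controlled mass at infinity while keeping the outer measure of the projection above \<open>t\<close>;
  compactness then turns the intersection of the closures of the projections into a subset of the projection.\<close>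

theorem seq_closed_projection:
  fixes F :: "('a::metric_space \<times> 'b::{metric_space,second_countable_topology} measure) set"
  assumes u: "coercive (u :: nat \<Rightarrow> 'b \<Rightarrow> real)" and r: "r > 0" and F: "seq_closed r F"
    and mu: "prob_space \<mu>" "sets \<mu> = sets borel"
  shows "fst ` F \<in> sets (completion \<mu>)"
proof -
  interpret prob_space \<mu> by fact
  have sp: "space \<mu> = UNIV" using sets_eq_imp_space_eq[OF mu(2)] by simp
  define E :: "nat \<Rightarrow> nat \<Rightarrow> ('a \<times> 'b measure) set"
    where "E m N = {z \<in> UNIV \<times> Pr r. (\<integral>y. cut (real N) (u m) y \<partial>(snd z)) \<le> (1/2) ^ Suc m
      \<and> (\<integral>y. tail r undefined (real N) y \<partial>(snd z)) \<le> (1/2) ^ Suc m}" for m N :: nat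
  have Emono: "E m N \<subseteq> E m (Suc N)" for m N
  proof
    fix z :: "'a \<times> 'b measure" assume z: "z \<in> E m N"
    then have p: "snd z \<in> Pr r" by (auto simp: E_def)
    have "(\<integral>y. cut (real (Suc N)) (u m) y \<partial>(snd z)) \<le> (\<integral>y. cut (real N) (u m) y \<partial>(snd z))"
      by (rule integral_mono[OF Phi_integrable[OF p cut_Phi[OF coercive_cont[OF u]] r] Phi_integrable[OF p cut_Phi[OF coercive_cont[OF u]] r]])
        (simp add: cut_def)
    moreover have "(\<integral>y. tail r undefined (real (Suc N)) y \<partial>(snd z)) \<le> (\<integral>y. tail r undefined (real N) y \<partial>(snd z))"
      by (rule integral_mono[OF Phi_integrable[OF p tail_Phi[OF r] r] Phi_integrable[OF p tail_Phi[OF r] r]])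
        (simp add: tail_def)
    ultimately show "z \<in> E m (Suc N)" using z by (auto simp: E_def)
  qed
  have Ecov: "\<exists>N. z \<in> E m N" if "z \<in> UNIV \<times> Pr r" for z :: "'a \<times> 'b measure" and m
  proof -
    have p: "snd z \<in> Pr r" using that by auto
    have "(\<lambda>N::nat. \<integral>y. cut (real N) (u m) y \<partial>(snd z)) \<longlonglongrightarrow> 0"
    proof (rule cut_tail_tendsto[where f = "\<lambda>_. 1", OF _ Phi_const p r cut_Phi[OF coercive_cont[OF u]] cut_range])
      fix y
      obtain K :: nat where "u m y \<le> real K" using real_arch_simple by blast
      then show "\<exists>K. \<forall>N\<ge>K. cut (real N) (u m) y = 0" by (intro exI[of _ K]) (auto simp: cut_def)
    qed simp
    moreover have "(\<lambda>N::nat. \<integral>y. tail r undefined (real N) y \<partial>(snd z)) \<longlonglongrightarrow> 0"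
    proof (rule cut_tail_tendsto[where f = "\<lambda>y. dist y undefined powr r", OF _ Phi_dist[OF r] p r tail_Phi[OF r] tail_nonneg])
      fix y :: 'b
      obtain K :: nat where "dist y undefined powr r \<le> real K" using real_arch_simple by blast
      then show "\<exists>K. \<forall>N\<ge>K. tail r undefined (real N) y = 0" by (intro exI[of _ K]) (auto simp: tail_def)
    qed (simp_all add: tail_def)
    ultimately have "\<forall>\<^sub>F N in sequentially. (\<integral>y. cut (real N) (u m) y \<partial>(snd z)) < (1/2) ^ Suc m \<and>
        (\<integral>y. tail r undefined (real N) y \<partial>(snd z)) < (1/2) ^ Suc m"
      by (intro eventually_conj; elim order_tendstoD(2)) simp_all
    then obtain N where "(\<integral>y. cut (real N) (u m) y \<partial>(snd z)) < (1/2) ^ Suc m \<and>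
        (\<integral>y. tail r undefined (real N) y \<partial>(snd z)) < (1/2) ^ Suc m"
      unfolding eventually_sequentially by blast
    then show ?thesis using that unfolding E_def by (intro exI[of _ N]) simp
  qed
  have FS: "F \<subseteq> UNIV \<times> Pr r" using F by (simp add: seq_closed_def)
  have compact: "\<exists>K. closed K \<and> K \<subseteq> fst ` F \<and> t \<le> emeasure \<mu> K" if t: "t < outer_measure_of \<mu> (fst ` F)" for t
  proof -
    have "\<exists>A. \<forall>n. (A n \<subseteq> F \<and> t < outer_measure_of \<mu> (fst ` A n)) \<and> (\<exists>N. A (Suc n) = A n \<inter> E n N)"
    proof (rule dependent_nat_choice)
      show "\<exists>A. A \<subseteq> F \<and> t < outer_measure_of \<mu> (fst ` A)" using t by blast
      fix A n assume A: "A \<subseteq> F \<and> t < outer_measure_of \<mu> (fst ` A)"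
      have "(\<Union>N. fst ` (A \<inter> E n N)) = fst ` A"
      proof -
        have "A = (\<Union>N. A \<inter> E n N)" using A FS Ecov[of _ n] by blast
        then show ?thesis by (metis image_UN)
      qed
      moreover have "incseq (\<lambda>N. fst ` (A \<inter> E n N))" using Emono by (intro incseq_SucI) blast
      then have "(SUP N. outer_measure_of \<mu> (fst ` (A \<inter> E n N))) = outer_measure_of \<mu> (\<Union>N. fst ` (A \<inter> E n N))"
        by (intro SUP_outer_measure_of_incseq) (simp_all add: sp)
      ultimately have "t < (SUP N. outer_measure_of \<mu> (fst ` (A \<inter> E n N)))" using A by simp
      then obtain N where "t < outer_measure_of \<mu> (fst ` (A \<inter> E n N))" by (auto simp: less_SUP_iff)
      then show "\<exists>A'. (A' \<subseteq> F \<and> t < outer_measure_of \<mu> (fst ` A')) \<and> (\<exists>N. A' = A \<inter> E n N)"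
        using A by (intro exI[of _ "A \<inter> E n N"]) auto
    qed
    then obtain A where "\<forall>n. (A n \<subseteq> F \<and> t < outer_measure_of \<mu> (fst ` A n)) \<and> (\<exists>N. A (Suc n) = A n \<inter> E n N)" by (rule exE)
    then have AF: "\<And>n. A n \<subseteq> F" and At: "\<And>n. t < outer_measure_of \<mu> (fst ` A n)" and AN: "\<And>n. \<exists>N. A (Suc n) = A n \<inter> E n N" by auto
    obtain N where N: "\<And>n. A (Suc n) = A n \<inter> E n (N n)" using AN by metis
    have Adec: "A n \<subseteq> A m" if "m \<le> n" for m n
      using that by (induction n rule: dec_induct) (use N in auto)
    define K where "K = (\<Inter>n. closure (fst ` A n))"
    have "closed K" unfolding K_def by (intro closed_INT) auto
    moreover have "t \<le> emeasure \<mu> K"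
    proof -
      have "(INF n. emeasure \<mu> (closure (fst ` A n))) = emeasure \<mu> (\<Inter>n. closure (fst ` A n))"
      proof (rule INF_emeasure_decseq)
        show "range (\<lambda>n. closure (fst ` A n)) \<subseteq> sets \<mu>" by (auto simp: mu(2))
        show "decseq (\<lambda>n. closure (fst ` A n))" using Adec by (intro decseq_SucI closure_mono image_mono) simp
      qed simp
      moreover have "t \<le> emeasure \<mu> (closure (fst ` A n))" for n
      proof -
        have "t \<le> outer_measure_of \<mu> (fst ` A n)" using At by (rule less_imp_le)
        also have "\<dots> \<le> outer_measure_of \<mu> (closure (fst ` A n))" by (intro outer_measure_of_mono closure_subset)
        also have "\<dots> = emeasure \<mu> (closure (fst ` A n))" by (rule outer_measure_of_eq) (simp add: mu(2))
        finally show ?thesis .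
      qed
      then have "t \<le> (INF n. emeasure \<mu> (closure (fst ` A n)))" by (intro INF_greatest)
      ultimately show ?thesis by (simp add: K_def)
    qed
    moreover have "K \<subseteq> fst ` F"
    proof
      fix x assume x: "x \<in> K"
      have "\<exists>w. w \<in> A (Suc n) \<and> dist (fst w) x < inverse (real (Suc n))" for n
      proof -
        have "x \<in> closure (fst ` A (Suc n))" using x unfolding K_def by blast
        then have "\<exists>y\<in>fst ` A (Suc n). dist y x < inverse (real (Suc n))" unfolding closure_approachable by simp
        then show ?thesis by blast
      qed
      then obtain w where w: "\<And>n. w n \<in> A (Suc n)" "\<And>n. dist (fst (w n)) x < inverse (real (Suc n))" by metis
      define xs ps where "xs n = fst (w n)" and "ps n = snd (w n)" for n
      have ps: "ps n \<in> Pr r" for n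
      proof -
        have "w n \<in> UNIV \<times> Pr r" using w(1)[of n] AF[of "Suc n"] FS by blast
        then show ?thesis by (auto simp: ps_def)
      qed
      \<comment> \<open>Stepping to \<open>A (Suc n)\<close> makes the constraints for all
        \<open>j \<le> n\<close> available, which is the range that \<open>Phi_compact\<close>
        requires.\<close>
      have wE: "w n \<in> E j (N j)" if "j \<le> n" for j n
      proof -
        have "w n \<in> A (Suc j)" using w(1)[of n] Adec[of "Suc j" "Suc n"] that by auto
        then show ?thesis using N[of j] by auto
      qed
      obtain s p where s: "strict_mono s" "p \<in> Pr r" "Phi_conv r (\<lambda>n. ps (s n)) p"
        by (rule Phi_compact[OF u r ps, where N = "\<lambda>j. real (N j)" and ?y0.0 = undefined])
          (use wE in \<open>auto simp: E_def ps_def\<close>)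
      have "xs \<longlonglongrightarrow> x"
      proof (rule metric_LIMSEQ_I)
        fix e :: real assume "e > 0"
        then obtain M where M: "inverse (real (Suc M)) < e" using reals_Archimedean by blast
        have "dist (xs n) x < e" if "n \<ge> M" for n
        proof -
          have "inverse (real (Suc n)) \<le> inverse (real (Suc M))" using that by (simp add: le_imp_inverse_le)
          then show ?thesis using w(2)[of n] M unfolding xs_def by linarith
        qed
        then show "\<exists>M. \<forall>n\<ge>M. dist (xs n) x < e" by blast
      qed
      then have "(\<lambda>n. xs (s n)) \<longlonglongrightarrow> x" using LIMSEQ_subseq_LIMSEQ[OF _ s(1)] by (simp add: o_def)
      moreover have "(xs (s n), ps (s n)) \<in> F" for n using w(1)[of "s n"] AF[of "Suc (s n)"] by (auto simp: xs_def ps_def)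
      ultimately have "(x, p) \<in> F" using F s(2,3) unfolding seq_closed_def
        by (elim conjE) (drule spec[of _ "\<lambda>n. xs (s n)"], drule spec[of _ "\<lambda>n. ps (s n)"], blast)
      then show "x \<in> fst ` F" by force
    qed
    ultimately show ?thesis by blast
  qed
  \<comment> \<open>A measurable hull of the projection. Closed subsets of the projection exhaust
    its measure, so the projection differs from a Borel set by part of a null set.\<close>
  obtain H where H: "H \<in> sets \<mu>" "fst ` F \<subseteq> H" "outer_measure_of \<mu> (fst ` F) = emeasure \<mu> H"
    using outer_measure_of_attain[of "fst ` F" \<mu>] by (auto simp: sp)
  have "\<exists>K. closed K \<and> K \<subseteq> fst ` F \<and> measure \<mu> H - inverse (real (Suc k)) \<le> measure \<mu> K" for k
  proof (cases "measure \<mu> H - inverse (real (Suc k)) \<le> 0")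
    case True
    then show ?thesis by (intro exI[of _ "{}"]) simp
  next
    case False
    moreover have "0 < inverse (real (Suc k))" by simp
    ultimately have "0 < measure \<mu> H" "measure \<mu> H - inverse (real (Suc k)) < measure \<mu> H" by linarith+
    then have "ennreal (measure \<mu> H - inverse (real (Suc k))) < outer_measure_of \<mu> (fst ` F)"
      unfolding H(3) emeasure_eq_measure by (rule ennreal_lessI)
    from compact[OF this] False show ?thesis by (auto simp: emeasure_eq_measure)
  qed
  then obtain K where K: "\<And>k. closed (K k)" "\<And>k. K k \<subseteq> fst ` F"
    "\<And>k. measure \<mu> H - inverse (real (Suc k)) \<le> measure \<mu> (K k)" by metis
  define B where "B = (\<Union>k. K k)"
  have Ks: "K k \<in> sets \<mu>" for k using K(1) by (simp add: mu(2))
  then have B: "B \<in> sets \<mu>" unfolding B_def by auto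
  have BF: "B \<subseteq> fst ` F" using K(2) by (auto simp: B_def)
  have "measure \<mu> H \<le> measure \<mu> B"
  proof (rule field_le_epsilon)
    fix e :: real assume "e > 0"
    then obtain k where "inverse (real (Suc k)) < e" using reals_Archimedean by blast
    moreover have "measure \<mu> (K k) \<le> measure \<mu> B" by (rule finite_measure_mono[OF _ B]) (auto simp: B_def)
    ultimately show "measure \<mu> H \<le> measure \<mu> B + e" using K(3)[of k] by simp
  qed
  moreover have "measure \<mu> (H - B) = measure \<mu> H - measure \<mu> B"
    by (rule finite_measure_Diff[OF H(1) B]) (use BF H(2) in blast)
  ultimately have "measure \<mu> (H - B) = 0" using measure_nonneg[of \<mu> "H - B"] by simp
  then have "H - B \<in> null_sets \<mu>" using H(1) B by (intro null_setsI) (auto simp: emeasure_eq_measure)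
  then have "fst ` F - B \<in> sets (completion \<mu>)" by (rule null_sets_completion) (use H(2) in blast)
  moreover have "fst ` F = B \<union> (fst ` F - B)" using BF by blast
  ultimately show ?thesis using sets_completionI_sets[OF B] by (metis sets.Un)
qed

lemma RC_measurable:
  fixes C :: "'a::metric_space \<Rightarrow> 'b::{metric_space,second_countable_topology} measure \<Rightarrow> ereal"
  assumes u: "coercive (u :: nat \<Rightarrow> 'b \<Rightarrow> real)" and r: "r > 0" and C: "lsc_Wr r C" and \<psi>: "\<psi> \<in> Phi r"
    and mu: "prob_space \<mu>" "sets \<mu> = sets borel"
  shows "RC r C \<psi> \<in> borel_measurable (completion \<mu>)"
  unfolding borel_measurable_ereal_iff_Iio
proof
  fix a :: ereal
  have sp: "space \<mu> = UNIV" using sets_eq_imp_space_eq[OF mu(2)] by simp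
  define F where "F q = {(x, p). p \<in> Pr r \<and> C x p \<le> ereal (real_of_rat q + (\<integral>y. \<psi> y \<partial>p))}" for q
  have eq: "- ereal b + c \<le> ereal q \<longleftrightarrow> c \<le> ereal (q + b)" for b q and c :: ereal by (cases c) auto
  have "RC r C \<psi> x < a \<longleftrightarrow> (\<exists>q\<in>{q. ereal (real_of_rat q) < a}. x \<in> fst ` F q)" for x
  proof -
    have "RC r C \<psi> x < a \<longleftrightarrow> (\<exists>p\<in>Pr r. - ereal (\<integral>y. \<psi> y \<partial>p) + C x p < a)"
      unfolding RC_def by (simp add: INF_less_iff)
    also have "\<dots> \<longleftrightarrow> (\<exists>p\<in>Pr r. \<exists>q. - ereal (\<integral>y. \<psi> y \<partial>p) + C x p \<le> ereal (real_of_rat q) \<and> ereal (real_of_rat q) < a)"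
      using ereal_dense3 by (meson le_less_trans less_imp_le)
    also have "\<dots> \<longleftrightarrow> (\<exists>q\<in>{q. ereal (real_of_rat q) < a}. \<exists>p. (x, p) \<in> F q)"
      unfolding F_def eq by auto
    finally show ?thesis by force
  qed
  then have "RC r C \<psi> -` {..<a} \<inter> space (completion \<mu>) = (\<Union>q\<in>{q. ereal (real_of_rat q) < a}. fst ` F q)"
    by (auto simp: sp)
  also have "\<dots> \<in> sets (completion \<mu>)"
  proof (rule sets.countable_UN'')
    show "fst ` F q \<in> sets (completion \<mu>)" for q
      unfolding F_def by (rule seq_closed_projection[OF u r lsc_seq_closed[OF C r \<psi>] mu])
  qed simp
  finally show "RC r C \<psi> -` {..<a} \<inter> space (completion \<mu>) \<in> sets (completion \<mu>)" .
qed

section \<open>Weak duality\<close>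

text \<open>The inequality \<open>g + w \<le> f\<close> with all negative parts moved to the other
  side. It contains no subtraction and can therefore be integrated without meeting a difference of
  infinities.\<close>

lemma e2ennreal_balance:
  assumes "g + ereal w \<le> f"
  shows "e2ennreal (- f) + e2ennreal g + ennreal w \<le> e2ennreal f + e2ennreal (- g) + ennreal (- w)"
proof -
  have real: "ennreal (- a) + ennreal b + ennreal w \<le> ennreal a + ennreal (- b) + ennreal (- w)" if "b + w \<le> a" for a b
    using that by (cases "a \<ge> 0"; cases "b \<ge> 0"; cases "w \<ge> 0")
      (auto simp: ennreal_neg ennreal_leI simp flip: ennreal_plus)
  show ?thesis
    using assms by (cases f; cases g) (auto simp: real e2ennreal_infty e2ennreal_neg)
qed

lemma enn2ereal_e2ennreal_split: "enn2ereal (e2ennreal x) - enn2ereal (e2ennreal (- x)) = x"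
proof (cases x)
  case (real a)
  then show ?thesis by (cases "a \<ge> 0") (auto simp: enn2ereal_ennreal ennreal_neg zero_ennreal.rep_eq)
qed (auto simp: e2ennreal_neg e2ennreal_infty zero_ennreal.rep_eq)

text \<open>The balanced inequality is integrated termwise; \<open>fin\<close> and the integrability
  of \<open>w\<close> then allow the finite terms to be moved back.\<close>

lemma ext_compare:
  assumes f: "f \<in> borel_measurable M" and g: "g \<in> borel_measurable M" and w: "integrable M w"
    and le: "AE x in M. g x + ereal (w x) \<le> f x"
    and fin: "(\<integral>\<^sup>+ x. e2ennreal (- f x) \<partial>M) < \<infinity>" "(\<integral>\<^sup>+ x. e2ennreal (- g x) \<partial>M) < \<infinity>"
  shows "ereal (\<integral>x. w x \<partial>M) + (enn2ereal (\<integral>\<^sup>+ x. e2ennreal (g x) \<partial>M) - enn2ereal (\<integral>\<^sup>+ x. e2ennreal (- g x) \<partial>M))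
     \<le> enn2ereal (\<integral>\<^sup>+ x. e2ennreal (f x) \<partial>M) - enn2ereal (\<integral>\<^sup>+ x. e2ennreal (- f x) \<partial>M)"
proof -
  note [measurable] = f g borel_measurable_integrable[OF w]
  define Fp Fm Gp Gm Wp Wm where "Fp = (\<integral>\<^sup>+ x. e2ennreal (f x) \<partial>M)" and "Fm = (\<integral>\<^sup>+ x. e2ennreal (- f x) \<partial>M)"
    and "Gp = (\<integral>\<^sup>+ x. e2ennreal (g x) \<partial>M)" and "Gm = (\<integral>\<^sup>+ x. e2ennreal (- g x) \<partial>M)"
    and "Wp = (\<integral>\<^sup>+ x. ennreal (w x) \<partial>M)" and "Wm = (\<integral>\<^sup>+ x. ennreal (- w x) \<partial>M)"
  have "Fm + Gp + Wp = (\<integral>\<^sup>+ x. e2ennreal (- f x) + e2ennreal (g x) + ennreal (w x) \<partial>M)"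
    unfolding Fm_def Gp_def Wp_def by (simp add: nn_integral_add)
  also have "\<dots> \<le> (\<integral>\<^sup>+ x. e2ennreal (f x) + e2ennreal (- g x) + ennreal (- w x) \<partial>M)"
    using le by (intro nn_integral_mono_AE, eventually_elim) (rule e2ennreal_balance)
  also have "\<dots> = Fp + Gm + Wm" unfolding Fp_def Gm_def Wm_def by (simp add: nn_integral_add)
  finally have main: "Fm + Gp + Wp \<le> Fp + Gm + Wm" .
  have Wfin: "Wp < \<infinity>" "Wm < \<infinity>" using w unfolding Wp_def Wm_def real_integrable_def by (auto simp: less_top)
  have wi: "(\<integral>x. w x \<partial>M) = enn2real Wp - enn2real Wm"
    unfolding Wp_def Wm_def by (rule real_lebesgue_integral_def[OF w])
  obtain a b c d where r: "Fm = ennreal a" "a \<ge> 0" "Gm = ennreal b" "b \<ge> 0" "Wp = ennreal c" "c \<ge> 0" "Wm = ennreal d" "d \<ge> 0"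
    using fin Wfin unfolding Fm_def[symmetric] Gm_def[symmetric] by (cases Fm; cases Gm; cases Wp; cases Wm) auto
  have "ereal (\<integral>x. w x \<partial>M) + (enn2ereal Gp - enn2ereal Gm) \<le> enn2ereal Fp - enn2ereal Fm"
  proof (cases Fp)
    case top
    then show ?thesis using r by (simp add: enn2ereal_ennreal)
  next
    case F: (real p)
    then have "Gp \<noteq> \<infinity>" using main r F by (auto simp: top_unique simp flip: ennreal_plus)
    then obtain q where G: "Gp = ennreal q" "q \<ge> 0" by (cases Gp) auto
    have "a + q + c \<le> p + b + d" using main r F G by (simp flip: ennreal_plus)
    then show ?thesis using r F G by (simp add: wi enn2ereal_ennreal)
  qed
  then show ?thesis by (simp add: Fp_def Fm_def Gp_def Gm_def)
qed

lemma nn_integral_negpart_finite: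
  assumes w: "integrable M w" and le: "AE x in M. ereal (w x) \<le> f x"
  shows "(\<integral>\<^sup>+ x. e2ennreal (- f x) \<partial>M) < \<infinity>"
proof -
  have "(\<integral>\<^sup>+ x. e2ennreal (- f x) \<partial>M) \<le> (\<integral>\<^sup>+ x. ennreal (- w x) \<partial>M)"
  proof (rule nn_integral_mono_AE, use le in eventually_elim)
    fix x assume "ereal (w x) \<le> f x"
    then have "e2ennreal (- f x) \<le> e2ennreal (ereal (- w x))" unfolding uminus_ereal.simps(1)[symmetric] by (intro e2ennreal_mono) (simp only: ereal_minus_le_minus)
    then show "e2ennreal (- f x) \<le> ennreal (- w x)" by simp
  qed
  also have "\<dots> < \<infinity>" using w by (auto simp: real_integrable_def less_top)
  finally show ?thesis .
qed

lemma ext_integral_eq: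
  assumes "f \<in> borel_measurable M" "(\<integral>\<^sup>+ x. e2ennreal (- f x) \<partial>M) < \<infinity>"
  shows "ext_integral M f = enn2ereal (\<integral>\<^sup>+ x. e2ennreal (f x) \<partial>M) - enn2ereal (\<integral>\<^sup>+ x. e2ennreal (- f x) \<partial>M)"
  using assms by (auto simp: ext_integral_def)

lemma integral_le_ext_integral:
  assumes f: "f \<in> borel_measurable M" and w: "integrable M w" and le: "AE x in M. ereal (w x) \<le> f x"
  shows "ereal (\<integral>x. w x \<partial>M) \<le> ext_integral M f"
proof -
  note fin = nn_integral_negpart_finite[OF w le]
  have "ereal (\<integral>x. w x \<partial>M) + (enn2ereal (\<integral>\<^sup>+ x. e2ennreal 0 \<partial>M) - enn2ereal (\<integral>\<^sup>+ x. e2ennreal (- 0) \<partial>M)) \<le> ext_integral M f"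
    unfolding ext_integral_eq[OF f fin]
    by (rule ext_compare[OF f _ w _ fin]) (use le in \<open>auto simp: e2ennreal_neg\<close>)
  then show ?thesis by (simp add: e2ennreal_neg)
qed

text \<open>Measurability holds after \<open>C\<close> is redefined off
  \<open>UNIV \<times> Pr r\<close>. That set has full measure under \<open>P\<close>, so the
  completion absorbs the arbitrary values.\<close>

lemma cost_measurable:
  fixes C :: "'a::{metric_space,second_countable_topology} \<Rightarrow> 'b::{metric_space,second_countable_topology} measure \<Rightarrow> ereal"
  assumes P: "P \<in> Lambda \<mu> \<nu>" and mu: "\<mu> \<in> Pr r" and nu: "\<nu> \<in> Pr r" and r: "r > 0" and C: "lsc_Wr r C"
  shows "(\<lambda>z. C (fst z) (snd z)) \<in> borel_measurable (completion P)"
proof -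
  have sP: "sets P = sets kern" using P by (simp add: Lambda_def)
  have "AE z in P. z \<in> UNIV \<times> Pr r" by (rule Lambda_Pr[OF P mu nu r])
  then obtain N where N: "N \<in> null_sets P" "{z \<in> space P. \<not> z \<in> UNIV \<times> Pr r} \<subseteq> N"
    by (auto elim!: AE_E simp: null_setsI)
  have "(\<lambda>z. if z \<in> UNIV \<times> Pr r then C (fst z) (snd z) else \<infinity>) \<in> borel_measurable P"
    using lsc_measurable[OF C r] measurable_cong_sets[OF sP refl] by blast
  then show ?thesis by (rule completion_measurable_null[OF _ N(1)]) (use N(2) in auto)
qed

lemma Lambda_sum_integral:
  fixes \<mu> :: "'a::metric_space measure" and \<nu> :: "'b::metric_space measure"
  assumes P: "P \<in> Lambda \<mu> \<nu>" and mu: "\<mu> \<in> Pr r" and nu: "\<nu> \<in> Pr r" and r: "r > 0"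
    and \<phi>: "\<phi> \<in> Phi r" and \<psi>: "\<psi> \<in> Phi r"
  shows "integrable P (\<lambda>z. \<phi> (fst z) + (\<integral>y. \<psi> y \<partial>(snd z)))"
    and "(\<integral>z. \<phi> (fst z) + (\<integral>y. \<psi> y \<partial>(snd z)) \<partial>P) = (\<integral>x. \<phi> x \<partial>\<mu>) + (\<integral>y. \<psi> y \<partial>\<nu>)"
proof -
  have sP: "sets P = sets kern" using P by (simp add: Lambda_def)
  have m1: "fst \<in> measurable P borel" by (simp add: measurable_cong_sets[OF sP refl])
  have d: "distr P borel fst = \<mu>" by (rule Lambda_fst[OF P mu nu r])
  have \<phi>m: "\<phi> \<in> borel_measurable borel" by (rule Phi_measurable[OF \<phi> refl])
  have "integrable (distr P borel fst) \<phi>" unfolding d by (rule Phi_integrable[OF mu \<phi> r])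
  then have i: "integrable P (\<lambda>z. \<phi> (fst z))" by (simp add: integrable_distr_eq[OF m1 \<phi>m])
  have e: "(\<integral>z. \<phi> (fst z) \<partial>P) = (\<integral>x. \<phi> x \<partial>\<mu>)" using integral_distr[OF m1 \<phi>m] d by simp
  note s = Lambda_snd[OF P mu nu r \<psi>]
  show "integrable P (\<lambda>z. \<phi> (fst z) + (\<integral>y. \<psi> y \<partial>(snd z)))" using i s by simp
  show "(\<integral>z. \<phi> (fst z) + (\<integral>y. \<psi> y \<partial>(snd z)) \<partial>P) = (\<integral>x. \<phi> x \<partial>\<mu>) + (\<integral>y. \<psi> y \<partial>\<nu>)"
    using i s e by simp
qed

text \<open>\<open>RC r C \<psi>\<close> is measurable for the completion of \<open>\<mu>\<close>.
  To be integrated against \<open>P\<close> it is replaced by a Borel function \<open>g\<close>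
  equal to it \<open>\<mu>\<close>-almost everywhere; the first marginal of \<open>P\<close> carries
  both the equality and the integrals over.\<close>

lemma weak_duality:
  fixes C :: "'a::{metric_space,second_countable_topology} \<Rightarrow> 'b::{metric_space,second_countable_topology} measure \<Rightarrow> ereal"
  assumes u: "coercive (u :: nat \<Rightarrow> 'b \<Rightarrow> real)"
    and P: "P \<in> Lambda \<mu> \<nu>" and mu: "\<mu> \<in> Pr r" and nu: "\<nu> \<in> Pr r" and r: "r > 0" and C: "lsc_Wr r C"
    and \<phi>0: "\<phi>0 \<in> Phi r" and \<psi>0: "\<psi>0 \<in> Phi r"
    and low: "\<And>x p. p \<in> Pr r \<Longrightarrow> ereal (\<phi>0 x + (\<integral>y. \<psi>0 y \<partial>p)) \<le> C x p"
    and \<psi>: "\<psi> \<in> Phi r"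
  shows "ereal (\<integral>y. \<psi> y \<partial>\<nu>) + ext_integral (completion \<mu>) (RC r C \<psi>)
    \<le> ext_integral (completion P) (\<lambda>z. C (fst z) (snd z))"
proof -
  let ?R = "RC r C \<psi>" and ?C = "\<lambda>z. C (fst z) (snd z)"
  have sP: "sets P = sets kern" using P by (simp add: Lambda_def)
  note AES = Lambda_Pr[OF P mu nu r]
  have m1: "fst \<in> measurable P borel" by (simp add: measurable_cong_sets[OF sP refl])
  have d: "distr P borel fst = \<mu>" by (rule Lambda_fst[OF P mu nu r])
  have smu: "sets \<mu> = sets borel" by (rule Pr_sets[OF mu])
  have Cm: "?C \<in> borel_measurable (completion P)" by (rule cost_measurable[OF P mu nu r C])
  have iC: "integrable (completion P) (\<lambda>z. \<phi>0 (fst z) + (\<integral>y. \<psi>0 y \<partial>(snd z)))"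
    using Lambda_sum_integral(1)[OF P mu nu r \<phi>0 \<psi>0] by (simp add: integrable_completion borel_measurable_integrable)
  have Cfin: "(\<integral>\<^sup>+ z. e2ennreal (- ?C z) \<partial>completion P) < \<infinity>"
    by (rule nn_integral_negpart_finite[OF iC]) (rule AE_completion, use AES in eventually_elim, use low in auto)
  have Rm: "?R \<in> borel_measurable (completion \<mu>)"
    by (rule RC_measurable[OF u r C \<psi> Pr_prob[OF mu] smu])
  show ?thesis
  proof (cases "ext_integral (completion \<mu>) ?R = - \<infinity>")
    case True
    then show ?thesis by simp
  next
    case False
    \<comment> \<open>An infinite negative part gives minus infinity in either branch of
      \<open>ext_integral\<close>, and that value has been dealt with.\<close>
    have Rfin: "(\<integral>\<^sup>+ x. e2ennreal (- ?R x) \<partial>completion \<mu>) < \<infinity>"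
    proof (rule ccontr)
      assume "\<not> ?thesis"
      then have "(\<integral>\<^sup>+ x. e2ennreal (- ?R x) \<partial>completion \<mu>) = \<infinity>" by (metis less_top infinity_ennreal_def)
      then have "ext_integral (completion \<mu>) ?R = - \<infinity>"
        unfolding ext_integral_def by (cases "(\<integral>\<^sup>+ x. e2ennreal (?R x) \<partial>completion \<mu>)") (auto simp: enn2ereal_ennreal)
      with False show False by contradiction
    qed
    have pm: "(\<lambda>x. e2ennreal (?R x)) \<in> borel_measurable (completion \<mu>)"
      and nm: "(\<lambda>x. e2ennreal (- ?R x)) \<in> borel_measurable (completion \<mu>)" using Rm by measurable
    \<comment> \<open>Borel versions are taken of the positive and the negative part separately,
      where values are in \<open>ennreal\<close>, and recombined in \<open>g\<close>.\<close>
    obtain gp where gp: "gp \<in> borel_measurable \<mu>" "AE x in \<mu>. e2ennreal (?R x) = gp x"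
      using completion_ex_borel_measurable[OF pm] by auto
    obtain gn where gn: "gn \<in> borel_measurable \<mu>" "AE x in \<mu>. e2ennreal (- ?R x) = gn x"
      using completion_ex_borel_measurable[OF nm] by auto
    define g where "g x = enn2ereal (gp x) - enn2ereal (gn x)" for x
    have gb: "g \<in> borel_measurable borel"
      unfolding g_def[abs_def] using gp(1) gn(1) measurable_cong_sets[OF smu refl] by (intro borel_measurable_ereal_diff measurable_compose[OF _ measurable_enn2ereal]) blast+
    have gR: "AE x in \<mu>. g x = ?R x"
      using gp(2) gn(2)
    proof eventually_elim
      fix x assume "e2ennreal (?R x) = gp x" "e2ennreal (- ?R x) = gn x"
      then have "g x = enn2ereal (e2ennreal (?R x)) - enn2ereal (e2ennreal (- ?R x))" by (simp add: g_def)
      also have "\<dots> = ?R x"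
        by (rule enn2ereal_e2ennreal_split)
      finally show "g x = ?R x" .
    qed
    have gRP: "AE z in P. g (fst z) = ?R (fst z)"
    proof (rule AE_distrD[OF m1])
      show "AE x in distr P borel fst. g x = ?R x" unfolding d by (rule gR)
    qed
    have nnp: "(\<integral>\<^sup>+ x. e2ennreal (h (?R x)) \<partial>completion \<mu>) = (\<integral>\<^sup>+ z. e2ennreal (h (g (fst z))) \<partial>completion P)"
      if h: "h \<in> borel_measurable borel" for h :: "ereal \<Rightarrow> ereal"
    proof -
      have "(\<integral>\<^sup>+ x. e2ennreal (h (?R x)) \<partial>completion \<mu>) = (\<integral>\<^sup>+ x. e2ennreal (h (g x)) \<partial>\<mu>)"
        unfolding nn_integral_completion using gR by (intro nn_integral_cong_AE, eventually_elim) simp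
      also have "\<dots> = (\<integral>\<^sup>+ x. e2ennreal (h (g x)) \<partial>distr P borel fst)" unfolding d ..
      also have "\<dots> = (\<integral>\<^sup>+ z. e2ennreal (h (g (fst z))) \<partial>P)"
        by (rule nn_integral_distr[OF m1]) (use gb h in measurable)
      finally show ?thesis by (simp add: nn_integral_completion)
    qed
    have gm: "(\<lambda>z. g (fst z)) \<in> borel_measurable (completion P)"
      by (rule measurable_completion[OF measurable_compose[OF m1 gb]])
    have iw: "integrable (completion P) (\<lambda>z. \<integral>y. \<psi> y \<partial>(snd z))" "(\<integral>z. (\<integral>y. \<psi> y \<partial>(snd z)) \<partial>completion P) = (\<integral>y. \<psi> y \<partial>\<nu>)"
      using Lambda_snd[OF P mu nu r \<psi>] by (simp_all add: integrable_completion integral_completion borel_measurable_integrable)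
    have le: "AE z in completion P. g (fst z) + ereal (\<integral>y. \<psi> y \<partial>(snd z)) \<le> ?C z"
    proof (rule AE_completion, use AES gRP in eventually_elim)
      fix z :: "'a \<times> 'b measure" assume z: "z \<in> UNIV \<times> Pr r" "g (fst z) = ?R (fst z)"
      then have "?R (fst z) \<le> - ereal (\<integral>y. \<psi> y \<partial>(snd z)) + ?C z" unfolding RC_def by (intro INF_lower) auto
      then show "g (fst z) + ereal (\<integral>y. \<psi> y \<partial>(snd z)) \<le> ?C z"
        unfolding z(2) by (cases "?R (fst z)"; cases "?C z") auto
    qed
    have gfin: "(\<integral>\<^sup>+ z. e2ennreal (- g (fst z)) \<partial>completion P) < \<infinity>"
      using Rfin nnp[of uminus] by simp
    have "ext_integral (completion \<mu>) ?R = enn2ereal (\<integral>\<^sup>+ z. e2ennreal (g (fst z)) \<partial>completion P)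
        - enn2ereal (\<integral>\<^sup>+ z. e2ennreal (- g (fst z)) \<partial>completion P)"
      unfolding ext_integral_eq[OF Rm Rfin] using nnp[of uminus] nnp[of "\<lambda>x. x"] by simp
    then show ?thesis
      using ext_compare[OF Cm gm iw(1) le Cfin gfin] unfolding ext_integral_eq[OF Cm Cfin] iw(2) by simp
  qed
qed

section \<open>The dual functional\<close>

lemma exists_small_cut:
  assumes u: "continuous_on UNIV u" and p: "p \<in> Pr r" and r: "r > 0" and e: "e > 0"
  shows "\<exists>N. (\<integral>y. cut N u y \<partial>p) \<le> e"
proof -
  have "(\<lambda>N::nat. \<integral>y. cut (real N) u y \<partial>p) \<longlonglongrightarrow> 0"
  proof (rule cut_tail_tendsto[where f = "\<lambda>_. 1", OF _ Phi_const p r cut_Phi[OF u] cut_range])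
    fix y
    obtain K :: nat where "u y \<le> real K" using real_arch_simple by blast
    then show "\<exists>K. \<forall>N\<ge>K. cut (real N) u y = 0" by (intro exI[of _ K]) (auto simp: cut_def)
  qed simp
  then have "\<forall>\<^sub>F N in sequentially. (\<integral>y. cut (real N) u y \<partial>p) < e" using e by (rule order_tendstoD(2))
  then show ?thesis unfolding eventually_sequentially by (meson less_imp_le order_refl)
qed

lemma exists_small_tail:
  assumes p: "p \<in> Pr r" and r: "r > 0" and e: "e > 0"
  shows "\<exists>N. (\<integral>y. tail r y0 N y \<partial>p) \<le> e"
proof -
  have "(\<lambda>N::nat. \<integral>y. tail r y0 (real N) y \<partial>p) \<longlonglongrightarrow> 0"
  proof (rule cut_tail_tendsto[where f = "\<lambda>y. dist y y0 powr r", OF _ Phi_dist[OF r] p r tail_Phi[OF r] tail_nonneg])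
    fix y
    obtain K :: nat where "dist y y0 powr r \<le> real K" using real_arch_simple by blast
    then show "\<exists>K. \<forall>N\<ge>K. tail r y0 (real N) y = 0" by (intro exI[of _ K]) (auto simp: tail_def)
  qed (simp_all add: tail_def)
  then have "\<forall>\<^sub>F N in sequentially. (\<integral>y. tail r y0 (real N) y \<partial>p) < e" using e by (rule order_tendstoD(2))
  then show ?thesis unfolding eventually_sequentially by (meson less_imp_le order_refl)
qed

definition oplus :: "('a \<Rightarrow> real) \<Rightarrow> ('b \<Rightarrow> real) \<Rightarrow> 'a \<times> 'b measure \<Rightarrow> real" where
  "oplus \<phi> \<psi> z = \<phi> (fst z) + (\<integral>y. \<psi> y \<partial>(snd z))"

text \<open>\<open>D\<close> is an arbitrary real upper bound of the constrained dual, so only a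
  finite dual supremum leads here; \<open>low\<close> is the growth condition in a form that
  \<open>oplus\<close> can absorb.\<close>

locale dual_problem =
  fixes r :: real
    and \<mu> :: "('a::{metric_space, second_countable_topology}) measure"
    and \<nu> :: "('b::{metric_space, second_countable_topology}) measure"
    and C :: "'a \<Rightarrow> 'b measure \<Rightarrow> ereal"
    and uX :: "nat \<Rightarrow> 'a \<Rightarrow> real" and uY :: "nat \<Rightarrow> 'b \<Rightarrow> real"
    and \<phi>0 :: "'a \<Rightarrow> real" and \<psi>0 :: "'b \<Rightarrow> real" and D :: real
  assumes uX: "coercive uX" and uY: "coercive uY" and r: "r > 0"
    and mu: "\<mu> \<in> Pr r" and nu: "\<nu> \<in> Pr r" and lsc: "lsc_Wr r C"
    and \<phi>0: "\<phi>0 \<in> Phi r" and \<psi>0: "\<psi>0 \<in> Phi r"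
    and low: "\<And>x p. p \<in> Pr r \<Longrightarrow> ereal (- oplus \<phi>0 \<psi>0 (x, p)) \<le> C x p"
    and D: "\<And>\<phi> \<psi>. \<phi> \<in> Phi r \<Longrightarrow> \<psi> \<in> Phi r \<Longrightarrow>
      (\<And>x p. p \<in> Pr r \<Longrightarrow> ereal (oplus \<phi> \<psi> (x, p)) \<le> C x p) \<Longrightarrow> (\<integral>x. \<phi> x \<partial>\<mu>) + (\<integral>y. \<psi> y \<partial>\<nu>) \<le> D"
begin

definition \<Omega> :: "('a \<times> 'b measure) set" where "\<Omega> = UNIV \<times> Pr r"

definition V :: "('a \<times> 'b measure \<Rightarrow> real) set" where
  "V = {f. \<exists>\<phi>\<in>Phi r. \<exists>\<psi>\<in>Phi r. \<forall>z\<in>\<Omega>. \<bar>f z\<bar> \<le> oplus \<phi> \<psi> z}"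

definition L :: "('a \<Rightarrow> real) \<Rightarrow> ('b \<Rightarrow> real) \<Rightarrow> real" where
  "L \<phi> \<psi> = (\<integral>x. \<phi> x \<partial>\<mu>) + (\<integral>y. \<psi> y \<partial>\<nu>)"

text \<open>The functional \<open>U f = Inf (S f)\<close> defined below is the largest sublinear one which is at most \<open>L \<phi> \<psi>\<close> on
  \<open>oplus \<phi> \<psi>\<close> and at most \<open>D\<close> on the (extended real) cost; the dual bound \<open>D\<close> makes it finite.\<close>

definition S :: "('a \<times> 'b measure \<Rightarrow> real) \<Rightarrow> real set" where
  "S f = {L \<phi> \<psi> + t * D | \<phi> \<psi> t. \<phi> \<in> Phi r \<and> \<psi> \<in> Phi r \<and> t \<ge> 0 \<and>
     (\<forall>z\<in>\<Omega>. ereal (f z) \<le> ereal (oplus \<phi> \<psi> z) + ereal t * C (fst z) (snd z))}"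

lemma S_I: "\<phi> \<in> Phi r \<Longrightarrow> \<psi> \<in> Phi r \<Longrightarrow> t \<ge> 0 \<Longrightarrow>
    (\<And>z. z \<in> \<Omega> \<Longrightarrow> ereal (f z) \<le> ereal (oplus \<phi> \<psi> z) + ereal t * C (fst z) (snd z)) \<Longrightarrow> L \<phi> \<psi> + t * D \<in> S f"
  unfolding S_def by blast

lemma S_E:
  assumes "c \<in> S f"
  obtains \<phi> \<psi> t where "\<phi> \<in> Phi r" "\<psi> \<in> Phi r" "t \<ge> 0" "c = L \<phi> \<psi> + t * D"
    "\<And>z. z \<in> \<Omega> \<Longrightarrow> ereal (f z) \<le> ereal (oplus \<phi> \<psi> z) + ereal t * C (fst z) (snd z)"
  using assms unfolding S_def by blast

lemma oplus_add:
  assumes "\<phi> \<in> Phi r" "\<psi> \<in> Phi r" "\<phi>' \<in> Phi r" "\<psi>' \<in> Phi r" "z \<in> \<Omega>"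
  shows "oplus (\<lambda>x. \<phi> x + \<phi>' x) (\<lambda>y. \<psi> y + \<psi>' y) z = oplus \<phi> \<psi> z + oplus \<phi>' \<psi>' z"
proof -
  have z: "snd z \<in> Pr r" using assms(5) by (auto simp: \<Omega>_def)
  show ?thesis using Phi_integrable[OF z assms(2) r] Phi_integrable[OF z assms(4) r] by (simp add: oplus_def)
qed

lemma oplus_scale: "oplus (\<lambda>x. c * \<phi> x) (\<lambda>y. c * \<psi> y) z = c * oplus \<phi> \<psi> z"
  by (simp add: oplus_def distrib_left)

lemma L_add:
  assumes "\<phi> \<in> Phi r" "\<psi> \<in> Phi r" "\<phi>' \<in> Phi r" "\<psi>' \<in> Phi r"
  shows "L (\<lambda>x. \<phi> x + \<phi>' x) (\<lambda>y. \<psi> y + \<psi>' y) = L \<phi> \<psi> + L \<phi>' \<psi>'"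
  using assms Phi_integrable[OF mu _ r] Phi_integrable[OF nu _ r] by (simp add: L_def)

lemma L_scale: "L (\<lambda>x. c * \<phi> x) (\<lambda>y. c * \<psi> y) = c * L \<phi> \<psi>"
  by (simp add: L_def distrib_left)

lemma Phi_add': "\<phi> \<in> Phi r \<Longrightarrow> \<psi> \<in> Phi r \<Longrightarrow> (\<lambda>y. \<phi> y + \<psi> y) \<in> Phi r"
  and Phi_scale': "\<phi> \<in> Phi r \<Longrightarrow> (\<lambda>y. c * \<phi> y) \<in> Phi r"
  by (simp_all add: Phi_add Phi_scale r)

text \<open>Evaluating at the fixed measure \<open>p = \<nu>\<close> gives a lower bound on
  \<open>\<phi> x\<close> that is constant in \<open>x\<close>; integration against
  \<open>\<mu>\<close> finishes.\<close>

lemma L_nonneg: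
  assumes \<phi>: "\<phi> \<in> Phi r" and \<psi>: "\<psi> \<in> Phi r" and pos: "\<And>z. z \<in> \<Omega> \<Longrightarrow> 0 \<le> oplus \<phi> \<psi> z"
  shows "0 \<le> L \<phi> \<psi>"
proof -
  interpret M: prob_space \<mu> by (rule Pr_prob[OF mu])
  have "(\<integral>x. - (\<integral>y. \<psi> y \<partial>\<nu>) \<partial>\<mu>) \<le> (\<integral>x. \<phi> x \<partial>\<mu>)"
  proof (rule integral_mono)
    show "integrable \<mu> \<phi>" by (rule Phi_integrable[OF mu \<phi> r])
    show "- (\<integral>y. \<psi> y \<partial>\<nu>) \<le> \<phi> x" for x
      using pos[of "(x, \<nu>)"] nu by (simp add: oplus_def \<Omega>_def)
  qed simp
  then show ?thesis by (simp add: L_def M.prob_space)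
qed

text \<open>This is what makes \<open>U\<close> finite. A member of \<open>S f\<close> with
  \<open>t > 0\<close> yields, after division by \<open>- t\<close>, a pair admissible for the dual,
  whose value is at most \<open>D\<close>; with \<open>t = 0\<close> the positivity of
  \<open>L\<close> takes over.\<close>

lemma S_lower:
  assumes \<phi>: "\<phi> \<in> Phi r" and \<psi>: "\<psi> \<in> Phi r" and f: "\<And>z. z \<in> \<Omega> \<Longrightarrow> - oplus \<phi> \<psi> z \<le> f z" and c: "c \<in> S f"
  shows "- L \<phi> \<psi> \<le> c"
proof -
  obtain \<phi>1 \<psi>1 t where h: "\<phi>1 \<in> Phi r" "\<psi>1 \<in> Phi r" "t \<ge> 0" "c = L \<phi>1 \<psi>1 + t * D"
    and le: "\<And>z. z \<in> \<Omega> \<Longrightarrow> ereal (f z) \<le> ereal (oplus \<phi>1 \<psi>1 z) + ereal t * C (fst z) (snd z)"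
    using S_E[OF c] by metis
  define \<phi>2 \<psi>2 where "\<phi>2 = (\<lambda>x. \<phi>1 x + \<phi> x)" and "\<psi>2 = (\<lambda>y. \<psi>1 y + \<psi> y)"
  have P2: "\<phi>2 \<in> Phi r" "\<psi>2 \<in> Phi r" unfolding \<phi>2_def \<psi>2_def by (intro Phi_add' h \<phi> \<psi>)+
  have L2: "L \<phi>2 \<psi>2 = L \<phi>1 \<psi>1 + L \<phi> \<psi>" unfolding \<phi>2_def \<psi>2_def by (rule L_add[OF h(1,2) \<phi> \<psi>])
  have o2: "oplus \<phi>2 \<psi>2 z = oplus \<phi>1 \<psi>1 z + oplus \<phi> \<psi> z" if "z \<in> \<Omega>" for z
    unfolding \<phi>2_def \<psi>2_def by (rule oplus_add[OF h(1,2) \<phi> \<psi> that])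
  have le2: "0 \<le> ereal (oplus \<phi>2 \<psi>2 z) + ereal t * C (fst z) (snd z)" if "z \<in> \<Omega>" for z
  proof -
    have "ereal (- oplus \<phi> \<psi> z) \<le> ereal (oplus \<phi>1 \<psi>1 z) + ereal t * C (fst z) (snd z)"
      using le[OF that] f[OF that] by (meson ereal_less_eq(3) order_trans)
    then show ?thesis unfolding o2[OF that]
      by (cases "ereal t * C (fst z) (snd z)") auto
  qed
  show ?thesis
  proof (cases "t = 0")
    \<comment> \<open>The cost drops out even where it is infinite, since zero times infinity is
      zero in \<open>ereal\<close>.\<close>
    case True
    then have "0 \<le> oplus \<phi>2 \<psi>2 z" if "z \<in> \<Omega>" for z using le2[OF that] by (simp flip: zero_ereal_def)
    then have "0 \<le> L \<phi>2 \<psi>2" by (rule L_nonneg[OF P2])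
    then show ?thesis using h True L2 by simp
  next
    case False
    then have t: "t > 0" using h by simp
    have "L (\<lambda>x. (- (1/t)) * \<phi>2 x) (\<lambda>y. (- (1/t)) * \<psi>2 y) \<le> D" unfolding L_def
    proof (rule D[OF Phi_scale'[OF P2(1)] Phi_scale'[OF P2(2)]])
      fix x and p :: "'b measure" assume p: "p \<in> Pr r"
      then have "(x, p) \<in> \<Omega>" by (simp add: \<Omega>_def)
      then have "0 \<le> ereal (oplus \<phi>2 \<psi>2 (x, p)) + ereal t * C x p" using le2[of "(x, p)"] by simp
      then have "ereal (- (1/t) * oplus \<phi>2 \<psi>2 (x, p)) \<le> C x p"
        using t low[OF p, of x] by (cases "C x p") (auto simp: field_simps)
      then show "ereal (oplus (\<lambda>x. (- (1/t)) * \<phi>2 x) (\<lambda>y. (- (1/t)) * \<psi>2 y) (x, p)) \<le> C x p"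
        by (simp only: oplus_scale)
    qed
    then have "- (1/t) * L \<phi>2 \<psi>2 \<le> D" by (simp only: L_scale)
    then have "- L \<phi>2 \<psi>2 \<le> t * D" using t by (simp add: field_simps)
    then show ?thesis using h L2 by simp
  qed
qed

definition U :: "('a \<times> 'b measure \<Rightarrow> real) \<Rightarrow> real" where "U f = Inf (S f)"

lemma V_E:
  assumes "f \<in> V"
  obtains \<phi> \<psi> where "\<phi> \<in> Phi r" "\<psi> \<in> Phi r" "\<And>z. z \<in> \<Omega> \<Longrightarrow> \<bar>f z\<bar> \<le> oplus \<phi> \<psi> z"
  using assms unfolding V_def by blast

lemma V_I: "\<phi> \<in> Phi r \<Longrightarrow> \<psi> \<in> Phi r \<Longrightarrow> (\<And>z. z \<in> \<Omega> \<Longrightarrow> \<bar>f z\<bar> \<le> oplus \<phi> \<psi> z) \<Longrightarrow> f \<in> V"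
  unfolding V_def by blast

lemma V_add:
  assumes "f \<in> V" "g \<in> V" shows "(\<lambda>z. f z + g z) \<in> V"
proof -
  obtain \<phi> \<psi> where f: "\<phi> \<in> Phi r" "\<psi> \<in> Phi r" "\<And>z. z \<in> \<Omega> \<Longrightarrow> \<bar>f z\<bar> \<le> oplus \<phi> \<psi> z" using V_E[OF assms(1)] by metis
  obtain \<phi>' \<psi>' where g: "\<phi>' \<in> Phi r" "\<psi>' \<in> Phi r" "\<And>z. z \<in> \<Omega> \<Longrightarrow> \<bar>g z\<bar> \<le> oplus \<phi>' \<psi>' z" using V_E[OF assms(2)] by metis
  show ?thesis
  proof (rule V_I[OF Phi_add'[OF f(1) g(1)] Phi_add'[OF f(2) g(2)]])
    fix z assume z: "z \<in> \<Omega>"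
    show "\<bar>f z + g z\<bar> \<le> oplus (\<lambda>x. \<phi> x + \<phi>' x) (\<lambda>y. \<psi> y + \<psi>' y) z"
      unfolding oplus_add[OF f(1,2) g(1,2) z] using f(3)[OF z] g(3)[OF z] by linarith
  qed
qed

lemma V_scale:
  assumes "f \<in> V" shows "(\<lambda>z. c * f z) \<in> V"
proof -
  obtain \<phi> \<psi> where f: "\<phi> \<in> Phi r" "\<psi> \<in> Phi r" "\<And>z. z \<in> \<Omega> \<Longrightarrow> \<bar>f z\<bar> \<le> oplus \<phi> \<psi> z" using V_E[OF assms] by metis
  show ?thesis
    by (rule V_I[OF Phi_scale'[OF f(1), of "\<bar>c\<bar>"] Phi_scale'[OF f(2), of "\<bar>c\<bar>"]])
      (simp add: oplus_scale abs_mult f(3) mult_left_mono)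
qed

lemma oplus_bound:
  assumes \<phi>: "\<phi> \<in> Phi r" and \<psi>: "\<psi> \<in> Phi r"
  shows "oplus \<phi> \<psi> \<in> V"
proof -
  have a: "(\<lambda>x. \<bar>\<phi> x\<bar>) \<in> Phi r" by (rule Phi_dominated[OF _ \<phi> r, of _ 1]) (auto intro!: continuous_intros Phi_cont[OF \<phi>])
  have b: "(\<lambda>x. \<bar>\<psi> x\<bar>) \<in> Phi r" by (rule Phi_dominated[OF _ \<psi> r, of _ 1]) (auto intro!: continuous_intros Phi_cont[OF \<psi>])
  show ?thesis
  proof (rule V_I[OF a b])
    fix z assume "z \<in> \<Omega>"
    have "\<bar>\<integral>y. \<psi> y \<partial>(snd z)\<bar> \<le> (\<integral>y. \<bar>\<psi> y\<bar> \<partial>(snd z))" by (rule integral_abs_bound)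
    then show "\<bar>oplus \<phi> \<psi> z\<bar> \<le> oplus (\<lambda>x. \<bar>\<phi> x\<bar>) (\<lambda>y. \<bar>\<psi> y\<bar>) z" unfolding oplus_def by linarith
  qed
qed

lemma S_ne: assumes "f \<in> V" shows "S f \<noteq> {}"
proof -
  obtain \<phi> \<psi> where f: "\<phi> \<in> Phi r" "\<psi> \<in> Phi r" "\<And>z. z \<in> \<Omega> \<Longrightarrow> \<bar>f z\<bar> \<le> oplus \<phi> \<psi> z" using V_E[OF assms] by metis
  have "L \<phi> \<psi> + 0 * D \<in> S f"
    by (rule S_I[OF f(1,2)]) (use f(3) in \<open>auto simp: abs_le_iff zero_ereal_def[symmetric]\<close>)
  then show ?thesis by blast
qed

lemma S_bdd: assumes "f \<in> V" shows "bdd_below (S f)"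
proof -
  obtain \<phi> \<psi> where f: "\<phi> \<in> Phi r" "\<psi> \<in> Phi r" "\<And>z. z \<in> \<Omega> \<Longrightarrow> \<bar>f z\<bar> \<le> oplus \<phi> \<psi> z" using V_E[OF assms] by metis
  have "- L \<phi> \<psi> \<le> c" if "c \<in> S f" for c
    by (rule S_lower[OF f(1,2) _ that]) (use f(3) in \<open>fastforce simp: abs_le_iff\<close>)
  then show ?thesis by (rule bdd_belowI)
qed

lemma U_le: "f \<in> V \<Longrightarrow> c \<in> S f \<Longrightarrow> U f \<le> c"
  unfolding U_def by (rule cInf_lower[OF _ S_bdd])

lemma U_approx: "f \<in> V \<Longrightarrow> e > 0 \<Longrightarrow> \<exists>c\<in>S f. c < U f + e"
  using cInf_less_iff[OF S_ne S_bdd, of f "U f + e"] unfolding U_def by simp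

lemma S_add:
  assumes "c \<in> S f" "d \<in> S g" shows "c + d \<in> S (\<lambda>z. f z + g z)"
proof -
  obtain \<phi> \<psi> t where f: "\<phi> \<in> Phi r" "\<psi> \<in> Phi r" "t \<ge> 0" "c = L \<phi> \<psi> + t * D"
    "\<And>z. z \<in> \<Omega> \<Longrightarrow> ereal (f z) \<le> ereal (oplus \<phi> \<psi> z) + ereal t * C (fst z) (snd z)" using S_E[OF assms(1)] by metis
  obtain \<phi>' \<psi>' s where g: "\<phi>' \<in> Phi r" "\<psi>' \<in> Phi r" "s \<ge> 0" "d = L \<phi>' \<psi>' + s * D"
    "\<And>z. z \<in> \<Omega> \<Longrightarrow> ereal (g z) \<le> ereal (oplus \<phi>' \<psi>' z) + ereal s * C (fst z) (snd z)" using S_E[OF assms(2)] by metis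
  have "L (\<lambda>x. \<phi> x + \<phi>' x) (\<lambda>y. \<psi> y + \<psi>' y) + (t + s) * D \<in> S (\<lambda>z. f z + g z)"
  proof (rule S_I[OF Phi_add'[OF f(1) g(1)] Phi_add'[OF f(2) g(2)]])
    show "0 \<le> t + s" using f(3) g(3) by simp
    fix z assume z: "z \<in> \<Omega>"
    have "ereal (t + s) * C (fst z) (snd z) = ereal t * C (fst z) (snd z) + ereal s * C (fst z) (snd z)"
      using f(3) g(3) ereal_left_distrib[of "ereal t" "ereal s" "C (fst z) (snd z)"] by simp
    moreover have "ereal (f z) + ereal (g z) \<le> (ereal (oplus \<phi> \<psi> z) + ereal t * C (fst z) (snd z)) + (ereal (oplus \<phi>' \<psi>' z) + ereal s * C (fst z) (snd z))"
      by (rule add_mono[OF f(5)[OF z] g(5)[OF z]])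
    ultimately show "ereal (f z + g z) \<le> ereal (oplus (\<lambda>x. \<phi> x + \<phi>' x) (\<lambda>y. \<psi> y + \<psi>' y) z) + ereal (t + s) * C (fst z) (snd z)"
      unfolding oplus_add[OF f(1,2) g(1,2) z] plus_ereal.simps(1)[symmetric] by (simp only: add_ac)
  qed
  then show ?thesis unfolding L_add[OF f(1,2) g(1,2)] f(4) g(4) by (simp add: algebra_simps)
qed

lemma S_scale:
  assumes "c \<in> S f" "a > 0" shows "a * c \<in> S (\<lambda>z. a * f z)"
proof -
  obtain \<phi> \<psi> t where f: "\<phi> \<in> Phi r" "\<psi> \<in> Phi r" "t \<ge> 0" "c = L \<phi> \<psi> + t * D"
    "\<And>z. z \<in> \<Omega> \<Longrightarrow> ereal (f z) \<le> ereal (oplus \<phi> \<psi> z) + ereal t * C (fst z) (snd z)" using S_E[OF assms(1)] by metis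
  have "L (\<lambda>x. a * \<phi> x) (\<lambda>y. a * \<psi> y) + (a * t) * D \<in> S (\<lambda>z. a * f z)"
  proof (rule S_I[OF Phi_scale'[OF f(1)] Phi_scale'[OF f(2)]])
    show "0 \<le> a * t" using f(3) assms(2) by simp
    fix z assume z: "z \<in> \<Omega>"
    have "ereal a * ereal (f z) \<le> ereal a * (ereal (oplus \<phi> \<psi> z) + ereal t * C (fst z) (snd z))"
      using f(5)[OF z] assms(2) by (intro ereal_mult_left_mono) auto
    also have "\<dots> = ereal a * ereal (oplus \<phi> \<psi> z) + ereal a * (ereal t * C (fst z) (snd z))"
      by (rule ereal_distrib_left) auto
    finally show "ereal (a * f z) \<le> ereal (oplus (\<lambda>x. a * \<phi> x) (\<lambda>y. a * \<psi> y) z) + ereal (a * t) * C (fst z) (snd z)"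
      by (simp add: oplus_scale mult.assoc flip: times_ereal.simps(1))
  qed
  then show ?thesis unfolding L_scale f(4) by (simp add: algebra_simps)
qed

lemma extension:
  obtains l where "\<And>f. f \<in> V \<Longrightarrow> l f \<le> U f"
    "\<And>f g. f \<in> V \<Longrightarrow> g \<in> V \<Longrightarrow> l (\<lambda>x. f x + g x) = l f + l g"
    "\<And>c f. f \<in> V \<Longrightarrow> l (\<lambda>x. c * f x) = c * l f"
proof (rule dominated_extension[of V U])
  show "(\<lambda>_. 0) \<in> V" by (rule V_I[OF Phi_const[of 0] Phi_const[of 0]]) (simp add: oplus_def)
  show "(\<lambda>x. f x + g x) \<in> V" if "f \<in> V" "g \<in> V" for f g by (rule V_add[OF that])
  show "(\<lambda>x. c * f x) \<in> V" if "f \<in> V" for f c by (rule V_scale[OF that])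
  show "U (\<lambda>x. f x + g x) \<le> U f + U g" if fg: "f \<in> V" "g \<in> V" for f g
  proof (rule field_le_epsilon)
    fix e :: real assume "e > 0"
    then obtain c d where c: "c \<in> S f" "c < U f + e/2" "d \<in> S g" "d < U g + e/2"
      using U_approx[OF fg(1), of "e/2"] U_approx[OF fg(2), of "e/2"] by auto
    have "U (\<lambda>x. f x + g x) \<le> c + d" by (rule U_le[OF V_add[OF fg] S_add[OF c(1,3)]])
    then show "U (\<lambda>x. f x + g x) \<le> U f + U g + e" using c by simp
  qed
  show "U (\<lambda>x. a * f x) \<le> a * U f" if f: "f \<in> V" and a: "a > 0" for f and a :: real
  proof (rule field_le_epsilon)
    fix e :: real assume "e > 0"
    then obtain c where c: "c \<in> S f" "c < U f + e/a" using U_approx[OF f, of "e/a"] a by auto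
    have "U (\<lambda>x. a * f x) \<le> a * c" by (rule U_le[OF V_scale[OF f] S_scale[OF c(1) a]])
    also have "\<dots> \<le> a * (U f + e/a)" using c a by (intro mult_left_mono) auto
    also have "\<dots> = a * U f + e" using a by (simp add: field_simps)
    finally show "U (\<lambda>x. a * f x) \<le> a * U f + e" .
  qed
qed (rule that)

end

section \<open>Attainment of the dual bound\<close>

context dual_problem
begin

definition H :: "('a \<times> 'b measure \<Rightarrow> real) set" where
  "H = {f. (\<exists>c. \<forall>z\<in>\<Omega>. \<bar>f z\<bar> \<le> c) \<and> (\<forall>xs ps x p. (\<forall>n. ps n \<in> Pr r) \<longrightarrow> p \<in> Pr r \<longrightarrow> xs \<longlonglongrightarrow> x \<longrightarrow>
     Phi_conv r ps p \<longrightarrow> (\<lambda>n. f (xs n, ps n)) \<longlonglongrightarrow> f (x, p))}"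

lemma H_I:
  assumes "\<And>z. z \<in> \<Omega> \<Longrightarrow> \<bar>f z\<bar> \<le> c"
    and "\<And>xs ps x p. (\<And>n. ps n \<in> Pr r) \<Longrightarrow> p \<in> Pr r \<Longrightarrow> xs \<longlonglongrightarrow> x \<Longrightarrow> Phi_conv r ps p \<Longrightarrow> (\<lambda>n. f (xs n, ps n)) \<longlonglongrightarrow> f (x, p)"
  shows "f \<in> H"
  unfolding H_def using assms by blast

lemma H_bounded: "f \<in> H \<Longrightarrow> \<exists>c. \<forall>z\<in>\<Omega>. \<bar>f z\<bar> \<le> c"
  unfolding H_def by blast

lemma H_tendsto:
  assumes "f \<in> H" "\<And>n. ps n \<in> Pr r" "p \<in> Pr r" "xs \<longlonglongrightarrow> x" "Phi_conv r ps p"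
  shows "(\<lambda>n. f (xs n, ps n)) \<longlonglongrightarrow> f (x, p)"
  using assms unfolding H_def by blast

lemma H_V: assumes "f \<in> H" shows "f \<in> V"
proof -
  obtain c where "\<And>z. z \<in> \<Omega> \<Longrightarrow> \<bar>f z\<bar> \<le> c" using H_bounded[OF assms] by blast
  then show ?thesis by (intro V_I[OF Phi_const[of c] Phi_const[of 0]]) (simp add: oplus_def)
qed

lemma H_fst:
  assumes "continuous_on UNIV h" "\<And>x. \<bar>h x\<bar> \<le> c" shows "(\<lambda>z. h (fst z)) \<in> H"
  by (rule H_I[of _ c]) (use assms in \<open>simp_all add: continuous_on_tendsto_compose\<close>)

lemma H_snd:
  assumes "f \<in> Cb" shows "(\<lambda>z. \<integral>y. f y \<partial>(snd z)) \<in> H"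
proof -
  obtain c where c: "continuous_on UNIV f" "\<And>x. \<bar>f x\<bar> \<le> c" using Cb_D[OF assms] by metis
  show ?thesis
  proof (rule H_I[of _ c])
    fix z assume "z \<in> \<Omega>"
    then have z: "snd z \<in> Pr r" by (auto simp: \<Omega>_def)
    interpret prob_space "snd z" by (rule Pr_prob[OF z])
    have "\<bar>\<integral>y. f y \<partial>(snd z)\<bar> \<le> (\<integral>y. \<bar>f y\<bar> \<partial>(snd z))" by (rule integral_abs_bound)
    also have "\<dots> \<le> (\<integral>y. c \<partial>(snd z))"
      by (rule integral_mono) (use c(2) Phi_integrable[OF z Cb_Phi[OF assms] r] in auto)
    finally show "\<bar>\<integral>y. f y \<partial>(snd z)\<bar> \<le> c" by (simp add: prob_space)
  next
    fix xs :: "nat \<Rightarrow> 'a" and ps :: "nat \<Rightarrow> 'b measure" and p x assume "Phi_conv r ps p"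
    then show "(\<lambda>n. \<integral>y. f y \<partial>(snd (xs n, ps n))) \<longlonglongrightarrow> (\<integral>y. f y \<partial>(snd (x :: 'a, p)))"
      using Cb_Phi[OF assms] unfolding Phi_conv_def snd_conv by (rule bspec)
  qed
qed

text \<open>The penalty for \<open>vanishing_on_tight\<close>: mass at infinity in \<open>X\<close>,
  mass at infinity in \<open>Y\<close>, and moment at infinity in \<open>Y\<close>. The first space
  has no moment term because its points are only required to converge. Being of the form
  \<open>oplus\<close>, the penalty has a value under the functional that depends on
  \<open>\<mu>\<close> and \<open>\<nu>\<close> alone.\<close>

definition weight :: "(nat \<Rightarrow> real) \<Rightarrow> (nat \<Rightarrow> real) \<Rightarrow> (nat \<Rightarrow> real) \<Rightarrow> nat \<Rightarrow> 'a \<times> 'b measure \<Rightarrow> real" where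
  "weight a b c J = oplus (\<lambda>x. \<Sum>i\<le>J. 2 ^ Suc i * cut (a i) (uX i) x)
     (\<lambda>y. \<Sum>i\<le>J. 2 ^ Suc i * (cut (b i) (uY i) y + tail r undefined (c i) y))"

lemma weight_Phi:
  "(\<lambda>x. \<Sum>i\<le>J. 2 ^ Suc i * cut (a i) (uX i) x) \<in> Phi r"
  "(\<lambda>y. \<Sum>i\<le>J. 2 ^ Suc i * (cut (b i) (uY i) y + tail r undefined (c i) y)) \<in> Phi r"
  by (intro Phi_sum Phi_scale' Phi_add' cut_Phi tail_Phi coercive_cont[OF uX] coercive_cont[OF uY] r finite_atMost)+

text \<open>A total of at most 1 bounds the \<open>j\<close>-th terms by
  \<open>(1/2) ^ Suc j\<close> for all \<open>n \<ge> j\<close>. Coercivity of \<open>uX\<close>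
  then yields a subsequence in the first component, and \<open>Phi_compact\<close> a further one in
  the second.\<close>

lemma weight_compact:
  assumes t: "\<And>n. t n \<in> \<Omega>" "\<And>n. weight a b c n (t n) \<le> 1"
  obtains k x p where "strict_mono (k :: nat \<Rightarrow> nat)" "p \<in> Pr r" "(\<lambda>n. fst (t (k n))) \<longlonglongrightarrow> x" "Phi_conv r (\<lambda>n. snd (t (k n))) p"
proof -
  have ps: "snd (t n) \<in> Pr r" for n using t(1)[of n] by (auto simp: \<Omega>_def)
  have bounds: "cut (a j) (uX j) (fst (t n)) \<le> (1/2) ^ Suc j" "(\<integral>y. cut (b j) (uY j) y \<partial>(snd (t n))) \<le> (1/2) ^ Suc j"
    "(\<integral>y. tail r undefined (c j) y \<partial>(snd (t n))) \<le> (1/2) ^ Suc j" if "j \<le> n" for j n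
  proof -
    let ?x = "fst (t n)" and ?p = "snd (t n)"
    have ic: "integrable ?p (cut (b i) (uY i))" and it: "integrable ?p (tail r undefined (c i))" for i
      by (rule Phi_integrable[OF ps cut_Phi[OF coercive_cont[OF uY]] r], rule Phi_integrable[OF ps tail_Phi[OF r] r])
    have nn: "0 \<le> (\<integral>y. cut (b i) (uY i) y \<partial>?p)" "0 \<le> (\<integral>y. tail r undefined (c i) y \<partial>?p)" for i
      by (simp_all add: cut_range tail_nonneg)
    have e: "weight a b c n (t n) = (\<Sum>i\<le>n. 2 ^ Suc i * (cut (a i) (uX i) ?x + (\<integral>y. cut (b i) (uY i) y \<partial>?p) + (\<integral>y. tail r undefined (c i) y \<partial>?p)))"
      unfolding weight_def oplus_def using ic it
      by (simp add: Bochner_Integration.integral_sum sum.distrib[symmetric] distrib_left add.assoc)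
    have "2 ^ Suc j * (cut (a j) (uX j) ?x + (\<integral>y. cut (b j) (uY j) y \<partial>?p) + (\<integral>y. tail r undefined (c j) y \<partial>?p)) \<le> weight a b c n (t n)"
      unfolding e by (rule member_le_sum) (use that nn in \<open>auto intro!: mult_nonneg_nonneg add_nonneg_nonneg cut_range\<close>)
    also have "\<dots> \<le> 1" by (rule t(2))
    finally have "cut (a j) (uX j) ?x + (\<integral>y. cut (b j) (uY j) y \<partial>?p) + (\<integral>y. tail r undefined (c j) y \<partial>?p) \<le> (1/2) ^ Suc j"
      by (simp add: field_simps)
    then show "cut (a j) (uX j) ?x \<le> (1/2) ^ Suc j" "(\<integral>y. cut (b j) (uY j) y \<partial>?p) \<le> (1/2) ^ Suc j"
      "(\<integral>y. tail r undefined (c j) y \<partial>?p) \<le> (1/2) ^ Suc j"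
      using nn[of j] cut_range(1)[of "a j" "uX j" ?x] by linarith+
  qed
  have "uX j (fst (t n)) \<le> a j + 1" if "j \<le> n" for j n
  proof -
    have "(1/2::real) ^ j \<le> 1" by (intro power_le_one) simp_all
    then have "(1/2::real) ^ Suc j < 1" by simp
    then have "cut (a j) (uX j) (fst (t n)) < 1" using bounds(1)[OF that] by linarith
    then show ?thesis unfolding cut_def by (simp add: min_def max_def split: if_splits)
  qed
  then have "\<forall>j. \<forall>n\<ge>j. uX j (fst (t n)) \<le> a j + 1" by blast
  then have "\<exists>k x. strict_mono (k :: nat \<Rightarrow> nat) \<and> ((\<lambda>n. fst (t n)) \<circ> k) \<longlonglongrightarrow> x"
    using uX[unfolded coercive_def] by (elim conjE) (drule spec[of _ "\<lambda>n. fst (t n)"], drule spec[of _ "\<lambda>j. a j + 1"], blast)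
  then obtain k x where k: "strict_mono (k :: nat \<Rightarrow> nat)" "(\<lambda>n. fst (t (k n))) \<longlonglongrightarrow> x" by (auto simp: o_def)
  have kn: "n \<le> k n" for n by (rule seq_suble[OF k(1)])
  obtain s p where s: "strict_mono s" "p \<in> Pr r" "Phi_conv r (\<lambda>n. snd (t (k (s n)))) p"
  \<comment> \<open>\<open>Phi_compact\<close> has a single threshold for mass and moment; the
    larger of \<open>b j\<close> and \<open>c j\<close> serves for both, as \<open>cut\<close> and
    \<open>tail\<close> decrease in it.\<close>
  proof (rule Phi_compact[OF uY r, where ps = "\<lambda>n. snd (t (k n))" and N = "\<lambda>j. max (b j) (c j)" and ?y0.0 = undefined])
    show "snd (t (k n)) \<in> Pr r" for n by (rule ps)
    fix j n :: nat assume jn: "j \<le> n"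
    then have jk: "j \<le> k n" using kn[of n] by simp
    have "(\<integral>y. cut (max (b j) (c j)) (uY j) y \<partial>(snd (t (k n)))) \<le> (\<integral>y. cut (b j) (uY j) y \<partial>(snd (t (k n))))"
      by (rule integral_mono[OF Phi_integrable[OF ps cut_Phi[OF coercive_cont[OF uY]] r] Phi_integrable[OF ps cut_Phi[OF coercive_cont[OF uY]] r]])
        (auto simp: cut_def)
    then show "(\<integral>y. cut (max (b j) (c j)) (uY j) y \<partial>(snd (t (k n)))) \<le> (1/2) ^ Suc j" using bounds(2)[OF jk] by linarith
    have "(\<integral>y. tail r undefined (max (b j) (c j)) y \<partial>(snd (t (k n)))) \<le> (\<integral>y. tail r undefined (c j) y \<partial>(snd (t (k n))))"
      by (rule integral_mono[OF Phi_integrable[OF ps tail_Phi[OF r] r] Phi_integrable[OF ps tail_Phi[OF r] r]])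
        (auto simp: tail_def)
    then show "(\<integral>y. tail r undefined (max (b j) (c j)) y \<partial>(snd (t (k n)))) \<le> (1/2) ^ Suc j" using bounds(3)[OF jk] by linarith
  qed (rule that)
  show thesis
  proof (rule that[of "k \<circ> s" p x])
    show "strict_mono (k \<circ> s)" by (rule strict_mono_o[OF k(1) s(1)])
    show "(\<lambda>n. fst (t ((k \<circ> s) n))) \<longlonglongrightarrow> x" using LIMSEQ_subseq_LIMSEQ[OF k(2) s(1)] by (simp add: o_def)
    show "Phi_conv r (\<lambda>n. snd (t ((k \<circ> s) n))) p" using s(3) by (simp add: o_def)
  qed (rule s(2))
qed

lemma weight_small:
  assumes e: "e > 0"
  shows "\<exists>a b c. \<forall>J. L (\<lambda>x. \<Sum>i\<le>J. 2 ^ Suc i * cut (a i) (uX i) x)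
     (\<lambda>y. \<Sum>i\<le>J. 2 ^ Suc i * (cut (b i) (uY i) y + tail r undefined (c i) y)) \<le> e"
proof -
  \<comment> \<open>One third of the admissible size for each of the three kinds of penalty.\<close>
  define d where "d i = e / 4 ^ Suc i / 3" for i
  have d: "d i > 0" for i using e by (simp add: d_def)
  have "\<exists>a. \<forall>i. (\<integral>x. cut (a i) (uX i) x \<partial>\<mu>) \<le> d i"
    by (rule choice, rule allI, rule exists_small_cut[OF coercive_cont[OF uX] mu r d])
  then obtain a where a: "\<And>i. (\<integral>x. cut (a i) (uX i) x \<partial>\<mu>) \<le> d i" by blast
  have "\<exists>b. \<forall>i. (\<integral>x. cut (b i) (uY i) x \<partial>\<nu>) \<le> d i"
    by (rule choice, rule allI, rule exists_small_cut[OF coercive_cont[OF uY] nu r d])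
  then obtain b where b: "\<And>i. (\<integral>x. cut (b i) (uY i) x \<partial>\<nu>) \<le> d i" by blast
  have "\<exists>c. \<forall>i. (\<integral>x. tail r undefined (c i) x \<partial>\<nu>) \<le> d i"
    by (rule choice, rule allI, rule exists_small_tail[OF nu r d])
  then obtain c where c: "\<And>i. (\<integral>x. tail r undefined (c i) x \<partial>\<nu>) \<le> d i" by blast
  show ?thesis
  proof (intro exI allI)
    fix J
    have i1: "integrable \<mu> (cut (a i) (uX i))" for i by (rule Phi_integrable[OF mu cut_Phi[OF coercive_cont[OF uX]] r])
    have i2: "integrable \<nu> (cut (b i) (uY i))" for i by (rule Phi_integrable[OF nu cut_Phi[OF coercive_cont[OF uY]] r])
    have i3: "integrable \<nu> (tail r undefined (c i))" for i by (rule Phi_integrable[OF nu tail_Phi[OF r] r])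
    have "L (\<lambda>x. \<Sum>i\<le>J. 2 ^ Suc i * cut (a i) (uX i) x) (\<lambda>y. \<Sum>i\<le>J. 2 ^ Suc i * (cut (b i) (uY i) y + tail r undefined (c i) y))
       = (\<Sum>i\<le>J. 2 ^ Suc i * ((\<integral>x. cut (a i) (uX i) x \<partial>\<mu>) + (\<integral>y. cut (b i) (uY i) y \<partial>\<nu>) + (\<integral>y. tail r undefined (c i) y \<partial>\<nu>)))"
      unfolding L_def using i1 i2 i3
      by (simp add: Bochner_Integration.integral_sum sum.distrib[symmetric] distrib_left add.assoc)
    also have "\<dots> \<le> (\<Sum>i\<le>J. 2 ^ Suc i * (e / 4 ^ Suc i))"
    proof (rule sum_mono, rule mult_left_mono)
      fix i
      have "3 * d i = e / 4 ^ Suc i" by (simp add: d_def)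
      then show "(\<integral>x. cut (a i) (uX i) x \<partial>\<mu>) + (\<integral>y. cut (b i) (uY i) y \<partial>\<nu>) + (\<integral>y. tail r undefined (c i) y \<partial>\<nu>) \<le> e / 4 ^ Suc i"
        using a[of i] b[of i] c[of i] by linarith
    qed simp
    also have "\<dots> \<le> e" by (rule sum_weights_le) (use e in simp)
    finally show "L (\<lambda>x. \<Sum>i\<le>J. 2 ^ Suc i * cut (a i) (uX i) x)
       (\<lambda>y. \<Sum>i\<le>J. 2 ^ Suc i * (cut (b i) (uY i) y + tail r undefined (c i) y)) \<le> e" .
  qed
qed

section \<open>The nonnegative cost and its approximation from below\<close>

definition cost_pos :: "'a \<times> 'b measure \<Rightarrow> ereal" where
  "cost_pos z = C (fst z) (snd z) + ereal (oplus \<phi>0 \<psi>0 z)"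

lemma cost_pos_nonneg: "z \<in> \<Omega> \<Longrightarrow> 0 \<le> cost_pos z"
  using low[of "snd z" "fst z"] unfolding cost_pos_def by (cases "C (fst z) (snd z)") (auto simp: \<Omega>_def)

lemma cost_pos_lsc:
  assumes ps: "\<And>n. ps n \<in> Pr r" and p: "p \<in> Pr r" and x: "xs \<longlonglongrightarrow> x" and c: "Phi_conv r ps p"
    and a: "\<forall>\<^sub>F n in sequentially. cost_pos (xs n, ps n) \<le> ereal a"
  shows "cost_pos (x, p) \<le> ereal a"
proof -
  have "(\<lambda>n. \<phi>0 (xs n)) \<longlonglongrightarrow> \<phi>0 x" by (rule continuous_on_tendsto_compose[OF Phi_cont[OF \<phi>0] x]) auto
  moreover have "(\<lambda>n. \<integral>y. \<psi>0 y \<partial>(ps n)) \<longlonglongrightarrow> (\<integral>y. \<psi>0 y \<partial>p)" using c \<psi>0 unfolding Phi_conv_def by (rule bspec)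
  ultimately have "(\<lambda>n. ereal (a - oplus \<phi>0 \<psi>0 (xs n, ps n))) \<longlonglongrightarrow> ereal (a - oplus \<phi>0 \<psi>0 (x, p))"
    unfolding oplus_def fst_conv snd_conv by (intro tendsto_intros)
  then have "liminf (\<lambda>n. ereal (a - oplus \<phi>0 \<psi>0 (xs n, ps n))) = ereal (a - oplus \<phi>0 \<psi>0 (x, p))"
    by (rule lim_imp_Liminf[OF sequentially_bot])
  moreover have "liminf (\<lambda>n. C (xs n) (ps n)) \<le> liminf (\<lambda>n. ereal (a - oplus \<phi>0 \<psi>0 (xs n, ps n)))"
  proof (rule Liminf_mono, use a in eventually_elim)
    fix n assume "cost_pos (xs n, ps n) \<le> ereal a"
    then show "C (xs n) (ps n) \<le> ereal (a - oplus \<phi>0 \<psi>0 (xs n, ps n))"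
      unfolding cost_pos_def by (cases "C (xs n) (ps n)") auto
  qed
  moreover have "C x p \<le> liminf (\<lambda>n. C (xs n) (ps n))" by (rule lsc_Wr_conv[OF lsc r ps p x c])
  ultimately have "C x p \<le> ereal (a - oplus \<phi>0 \<psi>0 (x, p))" by simp
  then show ?thesis unfolding cost_pos_def by (cases "C x p") auto
qed

text \<open>The approximations are the infimal convolutions of the truncated cost with \<open>n * dist\<close>, taken after embedding by \<open>stats\<close>.\<close>

lemma lower_approx:
  obtains f where "\<And>n. f n \<in> H" "\<And>n. f n \<in> borel_measurable kern" "\<And>n z. 0 \<le> f n z" "\<And>n z. z \<in> \<Omega> \<Longrightarrow> f n z \<le> f (Suc n) z"
    "\<And>n z. z \<in> \<Omega> \<Longrightarrow> ereal (f n z) \<le> cost_pos z"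
    "\<And>z a. z \<in> \<Omega> \<Longrightarrow> ereal a < cost_pos z \<Longrightarrow> \<exists>n. a \<le> f n z"
proof -
  obtain G :: "nat \<Rightarrow> 'b \<Rightarrow> real" where G: "lower_family G" by (rule lower_family_exists)
  define \<tau> where "\<tau> = (stats r undefined G :: 'a \<times> 'b measure \<Rightarrow> _)"
  have \<tau>m: "\<tau> \<in> measurable kern borel" unfolding \<tau>_def by (rule stats_measurable[OF G r])
  \<comment> \<open>On \<open>\<Omega>\<close> the minimum lies between 0 and \<open>n\<close>, so
    the conversion to a real loses nothing. The same index \<open>n\<close> serves as truncation
    level and as slope of the convolution.\<close>
  define b where "b n z = real_of_ereal (min (cost_pos z) (ereal (real n)))" for n :: nat and z
  have b: "0 \<le> b n z" "b n z \<le> real n" "ereal (b n z) = min (cost_pos z) (ereal (real n))" if "z \<in> \<Omega>" for n z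
  proof -
    have "\<bar>min (cost_pos z) (ereal (real n))\<bar> \<noteq> \<infinity>" using cost_pos_nonneg[OF that] by (cases "cost_pos z") (auto simp: min_def)
    then show e: "ereal (b n z) = min (cost_pos z) (ereal (real n))" unfolding b_def by (rule ereal_real')
    have "0 \<le> ereal (b n z)" unfolding e using cost_pos_nonneg[OF that] by simp
    then show "0 \<le> b n z" by simp
    have "ereal (b n z) \<le> ereal (real n)" unfolding e by simp
    then show "b n z \<le> real n" by simp
  qed
  have bmono: "b n z \<le> b (Suc n) z" if "z \<in> \<Omega>" for n z
  proof -
    have "ereal (b n z) \<le> ereal (b (Suc n) z)" unfolding b(3)[OF that] by (intro min.mono) simp_all
    then show ?thesis by simp
  qed
  have ne: "\<Omega> \<noteq> {}" using nu by (auto simp: \<Omega>_def)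
  define F where "F n \<zeta> = (INF z\<in>\<Omega>. b n z + real n * dist \<zeta> (\<tau> z))" for n :: nat and \<zeta>
  have bdd: "bdd_below ((\<lambda>z. b n z + real n * dist \<zeta> (\<tau> z)) ` \<Omega>)" for n \<zeta>
    by (rule bdd_belowI2[of _ 0]) (simp add: b)
  have Fle: "F n \<zeta> \<le> b n z + real n * dist \<zeta> (\<tau> z)" if "z \<in> \<Omega>" for n \<zeta> z
    unfolding F_def by (rule cINF_lower[OF bdd that])
  have F0: "0 \<le> F n \<zeta>" for n \<zeta> unfolding F_def by (rule cINF_greatest[OF ne]) (simp add: b)
  have Flip: "F n \<zeta> \<le> F n \<xi> + real n * dist \<zeta> \<xi>" for n \<zeta> \<xi>
  proof -
    have "F n \<zeta> - real n * dist \<zeta> \<xi> \<le> F n \<xi>"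
      unfolding F_def[of n \<xi>]
    proof (rule cINF_greatest[OF ne])
      fix z assume z: "z \<in> \<Omega>"
      have "real n * dist \<zeta> (\<tau> z) \<le> real n * (dist \<zeta> \<xi> + dist \<xi> (\<tau> z))" by (intro mult_left_mono dist_triangle) simp
      then show "F n \<zeta> - real n * dist \<zeta> \<xi> \<le> b n z + real n * dist \<xi> (\<tau> z)"
        using Fle[OF z, of n \<zeta>] by (simp add: distrib_left)
    qed
    then show ?thesis by simp
  qed
  have Fcont: "continuous_on UNIV (F n)" for n
  proof (rule lipschitz_on_continuous_on[of "real n"])
    show "(real n)-lipschitz_on UNIV (F n)"
    proof (rule lipschitz_onI)
      fix \<zeta> \<xi>
      show "dist (F n \<zeta>) (F n \<xi>) \<le> real n * dist \<zeta> \<xi>"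
        using Flip[of n \<zeta> \<xi>] Flip[of n \<xi> \<zeta>] by (simp add: dist_real_def dist_commute abs_le_iff)
    qed simp
  qed
  have Fb: "F n (\<tau> z) \<le> b n z" if "z \<in> \<Omega>" for n z using Fle[OF that, of n "\<tau> z"] by simp
  show thesis
  proof (rule that[of "\<lambda>n z. F n (\<tau> z)"])
    show "(\<lambda>z. F n (\<tau> z)) \<in> H" for n
    proof (rule H_I[of _ "real n"])
      show "\<bar>F n (\<tau> z)\<bar> \<le> real n" if "z \<in> \<Omega>" for z using F0[of n "\<tau> z"] Fb[OF that, of n] b(2)[OF that, of n] by simp
      fix xs :: "nat \<Rightarrow> 'a" and ps :: "nat \<Rightarrow> 'b measure" and p x assume "xs \<longlonglongrightarrow> x" "Phi_conv r ps p"
      then have "(\<lambda>n. \<tau> (xs n, ps n)) \<longlonglongrightarrow> \<tau> (x, p)" unfolding \<tau>_def by (rule conv_stats[OF G r])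
      then show "(\<lambda>m. F n (\<tau> (xs m, ps m))) \<longlonglongrightarrow> F n (\<tau> (x, p))"
        by (rule continuous_on_tendsto_compose[OF Fcont]) auto
    qed
    show "(\<lambda>z. F n (\<tau> z)) \<in> borel_measurable kern" for n
      by (rule measurable_compose[OF \<tau>m borel_measurable_continuous_onI[OF Fcont]])
    show "0 \<le> F n (\<tau> z)" for n z by (rule F0)
    show "F n (\<tau> z) \<le> F (Suc n) (\<tau> z)" if "z \<in> \<Omega>" for n z
      unfolding F_def[of "Suc n"]
    proof (rule cINF_greatest[OF ne])
      fix w assume w: "w \<in> \<Omega>"
      have "real n * dist (\<tau> z) (\<tau> w) \<le> real (Suc n) * dist (\<tau> z) (\<tau> w)" by (intro mult_right_mono) auto
      then show "F n (\<tau> z) \<le> b (Suc n) w + real (Suc n) * dist (\<tau> z) (\<tau> w)"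
        using Fle[OF w, of n "\<tau> z"] bmono[OF w, of n] by linarith
    qed
    show "ereal (F n (\<tau> z)) \<le> cost_pos z" if "z \<in> \<Omega>" for n z
    proof -
      have "ereal (F n (\<tau> z)) \<le> ereal (b n z)" using Fb[OF that] by simp
      then show ?thesis unfolding b(3)[OF that] by simp
    qed
    show "\<exists>n. a \<le> F n (\<tau> z)" if z: "z \<in> \<Omega>" and a: "ereal a < cost_pos z" for z a
    proof (rule ccontr)
      assume "\<nexists>n. a \<le> F n (\<tau> z)"
      then have less: "F n (\<tau> z) < a" for n by (meson not_le)
      have "\<exists>w\<in>\<Omega>. b n w + real n * dist (\<tau> z) (\<tau> w) < a" for n
        using less[of n] cINF_less_iff[OF ne bdd] unfolding F_def by blast
      \<comment> \<open>Near-minimisers of the convolution at \<open>z\<close>. The slope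
        \<open>n\<close> forces their images within \<open>a / n\<close> of the image of
        \<open>z\<close>, so they converge to \<open>z\<close> while their truncated costs stay
        below \<open>a\<close>, contrary to lower semicontinuity.\<close>
      then obtain w where w: "\<And>n. w n \<in> \<Omega>" "\<And>n. b n (w n) + real n * dist (\<tau> z) (\<tau> (w n)) < a" by metis
      have a0: "0 < a" using F0 less by (rule le_less_trans)
      have d: "dist (\<tau> (w n)) (\<tau> z) \<le> a * inverse (real n)" if "n > 0" for n
      proof -
        have "real n * dist (\<tau> z) (\<tau> (w n)) \<le> a" using w(2)[of n] b(1)[OF w(1), of n n] by linarith
        then show ?thesis using that by (simp add: field_simps dist_commute)
      qed
      have "(\<lambda>n. \<tau> (w n)) \<longlonglongrightarrow> \<tau> z"
      proof (rule metric_tendsto_imp_tendsto)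
        have "(\<lambda>n. a * inverse (real n)) \<longlonglongrightarrow> a * 0" by (intro tendsto_intros lim_inverse_n)
        then show "(\<lambda>n. a * inverse (real n)) \<longlonglongrightarrow> 0" by simp
        show "\<forall>\<^sub>F n in sequentially. dist (\<tau> (w n)) (\<tau> z) \<le> dist (a * inverse (real n)) 0"
          using eventually_gt_at_top[of 0]
        proof eventually_elim
          case (elim n)
          then show ?case using d[of n] a0 by (simp add: dist_real_def)
        qed
      qed
      then have conv: "(\<lambda>n. stats r undefined G (fst (w n), snd (w n))) \<longlonglongrightarrow> stats r undefined G (fst z, snd z)"
        by (simp add: \<tau>_def)
      have ps: "snd (w n) \<in> Pr r" for n using w(1)[of n] by (auto simp: \<Omega>_def)
      have p: "snd z \<in> Pr r" using z by (auto simp: \<Omega>_def)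
      note sc = stats_conv[OF G r ps p conv]
      have "cost_pos (fst z, snd z) \<le> ereal a"
      proof (rule cost_pos_lsc[OF ps p sc])
        \<comment> \<open>From \<open>n \<ge> a\<close> on the truncation is inactive below
          \<open>a\<close>, so the bound on \<open>b n\<close> becomes one on
          \<open>cost_pos\<close>.\<close>
        obtain n0 :: nat where n0: "a \<le> real n0" using real_arch_simple by blast
        show "\<forall>\<^sub>F n in sequentially. cost_pos (fst (w n), snd (w n)) \<le> ereal a"
          using eventually_ge_at_top[of n0]
        proof eventually_elim
          case (elim n)
          have "0 \<le> real n * dist (\<tau> z) (\<tau> (w n))" by simp
          then have "b n (w n) < a" using w(2)[of n] by linarith
          then have "min (cost_pos (w n)) (ereal (real n)) < ereal a" unfolding b(3)[OF w(1), symmetric] by simp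
          moreover have "ereal a \<le> ereal (real n)" using n0 elim by simp
          ultimately show ?case by (auto simp: min_def split: if_splits)
        qed
      qed
      with a show False by simp
    qed
  qed
qed

text \<open>Restricted to \<open>H\<close>, the extended functional is integration against some
  \<open>P\<close>. Its values on \<open>oplus\<close> fix the marginals, and its bound
  \<open>D\<close> below the cost passes to the integral of the cost by monotone
  convergence.\<close>

theorem primal_attains:
  obtains P where "P \<in> Lambda \<mu> \<nu>" "ext_integral (completion P) (\<lambda>z. C (fst z) (snd z)) \<le> ereal D"
proof (rule extension)
  fix l assume lU: "\<And>f. f \<in> V \<Longrightarrow> l f \<le> U f"
    and l_add: "\<And>f g. f \<in> V \<Longrightarrow> g \<in> V \<Longrightarrow> l (\<lambda>x. f x + g x) = l f + l g"
    and l_scale: "\<And>c f. f \<in> V \<Longrightarrow> l (\<lambda>x. c * f x) = c * l f"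
  have l_diff: "l (\<lambda>x. f x - g x) = l f - l g" if "f \<in> V" "g \<in> V" for f g
    using l_add[OF that(1) V_scale[OF that(2), of "-1"]] l_scale[OF that(2), of "-1"] by simp
  have V_diff: "(\<lambda>x. f x - g x) \<in> V" if "f \<in> V" "g \<in> V" for f g
    using V_add[OF that(1) V_scale[OF that(2), of "-1"]] by simp
  have l_le: "l f \<le> L \<phi> \<psi>" if "f \<in> V" "\<phi> \<in> Phi r" "\<psi> \<in> Phi r" "\<And>z. z \<in> \<Omega> \<Longrightarrow> f z \<le> oplus \<phi> \<psi> z" for f \<phi> \<psi>
  proof -
    have "L \<phi> \<psi> + 0 * D \<in> S f" by (rule S_I[OF that(2,3)]) (use that(4) in \<open>auto simp flip: zero_ereal_def\<close>)
    from U_le[OF that(1) this] lU[OF that(1)] show ?thesis by simp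
  qed
  \<comment> \<open>The upper bound \<open>L\<close> holds for \<open>oplus \<phi> \<psi>\<close>
    and for its negative, so linearity gives equality.\<close>
  have l_oplus: "l (oplus \<phi> \<psi>) = L \<phi> \<psi>" if "\<phi> \<in> Phi r" "\<psi> \<in> Phi r" for \<phi> \<psi>
  proof (rule antisym)
    show "l (oplus \<phi> \<psi>) \<le> L \<phi> \<psi>" by (rule l_le[OF oplus_bound[OF that] that]) simp
    have "l (\<lambda>z. (-1) * oplus \<phi> \<psi> z) \<le> L (\<lambda>x. (-1) * \<phi> x) (\<lambda>y. (-1) * \<psi> y)"
      by (rule l_le[OF V_scale[OF oplus_bound[OF that]] Phi_scale'[OF that(1)] Phi_scale'[OF that(2)]]) (simp only: oplus_scale order_refl)
    then have "(-1) * l (oplus \<phi> \<psi>) \<le> (-1) * L \<phi> \<psi>" by (simp only: L_scale l_scale[OF oplus_bound[OF that]])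
    then show "L \<phi> \<psi> \<le> l (oplus \<phi> \<psi>)" by simp
  qed
  have L0: "L (\<lambda>_. 0) (\<lambda>_. 0) = 0" by (simp add: L_def)
  have l_mono: "l f \<le> l g" if "f \<in> V" "g \<in> V" "\<And>z. z \<in> \<Omega> \<Longrightarrow> f z \<le> g z" for f g
  proof -
    have "l (\<lambda>z. f z - g z) \<le> L (\<lambda>_. 0) (\<lambda>_. 0)"
      by (rule l_le[OF V_diff[OF that(1,2)] Phi_const Phi_const]) (use that(3) in \<open>simp add: oplus_def\<close>)
    then show ?thesis using l_diff[OF that(1,2)] L0 by simp
  qed
  \<comment> \<open>The choice \<open>t = 1\<close> with both functions zero: this is where the
    multiples of the cost in \<open>S\<close> are used.\<close>
  have l_cost: "l f \<le> D" if "f \<in> V" "\<And>z. z \<in> \<Omega> \<Longrightarrow> ereal (f z) \<le> C (fst z) (snd z)" for f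
  proof -
    have "L (\<lambda>_. 0) (\<lambda>_. 0) + 1 * D \<in> S f"
      by (rule S_I[OF Phi_const Phi_const]) (use that(2) in \<open>simp_all add: oplus_def flip: zero_ereal_def one_ereal_def\<close>)
    from U_le[OF that(1) this] lU[OF that(1)] show ?thesis using L0 by simp
  qed
  interpret M: prob_space \<mu> by (rule Pr_prob[OF mu])
  have oneV: "(\<lambda>_. 1) \<in> V" by (rule V_I[OF Phi_const[of 1] Phi_const[of 0]]) (simp add: oplus_def)
  have l_one: "l (\<lambda>_. 1) = 1"
    using l_oplus[OF Phi_const[of 1] Phi_const[of 0]] by (simp add: oplus_def[abs_def] L_def M.prob_space)
  have dan: "daniell \<Omega> H l"
  proof
    fix f g assume f: "f \<in> H" and g: "g \<in> H"
    obtain c where c: "\<And>z. z \<in> \<Omega> \<Longrightarrow> \<bar>f z\<bar> \<le> c" using H_bounded[OF f] by blast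
    obtain d where d: "\<And>z. z \<in> \<Omega> \<Longrightarrow> \<bar>g z\<bar> \<le> d" using H_bounded[OF g] by blast
    show "(\<lambda>x. f x + g x) \<in> H"
    proof (rule H_I[of _ "c + d"])
      show "\<bar>f z + g z\<bar> \<le> c + d" if "z \<in> \<Omega>" for z using c[OF that] d[OF that] by linarith
    qed (intro tendsto_add H_tendsto[OF f] H_tendsto[OF g]; assumption)
    show "(\<lambda>x. max (f x) (g x)) \<in> H"
    proof (rule H_I[of _ "max c d"])
      show "\<bar>max (f z) (g z)\<bar> \<le> max c d" if "z \<in> \<Omega>" for z using c[OF that] d[OF that] by (simp add: max_def abs_le_iff)
    qed (intro tendsto_max H_tendsto[OF f] H_tendsto[OF g]; assumption)
    show "l (\<lambda>x. f x + g x) = l f + l g" by (rule l_add[OF H_V[OF f] H_V[OF g]])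
  next
    fix f and a :: real assume f: "f \<in> H"
    obtain c where c: "\<And>z. z \<in> \<Omega> \<Longrightarrow> \<bar>f z\<bar> \<le> c" using H_bounded[OF f] by blast
    show "(\<lambda>x. a * f x) \<in> H"
    proof (rule H_I[of _ "\<bar>a\<bar> * c"])
      show "\<bar>a * f z\<bar> \<le> \<bar>a\<bar> * c" if "z \<in> \<Omega>" for z using c[OF that] by (simp add: abs_mult mult_left_mono)
    qed (intro tendsto_mult_left H_tendsto[OF f]; assumption)
    show "l (\<lambda>x. a * f x) = a * l f" by (rule l_scale[OF H_V[OF f]])
    show "\<exists>c. \<forall>x\<in>\<Omega>. \<bar>f x\<bar> \<le> c" by (rule H_bounded[OF f])
    show "0 \<le> l f" if "\<And>x. x \<in> \<Omega> \<Longrightarrow> 0 \<le> f x"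
    proof -
      have "l (\<lambda>z. 0 * f z) \<le> l f" by (rule l_mono[OF V_scale[OF H_V[OF f]] H_V[OF f]]) (use that in simp)
      then show ?thesis using l_scale[OF H_V[OF f], of 0] by simp
    qed
  next
    show "(\<lambda>_. 1) \<in> H" by (rule H_I[of _ 1]) auto
    show "l (\<lambda>_. 1) = 1" by (rule l_one)
  next
    fix f :: "nat \<Rightarrow> 'a \<times> 'b measure \<Rightarrow> real"
    assume fH: "\<And>n. f n \<in> H" and dec: "\<And>n x. x \<in> \<Omega> \<Longrightarrow> f (Suc n) x \<le> f n x"
      and f0: "\<And>n x. x \<in> \<Omega> \<Longrightarrow> 0 \<le> f n x" and lim: "\<And>x. x \<in> \<Omega> \<Longrightarrow> (\<lambda>n. f n x) \<longlonglongrightarrow> 0"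
    obtain c where c: "\<And>x. x \<in> \<Omega> \<Longrightarrow> \<bar>f 0 x\<bar> \<le> c" using H_bounded[OF fH] by blast
    show "(\<lambda>n. l (f n)) \<longlonglongrightarrow> 0"
    proof (rule vanishing_on_tight[where V=V and \<Omega>=\<Omega> and c=c and l=l and f=f])
      fix e :: real assume e: "e > 0"
      obtain a b d where w: "\<And>J. L (\<lambda>x. \<Sum>i\<le>J. 2 ^ Suc i * cut (a i) (uX i) x)
         (\<lambda>y. \<Sum>i\<le>J. 2 ^ Suc i * (cut (b i) (uY i) y + tail r undefined (d i) y)) \<le> e"
        using weight_small[OF e] by blast
      have wV: "weight a b d J \<in> V" for J unfolding weight_def by (rule oplus_bound[OF weight_Phi])
      have we: "l (weight a b d J) \<le> e" for J unfolding weight_def l_oplus[OF weight_Phi] by (rule w)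
      have w0: "0 \<le> weight a b d J z" for J z
        unfolding weight_def oplus_def
        by (intro add_nonneg_nonneg sum_nonneg mult_nonneg_nonneg Bochner_Integration.integral_nonneg cut_range tail_nonneg) simp_all
      have sq: "\<exists>k x. strict_mono k \<and> x \<in> \<Omega> \<and> (\<forall>m. (\<lambda>n. f m (t (k n))) \<longlonglongrightarrow> f m x)"
        if t: "\<forall>n. t n \<in> \<Omega> \<and> weight a b d n (t n) \<le> 1" for t :: "nat \<Rightarrow> 'a \<times> 'b measure"
      proof -
        obtain k x p where k: "strict_mono (k :: nat \<Rightarrow> nat)" "p \<in> Pr r" "(\<lambda>n. fst (t (k n))) \<longlonglongrightarrow> x" "Phi_conv r (\<lambda>n. snd (t (k n))) p"
          by (rule weight_compact[of t a b d]) (use t in blast)+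
        have ps: "snd (t n) \<in> Pr r" for n using t by (auto simp: \<Omega>_def mem_Times_iff)
        have "(\<lambda>n. f m (fst (t (k n)), snd (t (k n)))) \<longlonglongrightarrow> f m (x, p)" for m
          by (rule H_tendsto[OF fH ps k(2,3,4)])
        then show ?thesis using k(1,2) by (intro exI[of _ k] exI[of _ "(x, p)"]) (simp add: \<Omega>_def)
      qed
      show "\<exists>w. (\<forall>J. w J \<in> V \<and> l (w J) \<le> e \<and> (\<forall>x\<in>\<Omega>. 0 \<le> w J x)) \<and>
         (\<forall>s :: nat \<Rightarrow> 'a \<times> 'b measure. (\<forall>n. s n \<in> \<Omega> \<and> w n (s n) \<le> 1) \<longrightarrow>
            (\<exists>k x. strict_mono k \<and> x \<in> \<Omega> \<and> (\<forall>m. (\<lambda>n. f m (s (k n))) \<longlonglongrightarrow> f m x)))"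
      proof (rule exI[of _ "weight a b d"], intro conjI allI impI)
        show "weight a b d J \<in> V" "l (weight a b d J) \<le> e" "\<forall>x\<in>\<Omega>. 0 \<le> weight a b d J x" for J using wV we w0 by auto
      qed (rule sq)
    next
      show "f 0 x \<le> c" if "x \<in> \<Omega>" for x using c[OF that] by (simp add: abs_le_iff)
    qed (fact V_add V_scale oneV l_add l_scale l_mono l_one H_V[OF fH] dec f0 lim)+
  qed
  obtain m where m: "prob_space m" "space m = \<Omega>" "\<And>f. f \<in> H \<Longrightarrow> f \<in> borel_measurable m"
    "\<And>f. f \<in> H \<Longrightarrow> integral\<^sup>L m f = l f"
    using daniell_stone[OF dan] by metis
  \<comment> \<open>The sigma-algebra of \<open>m\<close> is given through \<open>H\<close> alone.
    Functions of the first component detect open sets of \<open>X\<close>; integrals of bounded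
    continuous functions, which approximate masses of open sets, detect the second
    component.\<close>
  have fm: "fst \<in> measurable m borel"
  proof (rule borel_measurableI)
    fix W :: "'a set" assume "open W"
    then obtain h :: "'a \<Rightarrow> real" where h: "continuous_on UNIV h" "\<And>x. 0 \<le> h x" "\<And>x. h x \<le> 1" "W = {x. 0 < h x}"
      using open_eq_pos[of W] by metis
    have "(\<lambda>z. h (fst z)) \<in> H" by (rule H_fst[OF h(1), of 1]) (use h in \<open>simp add: abs_of_nonneg\<close>)
    then have "(\<lambda>z. h (fst z)) \<in> borel_measurable m" by (rule m(3))
    then have "{z \<in> space m. 0 < h (fst z)} \<in> sets m" by measurable
    moreover have "fst -` W \<inter> space m = {z \<in> space m. 0 < h (fst z)}" by (auto simp: h(4))
    ultimately show "fst -` W \<inter> space m \<in> sets m" by simp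
  qed
  have sm: "snd \<in> measurable m (prob_algebra borel)"
  proof (rule measurable_prob_algebra_generated[where \<Omega> = UNIV and G = "{W. open W}"])
    have z: "snd z \<in> Pr r" if "z \<in> space m" for z using that unfolding m(2) \<Omega>_def by (simp add: mem_Times_iff)
    show "prob_space (snd z)" "sets (snd z) = sets borel" if "z \<in> space m" for z
      using Pr_prob[OF z[OF that]] Pr_sets[OF z[OF that]] by auto
    fix W :: "'b set" assume "W \<in> {W. open W}"
    then have W: "open W" by simp
    then obtain f :: "nat \<Rightarrow> 'b \<Rightarrow> real" where f: "\<And>k. f k \<in> Cb" "\<And>k x. 0 \<le> f k x" "\<And>k x. f k x \<le> 1"
      "\<And>x. (\<lambda>k. f k x) \<longlonglongrightarrow> indicator W x" by (rule open_approx) blast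
    have "(\<lambda>z. measure (snd z) W) \<in> borel_measurable m"
    proof (rule borel_measurable_LIMSEQ_real)
      show "(\<lambda>k. \<integral>y. f k y \<partial>(snd z)) \<longlonglongrightarrow> measure (snd z) W" if "z \<in> space m" for z
        by (rule integral_open_approx[OF Pr_prob[OF z[OF that]] Pr_sets[OF z[OF that]] W f])
      show "(\<lambda>z. \<integral>y. f k y \<partial>(snd z)) \<in> borel_measurable m" for k by (rule m(3)[OF H_snd[OF f(1)]])
    qed
    then have "(\<lambda>z. ennreal (measure (snd z) W)) \<in> borel_measurable m" by measurable
    moreover have "emeasure (snd z) W = ennreal (measure (snd z) W)" if "z \<in> space m" for z
    proof -
      interpret prob_space "snd z" by (rule Pr_prob[OF z[OF that]])
      show ?thesis by (rule emeasure_eq_measure)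
    qed
    ultimately show "(\<lambda>z. emeasure (snd z) W) \<in> borel_measurable m" by (simp cong: measurable_cong)
  qed (auto simp: borel_def Int_stable_def)
  have idm: "(\<lambda>z. z) \<in> measurable m kern"
  proof -
    have "(\<lambda>z. (fst z, snd z)) \<in> measurable m kern" by (rule measurable_Pair[OF fm sm])
    then show ?thesis by simp
  qed
  define P where "P = distr m kern (\<lambda>z. z)"
  have pP: "prob_space P" unfolding P_def by (rule prob_space.prob_space_distr[OF m(1) idm])
  have sP: "sets P = sets kern" by (simp add: P_def)
  have spP: "space P = space kern" by (rule sets_eq_imp_space_eq[OF sP])
  have int: "integral\<^sup>L P f = l f" if "f \<in> H" "f \<in> borel_measurable kern" for f
    unfolding P_def using integral_distr[OF idm that(2)] m(4)[OF that(1)] by simp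
  have PL: "P \<in> Lambda \<mu> \<nu>" unfolding Lambda_def
  proof (intro CollectI conjI ballI)
    show "prob_space P" by (rule pP)
    show "sets P = sets (borel \<Otimes>\<^sub>M prob_algebra borel)" by (rule sP)
    fix g :: "'a \<Rightarrow> real" assume g: "g \<in> Cb"
    obtain c where c: "continuous_on UNIV g" "\<And>x. \<bar>g x\<bar> \<le> c" using Cb_D[OF g] by metis
    have gm: "g \<in> borel_measurable borel" by (rule borel_measurable_continuous_onI[OF c(1)])
    have "intensity P (\<lambda>(x, y). g x) = (\<integral>z. g (fst z) \<partial>P)"
      unfolding intensity_def by (rule Bochner_Integration.integral_cong) (auto simp: spP space_kern prob_space.prob_space)
    also have "\<dots> = l (\<lambda>z. g (fst z))"
      by (rule int[OF H_fst[OF c]]) (rule measurable_compose[OF measurable_fst gm])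
    also have "\<dots> = L g (\<lambda>_. 0)"
      using l_oplus[OF Cb_Phi[OF g] Phi_const[of 0]] by (simp add: oplus_def[abs_def])
    finally show "intensity P (\<lambda>(x, y). g x) = (\<integral>x. g x \<partial>\<mu>)" by (simp add: L_def)
  next
    fix h :: "'b \<Rightarrow> real" assume h: "h \<in> Cb"
    have "intensity P (\<lambda>(x, y). h y) = (\<integral>z. (\<integral>y. h y \<partial>(snd z)) \<partial>P)" by (simp add: intensity_def)
    also have "\<dots> = l (\<lambda>z. \<integral>y. h y \<partial>(snd z))"
      by (rule int[OF H_snd[OF h]]) (rule integral_kern_measurable[OF Phi_measurable[OF Cb_Phi[OF h] refl]])
    also have "\<dots> = L (\<lambda>_. 0) h"
      using l_oplus[OF Phi_const[of 0] Cb_Phi[OF h]] by (simp add: oplus_def[abs_def])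
    finally show "intensity P (\<lambda>(x, y). h y) = (\<integral>y. h y \<partial>\<nu>)" by (simp add: L_def)
  qed
  obtain f where f: "\<And>n. f n \<in> H" "\<And>n. f n \<in> borel_measurable kern" "\<And>n z. 0 \<le> f n z" "\<And>n z. z \<in> \<Omega> \<Longrightarrow> f n z \<le> f (Suc n) z"
    "\<And>n z. z \<in> \<Omega> \<Longrightarrow> ereal (f n z) \<le> cost_pos z"
    "\<And>z a. z \<in> \<Omega> \<Longrightarrow> ereal a < cost_pos z \<Longrightarrow> \<exists>n. a \<le> f n z"
    using lower_approx by metis
  \<comment> \<open>\<open>f n - oplus \<phi>0 \<psi>0\<close> lies below \<open>C\<close> but may
    be unbounded, so the estimate is made for \<open>l\<close> on \<open>V\<close>; only
    \<open>f n\<close> is then converted to an integral.\<close>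
  have lf: "l (f n) \<le> D + L \<phi>0 \<psi>0" for n
  proof -
    have "l (\<lambda>z. f n z - oplus \<phi>0 \<psi>0 z) \<le> D"
    proof (rule l_cost[OF V_diff[OF H_V[OF f(1)] oplus_bound[OF \<phi>0 \<psi>0]]])
      fix z assume z: "z \<in> \<Omega>"
      show "ereal (f n z - oplus \<phi>0 \<psi>0 z) \<le> C (fst z) (snd z)"
        using f(5)[OF z, of n] unfolding cost_pos_def by (cases "C (fst z) (snd z)") auto
    qed
    then show ?thesis using l_diff[OF H_V[OF f(1)] oplus_bound[OF \<phi>0 \<psi>0]] l_oplus[OF \<phi>0 \<psi>0] by simp
  qed
  note AES = Lambda_Pr[OF PL mu nu r, folded \<Omega>_def]
  have sup: "e2ennreal (cost_pos z) = (SUP n. ennreal (f n z))" if z: "z \<in> \<Omega>" for z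
  proof (rule antisym)
    show "(SUP n. ennreal (f n z)) \<le> e2ennreal (cost_pos z)"
    proof (rule SUP_least)
      fix n show "ennreal (f n z) \<le> e2ennreal (cost_pos z)" using e2ennreal_mono[OF f(5)[OF z, of n]] by simp
    qed
    show "e2ennreal (cost_pos z) \<le> (SUP n. ennreal (f n z))"
    proof (rule dense_le)
      fix y assume y: "y < e2ennreal (cost_pos z)"
      then obtain a where a: "y = ennreal a" "a \<ge> 0" by (cases y) auto
      have "ereal a < cost_pos z"
      proof (rule ccontr)
        assume "\<not> ereal a < cost_pos z"
        then have "e2ennreal (cost_pos z) \<le> e2ennreal (ereal a)" by (intro e2ennreal_mono) simp
        then show False using y a by simp
      qed
      then obtain n where "a \<le> f n z" using f(6)[OF z] by blast
      then show "y \<le> (SUP n. ennreal (f n z))" unfolding a(1) by (intro SUP_upper2[of n]) (auto intro: ennreal_leI)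
    qed
  qed
  interpret PP: prob_space P by (rule pP)
  have fP: "f n \<in> borel_measurable P" for n using f(2)[of n] measurable_cong_sets[OF sP refl] by blast
  have fi: "integrable P (f n)" for n
  proof -
    obtain c where c: "\<And>z. z \<in> \<Omega> \<Longrightarrow> \<bar>f n z\<bar> \<le> c" using H_bounded[OF f(1)] by blast
    show ?thesis by (rule PP.integrable_const_bound[of _ c, OF _ fP]) (use AES in eventually_elim, use c in simp)
  qed
  have "(\<integral>\<^sup>+ z. e2ennreal (cost_pos z) \<partial>P) = (\<integral>\<^sup>+ z. (SUP n. ennreal (f n z)) \<partial>P)"
    using AES by (intro nn_integral_cong_AE, eventually_elim) (rule sup)
  also have "\<dots> = (SUP n. (\<integral>\<^sup>+ z. ennreal (f n z) \<partial>P))"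
  proof (rule nn_integral_monotone_convergence_SUP_AE)
    show "AE z in P. ennreal (f n z) \<le> ennreal (f (Suc n) z)" for n
      using AES by eventually_elim (intro ennreal_leI f(4))
    show "(\<lambda>z. ennreal (f n z)) \<in> borel_measurable P" for n using fP by measurable
  qed
  also have "\<dots> \<le> ennreal (D + L \<phi>0 \<psi>0)"
  proof (rule SUP_least)
    fix n
    have "(\<integral>\<^sup>+ z. ennreal (f n z) \<partial>P) = ennreal (\<integral>z. f n z \<partial>P)" by (rule nn_integral_eq_integral[OF fi]) (simp add: f(3))
    also have "\<dots> \<le> ennreal (D + L \<phi>0 \<psi>0)" using lf[of n] by (simp add: int[OF f(1,2)] ennreal_leI)
    finally show "(\<integral>\<^sup>+ z. ennreal (f n z) \<partial>P) \<le> ennreal (D + L \<phi>0 \<psi>0)" .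
  qed
  finally have bound: "(\<integral>\<^sup>+ z. e2ennreal (cost_pos z) \<partial>completion P) \<le> ennreal (D + L \<phi>0 \<psi>0)"
    by (simp add: nn_integral_completion)
  have DL0: "0 \<le> D + L \<phi>0 \<psi>0"
  proof -
    have "0 \<le> integral\<^sup>L P (f 0)" using f(3) by simp
    then show ?thesis using lf[of 0] int[OF f(1,2), of 0] by simp
  qed
  let ?C = "\<lambda>z. C (fst z) (snd z)" and ?w = "oplus \<phi>0 \<psi>0"
  have wi: "integrable (completion P) ?w" "(\<integral>z. ?w z \<partial>completion P) = L \<phi>0 \<psi>0"
    using Lambda_sum_integral[OF PL mu nu r \<phi>0 \<psi>0] unfolding oplus_def[abs_def] L_def
    by (simp_all add: integrable_completion integral_completion borel_measurable_integrable)
  have Cm: "?C \<in> borel_measurable (completion P)" by (rule cost_measurable[OF PL mu nu r lsc])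
  have wm: "?w \<in> borel_measurable (completion P)" by (rule borel_measurable_integrable[OF wi(1)])
  have pm: "cost_pos \<in> borel_measurable (completion P)"
    unfolding cost_pos_def[abs_def] using Cm wm by measurable
  have nw: "integrable (completion P) (\<lambda>z. - ?w z)" using wi(1) by simp
  have Cfin: "(\<integral>\<^sup>+ z. e2ennreal (- ?C z) \<partial>completion P) < \<infinity>"
  proof (rule nn_integral_negpart_finite[OF nw], rule AE_completion, use AES in eventually_elim)
    fix z assume "z \<in> \<Omega>"
    then show "ereal (- ?w z) \<le> C (fst z) (snd z)" using low[of "snd z" "fst z"] by (auto simp: \<Omega>_def)
  qed
  have pz: "(\<integral>\<^sup>+ z. e2ennreal (- cost_pos z) \<partial>completion P) = 0"
  proof -
    have "(\<integral>\<^sup>+ z. e2ennreal (- cost_pos z) \<partial>completion P) = (\<integral>\<^sup>+ z. 0 \<partial>completion P)"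
    proof (rule nn_integral_cong_AE, rule AE_completion, use AES in eventually_elim)
      fix z assume "z \<in> \<Omega>"
      from cost_pos_nonneg[OF this] show "e2ennreal (- cost_pos z) = 0" by (intro e2ennreal_neg) simp
    qed
    then show ?thesis by simp
  qed
  \<comment> \<open>The equality of \<open>cost_pos\<close> with
    \<open>C + oplus \<phi>0 \<psi>0\<close>, read as an inequality, takes the shift out of the
    integral; the same constant was added to \<open>D\<close>.\<close>
  have "ereal (L \<phi>0 \<psi>0) + ext_integral (completion P) ?C
     \<le> enn2ereal (\<integral>\<^sup>+ z. e2ennreal (cost_pos z) \<partial>completion P) - enn2ereal (\<integral>\<^sup>+ z. e2ennreal (- cost_pos z) \<partial>completion P)"
    unfolding ext_integral_eq[OF Cm Cfin] wi(2)[symmetric]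
    by (rule ext_compare[OF pm Cm wi(1) _ _ Cfin]) (simp add: cost_pos_def, simp add: pz)
  also have "\<dots> = enn2ereal (\<integral>\<^sup>+ z. e2ennreal (cost_pos z) \<partial>completion P)" by (simp add: pz zero_ennreal.rep_eq)
  also have "\<dots> \<le> enn2ereal (ennreal (D + L \<phi>0 \<psi>0))" using bound by (simp add: less_eq_ennreal.rep_eq)
  also have "\<dots> = ereal (D + L \<phi>0 \<psi>0)" using DL0 by (simp add: enn2ereal_ennreal)
  finally have "ext_integral (completion P) ?C \<le> ereal D" by (cases "ext_integral (completion P) ?C") auto
  then show thesis using that PL by blast
qed

end

section \<open>The three values compared in a cycle\<close>

theorem theorem3p4:
  fixes r :: real
    and \<mu> :: "('a::{metric_space, second_countable_topology}) measure"
    and \<nu> :: "('b::{metric_space, second_countable_topology}) measure"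
    and C :: "'a \<Rightarrow> 'b measure \<Rightarrow> ereal"
    and K :: real and x0 :: 'a and y0 :: 'b
  assumes polishX: "completely_metrizable_space (euclidean :: 'a topology)"
    and polishY: "completely_metrizable_space (euclidean :: 'b topology)"
    and r: "r \<ge> 1"
    and mu: "\<mu> \<in> Pr r" and nu: "\<nu> \<in> Pr r"
    and lsc: "lsc_Wr r C"
    and K: "K > 0"
    and lower: "\<forall>x. \<forall>p\<in>Pr r.
        C x p \<ge> - ereal (K * (1 + dist x x0 powr r + wasserstein r p (return borel y0) powr r))"
  shows "((INF P\<in>Lambda \<mu> \<nu>. ext_integral (completion P) (\<lambda>z. C (fst z) (snd z)))
           = (SUP \<psi>\<in>Phi r. ereal (\<integral>y. \<psi> y \<partial>\<nu>) + ext_integral (completion \<mu>) (RC r C \<psi>))) \<and>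
       ((SUP \<psi>\<in>Phi r. ereal (\<integral>y. \<psi> y \<partial>\<nu>) + ext_integral (completion \<mu>) (RC r C \<psi>))
           = Sup {ereal ((\<integral>y. \<psi> y \<partial>\<nu>) + (\<integral>x. \<phi> x \<partial>\<mu>)) | \<phi> \<psi>.
                   \<phi> \<in> Phi r \<and> \<psi> \<in> Phi r \<and>
                   (\<forall>x. \<forall>p\<in>Pr r. ereal (\<phi> x + (\<integral>y. \<psi> y \<partial>p)) \<le> C x p)})"
    (is "?inf = ?mid \<and> _ = Sup ?T")
proof -
  have r0: "r > 0" using r by simp
  obtain uX :: "nat \<Rightarrow> 'a \<Rightarrow> real" where uX: "coercive uX" by (rule coercive_exists[OF polishX])
  obtain uY :: "nat \<Rightarrow> 'b \<Rightarrow> real" where uY: "coercive uY" by (rule coercive_exists[OF polishY])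
  define \<phi>0 where "\<phi>0 x = K * (1 + dist x x0 powr r)" for x :: 'a
  define \<psi>0 where "\<psi>0 y = K * dist y y0 powr r" for y :: 'b
  have \<phi>0: "\<phi>0 \<in> Phi r" unfolding \<phi>0_def by (intro Phi_scale Phi_add Phi_const Phi_dist r0)
  have \<psi>0: "\<psi>0 \<in> Phi r" unfolding \<psi>0_def by (intro Phi_scale Phi_dist r0)
  have low: "ereal (- oplus \<phi>0 \<psi>0 (x, p)) \<le> C x p" if p: "p \<in> Pr r" for x p
  proof -
    have "K * wasserstein r p (return borel y0) powr r \<le> K * (\<integral>y. dist y y0 powr r \<partial>p)"
      using wasserstein_return_le[OF p r0] K by (intro mult_left_mono) auto
    then have "K * (1 + dist x x0 powr r + wasserstein r p (return borel y0) powr r) \<le> oplus \<phi>0 \<psi>0 (x, p)"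
      by (simp add: oplus_def \<phi>0_def \<psi>0_def distrib_left)
    then have "ereal (- oplus \<phi>0 \<psi>0 (x, p)) \<le> - ereal (K * (1 + dist x x0 powr r + wasserstein r p (return borel y0) powr r))"
      by simp
    also have "\<dots> \<le> C x p" using lower p by blast
    finally show ?thesis .
  qed
  have low': "ereal (- \<phi>0 x + (\<integral>y. - \<psi>0 y \<partial>p)) \<le> C x p" if "p \<in> Pr r" for x p
    using low[OF that, of x] by (simp add: oplus_def)
  \<comment> \<open>Weak duality opens the cycle \<open>?mid \<le> ?inf\<close>,
    \<open>Sup ?T \<le> ?mid\<close>, \<open>?inf \<le> Sup ?T\<close>, which gives both equalities
    at once.\<close>
  have "?mid \<le> ?inf"
  proof (rule SUP_least, rule INF_greatest)
    fix \<psi> :: "'b \<Rightarrow> real" and P assume "\<psi> \<in> Phi r" "P \<in> Lambda \<mu> \<nu>"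
    then show "ereal (\<integral>y. \<psi> y \<partial>\<nu>) + ext_integral (completion \<mu>) (RC r C \<psi>) \<le> ext_integral (completion P) (\<lambda>z. C (fst z) (snd z))"
      using weak_duality[OF uY _ mu nu r0 lsc Phi_minus[OF \<phi>0 r0] Phi_minus[OF \<psi>0 r0] low'] by blast
  qed
  moreover have "Sup ?T \<le> ?mid"
  proof (rule Sup_least)
    fix v assume "v \<in> ?T"
    then obtain \<phi> \<psi> where v: "v = ereal ((\<integral>y. \<psi> y \<partial>\<nu>) + (\<integral>x. \<phi> x \<partial>\<mu>))" and \<phi>: "\<phi> \<in> Phi r" and \<psi>: "\<psi> \<in> Phi r"
      and le: "\<And>x p. p \<in> Pr r \<Longrightarrow> ereal (\<phi> x + (\<integral>y. \<psi> y \<partial>p)) \<le> C x p" by blast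
    have R: "ereal (\<phi> x) \<le> RC r C \<psi> x" for x unfolding RC_def
    proof (rule INF_greatest)
      fix p :: "'b measure" assume "p \<in> Pr r"
      from le[OF this, of x] show "ereal (\<phi> x) \<le> - ereal (\<integral>y. \<psi> y \<partial>p) + C x p" by (cases "C x p") auto
    qed
    have i: "integrable (completion \<mu>) \<phi>" "(\<integral>x. \<phi> x \<partial>completion \<mu>) = (\<integral>x. \<phi> x \<partial>\<mu>)"
      using Phi_integrable[OF mu \<phi> r0] by (simp_all add: integrable_completion integral_completion borel_measurable_integrable)
    have "ereal (\<integral>x. \<phi> x \<partial>\<mu>) \<le> ext_integral (completion \<mu>) (RC r C \<psi>)"
      using integral_le_ext_integral[OF RC_measurable[OF uY r0 lsc \<psi> Pr_prob[OF mu] Pr_sets[OF mu]] i(1)] R i(2) by simp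
    then have "ereal (\<integral>y. \<psi> y \<partial>\<nu>) + ereal (\<integral>x. \<phi> x \<partial>\<mu>) \<le> ereal (\<integral>y. \<psi> y \<partial>\<nu>) + ext_integral (completion \<mu>) (RC r C \<psi>)"
      by (rule add_left_mono)
    then show "v \<le> ?mid" unfolding v using \<psi> by (intro SUP_upper2[of \<psi>]) simp_all
  qed
  \<comment> \<open>A supremum of plus infinity is trivial. Minus infinity is impossible, because
    the growth condition makes the pair of \<open>- \<phi>0\<close> and \<open>- \<psi>0\<close>
    admissible.\<close>
  moreover have "?inf \<le> Sup ?T"
  proof (cases "Sup ?T")
    case (real D)
    interpret dual_problem r \<mu> \<nu> C uX uY \<phi>0 \<psi>0 D
    proof
      fix \<phi> :: "'a \<Rightarrow> real" and \<psi> :: "'b \<Rightarrow> real"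
      assume f: "\<phi> \<in> Phi r" "\<psi> \<in> Phi r" "\<And>x p. p \<in> Pr r \<Longrightarrow> ereal (oplus \<phi> \<psi> (x, p)) \<le> C x p"
      then have "ereal ((\<integral>y. \<psi> y \<partial>\<nu>) + (\<integral>x. \<phi> x \<partial>\<mu>)) \<in> ?T" unfolding oplus_def fst_conv snd_conv by blast
      then have "ereal ((\<integral>y. \<psi> y \<partial>\<nu>) + (\<integral>x. \<phi> x \<partial>\<mu>)) \<le> Sup ?T" by (rule Sup_upper)
      then show "(\<integral>x. \<phi> x \<partial>\<mu>) + (\<integral>y. \<psi> y \<partial>\<nu>) \<le> D" unfolding real by simp
    qed (fact uX uY r0 mu nu lsc \<phi>0 \<psi>0 low)+
    obtain P where "P \<in> Lambda \<mu> \<nu>" "ext_integral (completion P) (\<lambda>z. C (fst z) (snd z)) \<le> ereal D"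
      by (rule primal_attains)
    then show ?thesis unfolding real by (rule INF_lower2)
  next
    case MInf
    have "ereal ((\<integral>y. - \<psi>0 y \<partial>\<nu>) + (\<integral>x. - \<phi>0 x \<partial>\<mu>)) \<in> ?T"
      using Phi_minus[OF \<phi>0 r0] Phi_minus[OF \<psi>0 r0] low' by blast
    then have "ereal ((\<integral>y. - \<psi>0 y \<partial>\<nu>) + (\<integral>x. - \<phi>0 x \<partial>\<mu>)) \<le> Sup ?T" by (rule Sup_upper)
    then show ?thesis unfolding MInf by simp
  qed simp
  ultimately show ?thesis by (intro conjI antisym) (auto intro: order_trans)
qed

end
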